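(* Let $d\ge2$, $a_1>a_2\ge\ldots\ge a_d>0$, $a:=a_1$, $E:=\{z\in\mathbb R^d:\sum_{k=1}^d(z_k/a_k)^2\le1\}$ and $\Sigma:=\mathrm{diag}(a_1^2,\ldots,a_d^2)$. Let $f:E\to[0,\infty)$ with $\int_Ef(z)\,\mathrm dz=1$, and suppose there are constants $\alpha_\ell,\alpha_r>0$ and $\beta>-1$ such that, for $z\in\mathrm{int}(E)$, $$\frac{f(z)}{\alpha_\ell(1-z^\top\Sigma^{-1}z)^{\beta}}\to1\ \text{ as } z\to(-a,\mathbf 0),\qquad \frac{f(z)}{\alpha_r(1-z^\top\Sigma^{-1}z)^{\beta}}\to1\ \text{ as } z\to(a,\mathbf 0).$$ Let $Z_1,Z_2,\ldots$ be i.i.d. with density $f$, for each $n$ let $N_n$ be Poisson with mean $n$ and independent of $(Z_i)_{i\ge 1}$, and for $k\in\mathbb N$ let $D_n^{(1)}\ge\ldots\ge D_n^{(k)}$ be the $k$ largest distances, in descending order, among the values $|Z_i-Z_j|$, $1\le i<j\le N_n$. Then, for each fixed $k\ge1$, as $n\to\infty$, $$n^{\frac2{d+1+2\beta}}\big(2a-D_n^{(1)},\ldots,2a-D_n^{(k)}\big)\overset{\mathcal D}{\longrightarrow}\big(t_1(\xi),\ldots,t_k(\xi)\big),$$ where $\xi:=\sum_{i,j\ge1}\varepsilon_{G(\mathcal X_i,\mathcal Y_j)}$, $G(x,y):=x_1+y_1-\frac1{4a}|\widetilde x-\widetilde y|^2$, and $\{\mathcal X_i,i\ge1\}$, $\{\mathcal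 Y_j,j\ge1\}$ are independent Poisson processes with intensity measures $\alpha_\ell\cdot\Lambda_\beta$ and $\alpha_r\cdot\Lambda_\beta$, respectively.
   Context: Notation: $|\cdot|$ is the Euclidean norm, $\varepsilon_t$ the unit point mass at $t$, $\widetilde z:=(z_2,\ldots,z_d)$ for $z\in\mathbb R^d$. For a point process $\xi$ on $[0,\infty)$ and $i\in\mathbb N$, $t_i(\xi):=\inf\{t:\xi([0,t])\ge i\}$. If fewer than $k$ pairs are available, the $D_n^{(i)}$ may be defined arbitrarily (this has probability tending to $0$). With $P(H):=\{z\in\mathbb R^d:\sum_{k=2}^d(z_k/a_k)^2<2z_1/a_1\}$, the measure $\Lambda_\beta$ on $\mathbb R^d$ is defined for Borel sets $B$ by $$\Lambda_\beta(B):=\int_B\Big(\frac{2z_1}{a_1}-\sum_{k=2}^d\Big(\frac{z_k}{a_k}\Big)^2\Big)^\beta\mathbf 1\{z\in P(H)\}\,\mathrm dz.$$ *)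

theory Defs
  imports "HOL-Probability.Probability"
begin

text \<open>
  Vectors in \<open>\<real>\<^sup>d\<close> have type \<open>real ^ 'd\<close> with a finite, linearly ordered index type, \<open>d = CARD('d)\<close>.
  The order is the order of the coordinates: the index \<open>k\<close> in position \<open>i\<close> is the one
  with \<open>card {..k} = i\<close>, and \<open>first\<close> is the index of the coordinate \<open>z\<^sub>1\<close>.
\<close>

definition first :: "'d::{finite,linorder}" where
  "first = Min UNIV"

definition ellipsoid :: "real ^ 'd \<Rightarrow> (real ^ 'd) set" where
  "ellipsoid a = {z. (\<Sum>k\<in>UNIV. (z $ k / a $ k)\<^sup>2) \<le> 1}"

definition Sigma_mat :: "real ^ 'd \<Rightarrow> real ^ 'd ^ 'd" where
  "Sigma_mat a = (\<chi> i j. if i = j then (a $ i)\<^sup>2 else 0)"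

definition P_H :: "real ^ 'd::{finite,linorder} \<Rightarrow> (real ^ 'd::{finite,linorder}) set" where
  "P_H a = {z. (\<Sum>k\<in>UNIV - {first}. (z $ k / a $ k)\<^sup>2) < 2 * z $ first / a $ first}"

definition Lambda :: "real ^ 'd::{finite,linorder} \<Rightarrow> real \<Rightarrow> (real ^ 'd::{finite,linorder}) measure" where
  "Lambda a \<beta> = density lborel (\<lambda>z. ennreal
     ((2 * z $ first / a $ first - (\<Sum>k\<in>UNIV - {first}. (z $ k / a $ k)\<^sup>2)) powr \<beta>
        * indicator (P_H a) z))"

text \<open>
  \<open>tilde z\<close> keeps \<open>(z\<^sub>2, \<dots>, z\<^sub>d)\<close> as a vector of \<open>\<real>\<^sup>d\<close> with vanishing first coordinate;
  its norm is the Euclidean norm of \<open>(z\<^sub>2, \<dots>, z\<^sub>d)\<close>.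
\<close>

definition tilde :: "real ^ 'd::{finite,linorder} \<Rightarrow> real ^ 'd::{finite,linorder}" where
  "tilde z = (\<chi> k. if k = first then 0 else z $ k)"

definition G :: "real ^ 'd::{finite,linorder} \<Rightarrow> real ^ 'd::{finite,linorder} \<Rightarrow> real ^ 'd::{finite,linorder} \<Rightarrow> real" where
  "G a x y = x $ first + y $ first - 1 / (4 * a $ first) * (norm (tilde x - tilde y))\<^sup>2"

definition pair_distances :: "(nat \<Rightarrow> real ^ 'd) \<Rightarrow> nat \<Rightarrow> real multiset" where
  "pair_distances z n =
     image_mset (\<lambda>(i, j). norm (z i - z j)) (mset_set {(i, j). 1 \<le> i \<and> i < j \<and> j \<le> n})"

text \<open>Multiplicities count, and the numbering starts at \<open>i = 1\<close>.\<close>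

definition ith_largest :: "nat \<Rightarrow> real multiset \<Rightarrow> real" where
  "ith_largest i A = rev (sorted_list_of_multiset A) ! (i - 1)"

text \<open>Unlike \<open>indep_var\<close>, the two random variables may have values of different types.\<close>

definition indep_pair ::
  "'w measure \<Rightarrow> 'b measure \<Rightarrow> ('w \<Rightarrow> 'b) \<Rightarrow> 'c measure \<Rightarrow> ('w \<Rightarrow> 'c) \<Rightarrow> bool" where
  "indep_pair M A X B Y \<longleftrightarrow> X \<in> measurable M A \<and> Y \<in> measurable M B \<and>
     prob_space.indep_set M {X -` S \<inter> space M | S. S \<in> sets A} {Y -` T \<inter> space M | T. T \<in> sets B}"

definition converges_in_distribution ::
  "'w measure \<Rightarrow> (nat \<Rightarrow> 'w \<Rightarrow> 'b::topological_space) \<Rightarrow> 'v measure \<Rightarrow> ('v \<Rightarrow> 'b) \<Rightarrow> bool" where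
  "converges_in_distribution M X M' Y \<longleftrightarrow>
     (\<forall>n. X n \<in> borel_measurable M) \<and> Y \<in> borel_measurable M' \<and>
     (\<forall>g :: 'b \<Rightarrow> real. continuous_on UNIV g \<and> bounded (range g) \<longrightarrow>
        (\<lambda>n. \<integral>\<omega>. g (X n \<omega>) \<partial>M) \<longlonglongrightarrow> (\<integral>\<omega>. g (Y \<omega>) \<partial>M'))"

text \<open>\<open>poisson_pmf\<close> is specified for positive means only.\<close>

definition poisson_law :: "real \<Rightarrow> nat pmf" where
  "poisson_law m = (if m = 0 then return_pmf 0 else poisson_pmf m)"

text \<open>
  The sum of the unit point masses at \<open>x i\<close>, \<open>i \<in> I\<close>: the measure of a Borel set \<open>B\<close> is the
  number (possibly \<open>\<infinity>\<close>) of \<open>i \<in> I\<close> with \<open>x i \<in> B\<close>.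
\<close>

definition point_masses :: "'i set \<Rightarrow> ('i \<Rightarrow> 'b::topological_space) \<Rightarrow> 'b measure" where
  "point_masses I x = distr (count_space I) borel x"

definition poisson_process :: "'w measure \<Rightarrow> ('w \<Rightarrow> 'b measure) \<Rightarrow> 'b measure \<Rightarrow> bool" where
  "poisson_process M \<eta> \<mu> \<longleftrightarrow>
     (\<forall>B\<in>sets \<mu>. (\<lambda>\<omega>. emeasure (\<eta> \<omega>) B) \<in> borel_measurable M) \<and>
     (\<forall>B\<in>sets \<mu>. distr M borel (\<lambda>\<omega>. emeasure (\<eta> \<omega>) B) =
        (if emeasure \<mu> B = \<infinity> then return borel \<infinity>
         else distr (measure_pmf (poisson_law (measure \<mu> B))) borel of_nat)) \<and>
     (\<forall>m. \<forall>B :: nat \<Rightarrow> 'b set. (\<forall>i<m. B i \<in> sets \<mu>) \<and> disjoint_family_on B {..<m} \<longrightarrow>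
        prob_space.indep_vars M (\<lambda>_. borel) (\<lambda>i \<omega>. emeasure (\<eta> \<omega>) (B i)) {..<m})"

text \<open>Independence of two random measures, viewed through their values on all Borel sets.\<close>

definition indep_point_processes ::
  "'w measure \<Rightarrow> ('w \<Rightarrow> 'b::topological_space measure) \<Rightarrow> ('w \<Rightarrow> 'b measure) \<Rightarrow> bool" where
  "indep_point_processes M \<eta> \<zeta> \<longleftrightarrow>
     indep_pair M
       (PiM (sets borel) (\<lambda>_. borel)) (\<lambda>\<omega>. \<lambda>B\<in>sets borel. emeasure (\<eta> \<omega>) B)
       (PiM (sets borel) (\<lambda>_. borel)) (\<lambda>\<omega>. \<lambda>B\<in>sets borel. emeasure (\<zeta> \<omega>) B)"

text \<open>For \<open>i \<ge> 1\<close> only \<open>t \<ge> 0\<close> contribute, as \<open>{0..t}\<close> is empty for \<open>t < 0\<close>.\<close>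

definition arrival :: "nat \<Rightarrow> real measure \<Rightarrow> real" where
  "arrival i \<xi> = Inf {t. of_nat i \<le> emeasure \<xi> {0..t}}"

end

(*
Two points of E at distance at least 2a - sK, with s = n^(-2/(d+1+2 beta)) small, must lie near the two
opposite tips. In the charts (x_1, x~) = ((a/2)(1 - (z_1/a)^2)/s, z~/sqrt s) around the tips, E becomes the
paraboloid P(H), the density becomes n times smaller than that of alpha Lambda_beta, and (2a - |z - w|)/s
converges uniformly on bounded sets to G. All pairs that matter below level K thus have charts in a bounded
piece B of P(H). Cut B into finitely many cells on which G is nearly constant. By Poissonization the numbers
of sample points in the cells are independent Poisson variables, and their means converge to those of the
limit processes; so the vector of cell counts converges in law, on a countable space. Up to an error e, both
the scaled defects of the largest distances and the arrival times of xi are the same function of the counts.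
*)

theory Submission
  imports Defs
begin

text \<open>The scaling is forced by the mass at a tip: the chart pulls volume back with the factor
  s^((d+1)/2), the density adds s^\<beta>, and the product is 1/n, which balances a Poisson number
  of points with mean n. What confines everything is a_1 > a_2: with q < 1 the largest squared ratio
  of another semi-axis to a_1, a transverse displacement can make up for at most the share q of a
  loss in the first coordinate. This inequality, before and after scaling, bounds the charts of all
  pairs below level K by the same constant K/(1-q). Finite count vectors avoid a topology on point
  measures and a continuous mapping argument for the double sum: the i-th smallest value need not be
  continuous in anything, because both sides apply literally the same function to their counts. The
  price is that the k-th value may lie above K; that event is read off from the counts too, so its
  probability converges as well. For \<beta> < 0 the intensity is unbounded near the boundary of
  P(H). Masses are compared up to factors 1-e and 1+e, so no direct estimate is needed
  there.\<close>

subsection \<open>The i-th smallest value of a family\<close>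

text \<open>
  For each of the three families of pairs (sample, cells, Poisson limit), \<open>Inf {t. attained i S val t}\<close>
  is the \<open>i\<close>-th smallest value; unlike a count, the predicate also makes sense for infinite \<open>S\<close>.
\<close>

definition attained :: "nat \<Rightarrow> 'p set \<Rightarrow> ('p \<Rightarrow> real) \<Rightarrow> real \<Rightarrow> bool" where
  "attained i S val t \<longleftrightarrow> (\<exists>F\<subseteq>S. finite F \<and> card F = i \<and> (\<forall>p\<in>F. val p \<le> t))"

lemma attained_mono:
  assumes "attained i S val t" "j \<le> i" "t \<le> u"
  shows "attained j S val u"
proof -
  obtain F where F: "F \<subseteq> S" "finite F" "card F = i" "\<forall>p\<in>F. val p \<le> t"
    using assms(1) by (auto simp: attained_def)
  obtain F' where "F' \<subseteq> F" "card F' = j"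
    using obtain_subset_with_card_n[of j F] F(3) assms(2) by auto
  moreover from this have "val p \<le> u" if "p \<in> F'" for p
    using F(4) that assms(3) by force
  ultimately show ?thesis
    using F finite_subset[of F' F] unfolding attained_def by (intro exI[of _ F']) auto
qed

text \<open>An injection is enough to carry \<open>i\<close> witnesses from one family to the other,
  so the two directions of a comparison may use unrelated maps; no bijection between the families
  has to exist.\<close>

lemma attained_inj:
  assumes "attained i S val t"
    and "\<And>p. p \<in> S \<Longrightarrow> val p \<le> t \<Longrightarrow> \<phi> p \<in> S' \<and> val' (\<phi> p) \<le> t'"
    and "inj_on \<phi> {p\<in>S. val p \<le> t}"
  shows "attained i S' val' t'"
proof -
  obtain F where F: "F \<subseteq> S" "finite F" "card F = i" "\<forall>p\<in>F. val p \<le> t"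
    using assms(1) by (auto simp: attained_def)
  have "inj_on \<phi> F"
    by (rule inj_on_subset[OF assms(3)]) (use F in auto)
  hence "card (\<phi> ` F) = i" using F by (simp add: card_image)
  thus ?thesis using F assms(2) unfolding attained_def
    by (intro exI[of _ "\<phi> ` F"]) auto
qed

text \<open>Bridge to \<open>arrival\<close>, which counts with an extended measure: when infinitely
  many values lie below \<open>t\<close>, both sides hold for every \<open>i\<close>.\<close>

lemma attained_iff_emeasure:
  "attained i S val t \<longleftrightarrow> of_nat i \<le> emeasure (count_space S) {p\<in>S. val p \<le> t}"
proof (cases "finite {p\<in>S. val p \<le> t}")
  case True
  have "attained i S val t \<longleftrightarrow> i \<le> card {p\<in>S. val p \<le> t}"
  proof
    assume "attained i S val t"
    then obtain F where "F \<subseteq> S" "card F = i" "\<forall>p\<in>F. val p \<le> t"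
      by (auto simp: attained_def)
    thus "i \<le> card {p\<in>S. val p \<le> t}" using True by (auto intro: card_mono)
  next
    assume "i \<le> card {p\<in>S. val p \<le> t}"
    then obtain F where "F \<subseteq> {p\<in>S. val p \<le> t}" "card F = i" "finite F"
      by (rule obtain_subset_with_card_n)
    thus "attained i S val t" by (auto simp: attained_def)
  qed
  thus ?thesis using True by (simp add: emeasure_count_space)
next
  case False
  then obtain F where "F \<subseteq> {p\<in>S. val p \<le> t}" "card F = i" "finite F"
    using infinite_arbitrarily_large[of _ i] by blast
  thus ?thesis using False by (auto simp: attained_def emeasure_count_space_infinite)
qed

lemma attained_iff_card:
  assumes "finite S"
  shows "attained i S val t \<longleftrightarrow> i \<le> card {p\<in>S. val p \<le> t}"
  using assms by (simp add: attained_iff_emeasure emeasure_count_space)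

lemma attained_nonneg:
  assumes "attained i S val t" "i \<ge> 1" "\<And>p. p \<in> S \<Longrightarrow> val p \<ge> 0"
  shows "t \<ge> 0"
proof -
  obtain F where F: "F \<subseteq> S" "card F = i" "\<forall>p\<in>F. val p \<le> t"
    using assms(1) by (auto simp: attained_def)
  then obtain p where "p \<in> F" using assms(2) by (metis card.empty ex_in_conv not_one_le_zero)
  thus ?thesis using F assms(3)[of p] by (meson order_trans subsetD)
qed

text \<open>The two sets are comparable only up to level \<open>K\<close>. The witness
  \<open>K - e\<close> of \<open>SB\<close> puts \<open>K\<close> into \<open>SA\<close>, so both
  infima are at most \<open>K\<close>, and elements above \<open>K\<close> satisfy the required
  lower bounds automatically.\<close>

lemma Inf_close:
  fixes SA SB :: "real set"
  assumes "\<And>t. t \<in> SA \<Longrightarrow> 0 \<le> t" "\<And>t. t \<in> SB \<Longrightarrow> 0 \<le> t"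
    and "K - e \<in> SB"
    and "\<And>t. t \<in> SA \<Longrightarrow> t \<le> K \<Longrightarrow> t + e \<in> SB"
    and "\<And>t. t \<in> SB \<Longrightarrow> t \<le> K \<Longrightarrow> t + e \<in> SA"
    and "e \<ge> 0"
  shows "\<bar>Inf SA - Inf SB\<bar> \<le> e" "0 \<le> Inf SB" "Inf SB \<le> K - e" "0 \<le> Inf SA" "Inf SA \<le> K"
proof -
  have bA: "bdd_below SA" and bB: "bdd_below SB" using assms(1,2) by (auto simp: bdd_below_def)
  have KA: "K \<in> SA" using assms(5)[OF assms(3)] assms(6) by simp
  have *: "Inf SA - e \<le> Inf SB"
  proof (rule cInf_greatest)
    fix t assume t: "t \<in> SB"
    show "Inf SA - e \<le> t"
      using cInf_lower[OF assms(5)[OF t] bA] cInf_lower[OF KA bA] assms(6)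
        cInf_lower[OF assms(5)[OF assms(3)] bA]
      by (cases "t \<le> K") auto
  qed (use assms(3) in auto)
  have **: "Inf SB - e \<le> Inf SA"
  proof (rule cInf_greatest)
    fix t assume t: "t \<in> SA"
    show "Inf SB - e \<le> t"
      using cInf_lower[OF assms(4)[OF t] bB] cInf_lower[OF assms(3) bB] assms(6)
      by (cases "t \<le> K") auto
  qed (use KA in auto)
  show "\<bar>Inf SA - Inf SB\<bar> \<le> e" using * ** by auto
  show "0 \<le> Inf SB" using assms(2,3) by (intro cInf_greatest) auto
  show "Inf SB \<le> K - e" using assms(3) bB by (rule cInf_lower)
  show "0 \<le> Inf SA" using assms(1) KA by (intro cInf_greatest) auto
  show "Inf SA \<le> K" using KA bA by (rule cInf_lower)
qed

section \<open>Order statistics of finite multisets\<close>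

lemma le_nth_iff_descending:
  fixes ys :: "real list"
  assumes "sorted_wrt (\<ge>) ys" "1 \<le> i" "i \<le> length ys"
  shows "u \<le> ys ! (i - 1) \<longleftrightarrow> i \<le> length (filter (\<lambda>y. u \<le> y) ys)"
  using assms
proof (induction ys arbitrary: i)
  case (Cons y ys)
  show ?case
  proof (cases "u \<le> y")
    case True
    show ?thesis
    proof (cases "i = 1")
      case False
      then obtain j where j: "i = Suc j" "j \<ge> 1" using Cons.prems by (cases i) auto
      have "u \<le> ys ! (j - 1) \<longleftrightarrow> j \<le> length (filter (\<lambda>y. u \<le> y) ys)"
        using Cons.prems j by (intro Cons.IH) auto
      thus ?thesis using True j by (auto simp: nth_Cons')
    qed (use True in auto)
  next
    case False
    have *: "filter (\<lambda>y. u \<le> y) ys = []"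
      using False Cons.prems(1) by (auto simp: filter_empty_conv)
    have "(y # ys) ! (i - 1) \<in> set (y # ys)" using Cons.prems by (intro nth_mem) auto
    hence "(y # ys) ! (i - 1) \<le> y" using Cons.prems(1) by auto
    thus ?thesis using False * Cons.prems by auto
  qed
qed simp

lemma le_ith_largest_iff:
  assumes "1 \<le> i" "i \<le> size A"
  shows "u \<le> ith_largest i A \<longleftrightarrow> i \<le> size (filter_mset (\<lambda>y. u \<le> y) A)"
proof -
  let ?ys = "rev (sorted_list_of_multiset A)"
  have "sorted (rev ?ys)" by simp
  hence s: "sorted_wrt (\<ge>) ?ys" by (simp only: sorted_wrt_rev rev_rev_ident)
  have m: "mset ?ys = A" by simp
  have l: "length ?ys = size A" by (metis m size_mset)
  have f: "length (filter (\<lambda>y. u \<le> y) ?ys) = size (filter_mset (\<lambda>y. u \<le> y) A)"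
    by (metis m mset_filter size_mset)
  show ?thesis unfolding ith_largest_def
    using le_nth_iff_descending[OF s assms(1), of u] assms l f by simp
qed

text \<open>Large values of \<open>f\<close> are small defects \<open>c - f\<close>. The attained
  levels form the closed half-line that starts at the i-th smallest scaled defect, so
  \<open>Inf\<close> returns it exactly, ties included.\<close>

lemma ith_largest_eq_Inf:
  fixes f :: "'p \<Rightarrow> real"
  assumes "finite P" "1 \<le> i" "i \<le> card P" "s > 0"
  shows "(c - ith_largest i (image_mset f (mset_set P))) / s =
    Inf {t. attained i P (\<lambda>p. (c - f p) / s) t}"
proof -
  let ?A = "image_mset f (mset_set P)"
  have sz: "size ?A = card P" by simp
  have "attained i P (\<lambda>p. (c - f p) / s) t \<longleftrightarrow> (c - ith_largest i ?A) / s \<le> t" for t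
  proof -
    have "attained i P (\<lambda>p. (c - f p) / s) t \<longleftrightarrow> i \<le> card {p\<in>P. (c - f p) / s \<le> t}"
      using assms(1) by (rule attained_iff_card)
    also have "{p\<in>P. (c - f p) / s \<le> t} = {p\<in>P. c - s * t \<le> f p}"
      using assms(4) by (auto simp: field_simps)
    also have "card \<dots> = size (filter_mset (\<lambda>y. c - s * t \<le> y) ?A)"
      using assms(1) by (simp add: filter_mset_image_mset filter_mset_mset_set)
    also have "i \<le> \<dots> \<longleftrightarrow> c - s * t \<le> ith_largest i ?A"
      using le_ith_largest_iff[of i ?A] assms sz by simp
    also have "\<dots> \<longleftrightarrow> (c - ith_largest i ?A) / s \<le> t"
      using assms(4) by (auto simp: field_simps)
    finally show ?thesis .
  qed
  hence "{t. attained i P (\<lambda>p. (c - f p) / s) t} = {(c - ith_largest i ?A) / s ..}" by auto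
  thus ?thesis by simp
qed

text \<open>On a countable type, convergence of the point probabilities to a probability leaves no room for
  mass to escape (Scheffe), hence gives convergence of all bounded expectations.\<close>

lemma tendsto_expectation_countable:
  fixes V :: "nat \<Rightarrow> 'w \<Rightarrow> 'c::countable" and V' :: "'v \<Rightarrow> 'c" and h :: "'c \<Rightarrow> real"
  assumes M: "prob_space M" and M': "prob_space M'"
    and V: "\<And>n. V n \<in> measurable M (count_space UNIV)"
    and V': "V' \<in> measurable M' (count_space UNIV)"
    and lim: "\<And>l. (\<lambda>n. measure M {\<omega>\<in>space M. V n \<omega> = l}) \<longlonglongrightarrow> measure M' {\<omega>\<in>space M'. V' \<omega> = l}"
    and h: "\<And>l. \<bar>h l\<bar> \<le> C"
  shows "(\<lambda>n. \<integral>\<omega>. h (V n \<omega>) \<partial>M) \<longlonglongrightarrow> (\<integral>\<omega>. h (V' \<omega>) \<partial>M')"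
proof -
  interpret M: prob_space M by fact
  interpret M': prob_space M' by fact
  have C: "C \<ge> 0" using h[of undefined] by linarith
  define q where "q l = measure M' {\<omega>\<in>space M'. V' \<omega> = l}" for l
  define p where "p n l = measure M {\<omega>\<in>space M. V n \<omega> = l}" for n l
  \<comment> \<open>Truncation bound for one law at a time, over an arbitrary probability space, so
    that it serves both \<open>M\<close> and \<open>M'\<close>; the right-hand side involves only
    the point probabilities in \<open>F\<close>.\<close>
  have key: "\<bar>(\<integral>\<omega>. h (U \<omega>) \<partial>L) - (\<Sum>l\<in>F. h l * measure L {\<omega>\<in>space L. U \<omega> = l})\<bar>
      \<le> C * (1 - (\<Sum>l\<in>F. measure L {\<omega>\<in>space L. U \<omega> = l}))"
    if L: "prob_space L" and U: "U \<in> measurable L (count_space UNIV)" and F: "finite F"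
    for L :: "'z measure" and U :: "'z \<Rightarrow> 'c" and F
  proof -
    interpret L: prob_space L by fact
    have [measurable]: "U \<in> measurable L (count_space UNIV)" by fact
    have ind: "(indicator F (U x) :: real) = (\<Sum>l\<in>F. indicator {\<omega>\<in>space L. U \<omega> = l} x)"
      if "x \<in> space L" for x :: 'z
    proof -
      have "(\<Sum>l\<in>F. indicator {\<omega>\<in>space L. U \<omega> = l} x :: real) = (\<Sum>l\<in>F. if l = U x then (1::real) else 0)"
        using that by (intro sum.cong) (auto simp: indicator_def)
      also have "\<dots> = indicator F (U x)" using F by (simp add: indicator_def)
      finally show ?thesis ..
    qed
    have hind: "h (U x) * indicator F (U x) = (\<Sum>l\<in>F. h l * indicator {\<omega>\<in>space L. U \<omega> = l} x)"
      if "x \<in> space L" for x :: 'z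
    proof -
      have "(\<Sum>l\<in>F. h l * indicator {\<omega>\<in>space L. U \<omega> = l} x) = (\<Sum>l\<in>F. if l = U x then h (U x) else 0)"
        using that by (intro sum.cong) (auto simp: indicator_def)
      also have "\<dots> = h (U x) * indicator F (U x)" using F by (simp add: indicator_def)
      finally show ?thesis ..
    qed
    have int_h: "integrable L (\<lambda>x. h (U x))"
      by (rule L.integrable_const_bound[where B = C]) (simp_all add: h)
    have int_hi: "integrable L (\<lambda>x. h (U x) * indicator F (U x))"
      by (rule L.integrable_const_bound[where B = C]) (simp_all add: indicator_def h C)
    have int_l: "integrable L (indicator {\<omega>\<in>space L. U \<omega> = l} :: 'z \<Rightarrow> real)" for l
      by (rule L.integrable_const_bound[where B = 1]) (simp_all add: indicator_def)
    have int_i: "integrable L (\<lambda>x. indicator F (U x) :: real)"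
      by (rule L.integrable_const_bound[where B = 1]) (auto simp: indicator_def)
    have "(\<integral>x. h (U x) * indicator F (U x) \<partial>L) = (\<integral>x. (\<Sum>l\<in>F. h l * indicator {\<omega>\<in>space L. U \<omega> = l} x) \<partial>L)"
      by (intro Bochner_Integration.integral_cong refl hind)
    also have "\<dots> = (\<Sum>l\<in>F. h l * measure L {\<omega>\<in>space L. U \<omega> = l})"
      by (subst Bochner_Integration.integral_sum) (auto intro!: integrable_mult_right int_l)
    finally have e1: "(\<integral>x. h (U x) * indicator F (U x) \<partial>L) = (\<Sum>l\<in>F. h l * measure L {\<omega>\<in>space L. U \<omega> = l})" .
    have "(\<integral>x. indicator F (U x) \<partial>L) = (\<integral>x. (\<Sum>l\<in>F. indicator {\<omega>\<in>space L. U \<omega> = l} x :: real) \<partial>L)"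
      by (intro Bochner_Integration.integral_cong refl ind)
    also have "\<dots> = (\<Sum>l\<in>F. measure L {\<omega>\<in>space L. U \<omega> = l})"
      by (subst Bochner_Integration.integral_sum) (auto intro!: int_l)
    finally have e2: "(\<integral>x. indicator F (U x) \<partial>L) = (\<Sum>l\<in>F. measure L {\<omega>\<in>space L. U \<omega> = l})" .
    have "\<bar>(\<integral>x. h (U x) \<partial>L) - (\<integral>x. h (U x) * indicator F (U x) \<partial>L)\<bar> =
        \<bar>\<integral>x. h (U x) - h (U x) * indicator F (U x) \<partial>L\<bar>"
      by (simp only: Bochner_Integration.integral_diff[OF int_h int_hi])
    also have "\<dots> \<le> (\<integral>x. \<bar>h (U x) - h (U x) * indicator F (U x)\<bar> \<partial>L)"
      by (rule integral_abs_bound)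
    also have "\<dots> \<le> (\<integral>x. C * (1 - indicator F (U x)) \<partial>L)"
    proof (rule integral_mono)
      show "integrable L (\<lambda>x. \<bar>h (U x) - h (U x) * indicator F (U x)\<bar>)" using int_h int_hi by simp
      show "integrable L (\<lambda>x. C * (1 - indicator F (U x)))" using int_i by simp
      show "\<bar>h (U x) - h (U x) * indicator F (U x)\<bar> \<le> C * (1 - indicator F (U x))" for x
        using h[of "U x"] C by (simp add: indicator_def)
    qed
    also have "\<dots> = C * (1 - (\<integral>x. indicator F (U x) \<partial>L))"
      using int_i by (simp add: L.prob_space)
    finally show ?thesis unfolding e1 e2 .
  qed
  show ?thesis
  proof (rule LIMSEQ_I)
    fix r :: real assume r: "r > 0"
    \<comment> \<open>Each of the two tails costs at most \<open>C * \<eta>\<close>, hence r/4, and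
      the finite sum gets r/2; \<open>C + 1\<close> avoids a division by zero.\<close>
    define \<eta> where "\<eta> = r / (4 * (C + 1))"
    have \<eta>: "\<eta> > 0" using r C by (simp add: \<eta>_def)
    \<comment> \<open>The enumeration \<open>to_nat\<close> provides an exhaustion of the type by
      finite sets of values.\<close>
    define A where "A m = {\<omega>\<in>space M'. to_nat (V' \<omega>) < m}" for m :: nat
    have "(\<lambda>m. measure M' (A m)) \<longlonglongrightarrow> measure M' (\<Union>m. A m)"
      using V' by (intro M'.finite_Lim_measure_incseq) (auto simp: A_def incseq_def)
    moreover have "(\<Union>m. A m) = space M'" by (auto simp: A_def)
    ultimately have "(\<lambda>m. measure M' (A m)) \<longlonglongrightarrow> 1" by (simp add: M'.prob_space)
    hence "eventually (\<lambda>m. measure M' (A m) > 1 - \<eta>) sequentially"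
      using \<eta> by (intro order_tendstoD) auto
    then obtain m where m: "measure M' (A m) > 1 - \<eta>" by (auto simp: eventually_sequentially)
    define F where "F = {l::'c. to_nat l < m}"
    have F: "finite F"
    proof (rule finite_imageD)
      show "finite (to_nat ` F)" by (rule finite_subset[of _ "{..<m}"]) (auto simp: F_def)
      show "inj_on to_nat F" by simp
    qed
    have AF: "measure M' (A m) = (\<Sum>l\<in>F. q l)"
    proof -
      have "A m = (\<Union>l\<in>F. {\<omega>\<in>space M'. V' \<omega> = l})" by (auto simp: A_def F_def)
      also have "measure M' \<dots> = (\<Sum>l\<in>F. q l)"
        unfolding q_def using F V' by (intro M'.finite_measure_finite_Union) (auto simp: disjoint_family_on_def)
      finally show ?thesis .
    qed
    have l1: "(\<lambda>n. \<Sum>l\<in>F. p n l) \<longlonglongrightarrow> (\<Sum>l\<in>F. q l)"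
      unfolding p_def q_def by (intro tendsto_sum lim)
    have l2: "(\<lambda>n. \<Sum>l\<in>F. h l * p n l) \<longlonglongrightarrow> (\<Sum>l\<in>F. h l * q l)"
      unfolding p_def q_def by (intro tendsto_sum tendsto_mult tendsto_const lim)
    have "eventually (\<lambda>n. (\<Sum>l\<in>F. p n l) > 1 - \<eta>) sequentially"
      using l1 m AF by (intro order_tendstoD) auto
    moreover have "eventually (\<lambda>n. dist (\<Sum>l\<in>F. h l * p n l) (\<Sum>l\<in>F. h l * q l) < r / 2) sequentially"
      using l2 r by (intro tendstoD) auto
    ultimately have "eventually (\<lambda>n. norm ((\<integral>\<omega>. h (V n \<omega>) \<partial>M) - (\<integral>\<omega>. h (V' \<omega>) \<partial>M')) < r) sequentially"
    proof eventually_elim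
      case (elim n)
      have k1: "\<bar>(\<integral>\<omega>. h (V n \<omega>) \<partial>M) - (\<Sum>l\<in>F. h l * p n l)\<bar> \<le> C * (1 - (\<Sum>l\<in>F. p n l))"
        unfolding p_def using key[OF M V F] .
      have k2: "\<bar>(\<integral>\<omega>. h (V' \<omega>) \<partial>M') - (\<Sum>l\<in>F. h l * q l)\<bar> \<le> C * (1 - (\<Sum>l\<in>F. q l))"
        unfolding q_def using key[OF M' V' F] .
      have "C * (1 - (\<Sum>l\<in>F. p n l)) \<le> C * \<eta>" "C * (1 - (\<Sum>l\<in>F. q l)) \<le> C * \<eta>"
        using elim m AF C by (auto intro!: mult_left_mono)
      moreover have "C * \<eta> \<le> r / 4" using C r by (simp add: \<eta>_def divide_simps)
      ultimately show ?case using k1 k2 elim(2) unfolding dist_real_def real_norm_def by linarith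
    qed
    thus "\<exists>no. \<forall>n\<ge>no. norm ((\<integral>\<omega>. h (V n \<omega>) \<partial>M) - (\<integral>\<omega>. h (V' \<omega>) \<partial>M')) < r"
      by (simp add: eventually_sequentially)
  qed
qed

subsection \<open>Counting Poisson points\<close>

text \<open>Since 0 ^ 0 = 1, the usual formula also covers the degenerate law of mean 0, which
  occurs for cells of mass zero.\<close>

lemma pmf_poisson_law:
  assumes "x \<ge> 0"
  shows "pmf (poisson_law x) k = x ^ k / fact k * exp (- x)"
proof (cases "x = 0")
  case True
  thus ?thesis by (cases k) (auto simp: poisson_law_def)
next
  case False
  thus ?thesis using assms by (simp add: poisson_law_def poisson_pmf.rep_eq)
qed

text \<open>The multinomial coefficient, counted through labellings by induction on
  \<open>I\<close>: giving the new index the label \<open>y\<close> leaves the counts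
  \<open>v(y := v y - 1)\<close> for the others and contributes the share \<open>v y\<close>; these
  shares add up to the new cardinality.\<close>

lemma sum_prod_labellings:
  fixes p :: "'c \<Rightarrow> real"
  assumes "finite I" "finite C" "(\<Sum>c\<in>C. v c) = card I"
  shows "(\<Sum>l\<in>I \<rightarrow>\<^sub>E C. if \<forall>c\<in>C. card {i\<in>I. l i = c} = v c then \<Prod>i\<in>I. p (l i) else 0) =
    fact (card I) * (\<Prod>c\<in>C. p c ^ v c / fact (v c))"
  using assms(1,3)
proof (induction I arbitrary: v rule: finite_induct)
  case empty
  hence "\<forall>c\<in>C. v c = 0" using assms(2) by simp
  thus ?case by simp
next
  case (insert x I)
  let ?T = "\<Prod>c\<in>C. p c ^ v c / fact (v c)"
  have inj: "inj_on (\<lambda>(y, g). g(x := y)) (C \<times> (I \<rightarrow>\<^sub>E C))"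
    using insert.hyps(2) by (intro inj_combinator)
  have cnt: "card {i\<in>insert x I. (g(x := y)) i = c} = card {i\<in>I. g i = c} + (if c = y then 1 else 0)"
    for y g c
  proof -
    have "{i\<in>insert x I. (g(x := y)) i = c} = {i\<in>I. g i = c} \<union> (if c = y then {x} else {})"
      using insert.hyps(2) by auto
    thus ?thesis using insert.hyps by (auto simp: card_Un_disjoint)
  qed
  have prd: "(\<Prod>i\<in>insert x I. p ((g(x := y)) i)) = p y * (\<Prod>i\<in>I. p (g i))" for y g
  proof -
    have "(\<Prod>i\<in>I. p ((g(x := y)) i)) = (\<Prod>i\<in>I. p (g i))"
      using insert.hyps(2) by (intro prod.cong) auto
    thus ?thesis using insert.hyps by simp
  qed
  have step: "(\<Sum>g\<in>I \<rightarrow>\<^sub>E C. if \<forall>c\<in>C. card {i\<in>insert x I. (g(x := y)) i = c} = v c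
        then \<Prod>i\<in>insert x I. p ((g(x := y)) i) else 0) = fact (card I) * real (v y) * ?T"
    if y: "y \<in> C" for y
  proof (cases "v y = 0")
    case True
    \<comment> \<open>A labelling that gives \<open>x\<close> the label \<open>y\<close> cannot have
      count 0 there, in accordance with the factor \<open>v y\<close> on the right.\<close>
    have "\<not> (\<forall>c\<in>C. card {i\<in>insert x I. (g(x := y)) i = c} = v c)" for g
      unfolding cnt using True y by (intro notI) (drule bspec[OF _ y], simp)
    hence "(\<Sum>g\<in>I \<rightarrow>\<^sub>E C. if \<forall>c\<in>C. card {i\<in>insert x I. (g(x := y)) i = c} = v c
        then \<Prod>i\<in>insert x I. p ((g(x := y)) i) else 0) = (\<Sum>g\<in>I \<rightarrow>\<^sub>E C. 0)"
      by (intro sum.cong refl if_not_P)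
    thus ?thesis using True by simp
  next
    case False
    define w where "w = v(y := v y - 1)"
    have eq: "(\<forall>c\<in>C. card {i\<in>insert x I. (g(x := y)) i = c} = v c) \<longleftrightarrow>
        (\<forall>c\<in>C. card {i\<in>I. g i = c} = w c)" for g
      unfolding cnt w_def using False by auto
    have sw: "(\<Sum>c\<in>C. v c) = Suc (\<Sum>c\<in>C. w c)"
    proof -
      have "(\<Sum>c\<in>C. v c) = v y + (\<Sum>c\<in>C - {y}. v c)" using y assms(2) by (simp add: sum.remove)
      moreover have "(\<Sum>c\<in>C. w c) = (v y - 1) + (\<Sum>c\<in>C - {y}. w c)"
        using y assms(2) by (simp add: sum.remove w_def)
      moreover have "(\<Sum>c\<in>C - {y}. w c) = (\<Sum>c\<in>C - {y}. v c)"
        by (intro sum.cong) (auto simp: w_def)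
      ultimately show ?thesis using False by simp
    qed
    hence IH: "(\<Sum>l\<in>I \<rightarrow>\<^sub>E C. if \<forall>c\<in>C. card {i\<in>I. l i = c} = w c then \<Prod>i\<in>I. p (l i) else 0) =
      fact (card I) * (\<Prod>c\<in>C. p c ^ w c / fact (w c))"
      using insert by (intro insert.IH) simp
    have T: "p y * (\<Prod>c\<in>C. p c ^ w c / fact (w c)) = real (v y) * ?T"
    proof -
      obtain k where k: "v y = Suc k" using False by (cases "v y") auto
      have "(\<Prod>c\<in>C - {y}. p c ^ w c / fact (w c)) = (\<Prod>c\<in>C - {y}. p c ^ v c / fact (v c))"
        by (intro prod.cong) (auto simp: w_def)
      thus ?thesis using y assms(2) k
        by (simp add: prod.remove[of C y] w_def field_simps del: of_nat_Suc)
    qed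
    have "(\<Sum>g\<in>I \<rightarrow>\<^sub>E C. if \<forall>c\<in>C. card {i\<in>insert x I. (g(x := y)) i = c} = v c
        then \<Prod>i\<in>insert x I. p ((g(x := y)) i) else 0) =
      p y * (\<Sum>l\<in>I \<rightarrow>\<^sub>E C. if \<forall>c\<in>C. card {i\<in>I. l i = c} = w c then \<Prod>i\<in>I. p (l i) else 0)"
      unfolding eq prd sum_distrib_left by (intro sum.cong refl) auto
    thus ?thesis unfolding IH using T by (simp add: mult_ac)
  qed
  have "(\<Sum>l\<in>insert x I \<rightarrow>\<^sub>E C. if \<forall>c\<in>C. card {i\<in>insert x I. l i = c} = v c
        then \<Prod>i\<in>insert x I. p (l i) else 0) =
      (\<Sum>(y, g)\<in>C \<times> (I \<rightarrow>\<^sub>E C). if \<forall>c\<in>C. card {i\<in>insert x I. (g(x := y)) i = c} = v c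
        then \<Prod>i\<in>insert x I. p ((g(x := y)) i) else 0)"
    unfolding PiE_insert_eq by (subst sum.reindex[OF inj]) (simp add: case_prod_unfold o_def)
  also have "\<dots> = (\<Sum>y\<in>C. fact (card I) * real (v y) * ?T)"
    unfolding sum.cartesian_product[symmetric] by (intro sum.cong refl step)
  also have "\<dots> = fact (card I) * (\<Sum>y\<in>C. real (v y)) * ?T"
    by (simp add: sum_distrib_left sum_distrib_right)
  also have "(\<Sum>y\<in>C. real (v y)) = real (card (insert x I))"
    using insert.prems by (metis of_nat_sum)
  finally show ?case using insert.hyps by (simp add: mult_ac)
qed

text \<open>Label \<open>r\<close> collects everything outside the cells of interest; summing over its count \<open>j\<close> turns the
  multinomial probabilities into a product of Poisson probabilities.\<close>

lemma poissonized_label_counts: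
  fixes Z :: "nat \<Rightarrow> 'w \<Rightarrow> 'b::topological_space" and lab :: "'b \<Rightarrow> nat"
  assumes M: "prob_space M"
    and Z: "prob_space.indep_vars M (\<lambda>_. borel) Z {1..}"
    and N: "distr M (count_space UNIV) N = measure_pmf (poisson_law \<nu>)" "\<nu> \<ge> 0"
    and NZ: "indep_pair M (count_space UNIV) N (PiM {1..} (\<lambda>_. borel)) (\<lambda>\<omega>. \<lambda>i\<in>{1..}. Z i \<omega>)"
    and lab: "lab \<in> measurable borel (count_space UNIV)" "\<And>z. lab z \<le> r"
    and p: "\<And>i c. i \<ge> 1 \<Longrightarrow> measure M {\<omega>\<in>space M. lab (Z i \<omega>) = c} = p c"
  shows "measure M {\<omega>\<in>space M. \<forall>c<r. card {i\<in>{1..N \<omega>}. lab (Z i \<omega>) = c} = v c} =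
    (\<Prod>c<r. pmf (poisson_law (\<nu> * p c)) (v c))"
proof -
  interpret prob_space M by fact
  have Nm[measurable]: "N \<in> measurable M (count_space UNIV)"
    and ind: "indep_set {N -` S \<inter> space M |S. S \<in> sets (count_space UNIV)}
      {(\<lambda>\<omega>. \<lambda>i\<in>{1..}. Z i \<omega>) -` T \<inter> space M |T. T \<in> sets (PiM {1..} (\<lambda>_. borel))}"
    using NZ by (auto simp: indep_pair_def)
  have Zm: "Z i \<in> borel_measurable M" if "i \<ge> 1" for i
    using Z that by (auto simp: indep_vars_def)
  note [measurable] = lab(1)
  have lZm: "(\<lambda>\<omega>. lab (Z i \<omega>)) \<in> measurable M (count_space UNIV)" if "i \<ge> 1" for i
    using Zm[OF that] lab(1) by measurable
  define E where "E m l = {\<omega>\<in>space M. N \<omega> = m \<and> (\<forall>i\<in>{1..m}. lab (Z i \<omega>) = l i)}" for m l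
  have Elab: "{\<omega>\<in>space M. \<forall>i\<in>{1..m}. lab (Z i \<omega>) = l i} \<in> sets M" for m and l :: "nat \<Rightarrow> nat"
    using lZm by measurable
  have Em: "E m l \<in> sets M" for m l
  proof -
    have "E m l = {\<omega>\<in>space M. N \<omega> = m} \<inter> {\<omega>\<in>space M. \<forall>i\<in>{1..m}. lab (Z i \<omega>) = l i}"
      by (auto simp: E_def)
    thus ?thesis using Elab[of m l] by simp
  qed
  have PN: "prob {\<omega>\<in>space M. N \<omega> = m} = \<nu> ^ m / fact m * exp (- \<nu>)" for m
  proof -
    have "prob {\<omega>\<in>space M. N \<omega> = m} = measure (distr M (count_space UNIV) N) {m}"
      by (subst measure_distr) (auto intro!: arg_cong[where f = prob])
    also have "\<dots> = pmf (poisson_law \<nu>) m" unfolding N by (simp add: measure_pmf_single)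
    finally show ?thesis using N(2) by (simp add: pmf_poisson_law)
  qed
  have PL: "prob {\<omega>\<in>space M. \<forall>i\<in>{1..m}. lab (Z i \<omega>) = l i} = (\<Prod>i\<in>{1..m}. p (l i))" for m l
  proof (cases "m = 0")
    case True
    thus ?thesis by (simp add: prob_space)
  next
    case False
    have "{\<omega>\<in>space M. \<forall>i\<in>{1..m}. lab (Z i \<omega>) = l i} =
        (\<Inter>i\<in>{1..m}. Z i -` (lab -` {l i}) \<inter> space M)"
      using False by auto
    also have "prob \<dots> = (\<Prod>i\<in>{1..m}. prob (Z i -` (lab -` {l i}) \<inter> space M))"
    proof (rule indep_varsD[OF Z])
      show "lab -` {l i} \<in> sets borel" for i
        using measurable_sets[OF lab(1), of "{l i}"] by simp
    qed (use False in auto)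
    also have "\<dots> = (\<Prod>i\<in>{1..m}. p (l i))"
    proof (intro prod.cong refl)
      fix i assume "i \<in> {1..m}"
      moreover have "Z i -` (lab -` {l i}) \<inter> space M = {\<omega>\<in>space M. lab (Z i \<omega>) = l i}" by auto
      ultimately show "prob (Z i -` (lab -` {l i}) \<inter> space M) = p (l i)" using p[of i "l i"] by simp
    qed
    finally show ?thesis .
  qed
  have PE: "prob (E m l) = \<nu> ^ m / fact m * exp (- \<nu>) * (\<Prod>i\<in>{1..m}. p (l i))" for m l
  proof -
    let ?T = "{y\<in>space (PiM {1..} (\<lambda>_. borel)). \<forall>i\<in>{1..m}. lab (y i) = l i}"
    have T: "?T \<in> sets (PiM {1..} (\<lambda>_. borel :: 'b measure))"
    proof -
      have "(\<lambda>y. lab (y i)) \<in> measurable (PiM {1..} (\<lambda>_. borel :: 'b measure)) (count_space UNIV)"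
        if "i \<in> {1..m}" for i
        using that by (intro measurable_compose[OF _ lab(1)] measurable_component_singleton) auto
      thus ?thesis by measurable
    qed
    have "E m l = (N -` {m} \<inter> space M) \<inter> ((\<lambda>\<omega>. \<lambda>i\<in>{1..}. Z i \<omega>) -` ?T \<inter> space M)"
      by (auto simp: E_def space_PiM)
    also have "prob \<dots> = prob (N -` {m} \<inter> space M) * prob ((\<lambda>\<omega>. \<lambda>i\<in>{1..}. Z i \<omega>) -` ?T \<inter> space M)"
      using T by (intro indep_setD[OF ind]) (unfold sets_count_space, blast+)
    also have "N -` {m} \<inter> space M = {\<omega>\<in>space M. N \<omega> = m}" by auto
    also have "(\<lambda>\<omega>. \<lambda>i\<in>{1..}. Z i \<omega>) -` ?T \<inter> space M = {\<omega>\<in>space M. \<forall>i\<in>{1..m}. lab (Z i \<omega>) = l i}"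
      by (auto simp: space_PiM)
    finally show ?thesis unfolding PN PL .
  qed
  \<comment> \<open>\<open>S\<close> points carry labels below \<open>r\<close> and \<open>j\<close>
    is the number of the remaining ones, so on \<open>A j\<close> the sample size is forced to be
    \<open>S + j\<close>.\<close>
  define S where "S = (\<Sum>c<r. v c)"
  define w where "w j = v(r := j)" for j
  define A where "A j = {\<omega>\<in>space M. N \<omega> = S + j \<and> (\<forall>c\<le>r. card {i\<in>{1..N \<omega>}. lab (Z i \<omega>) = c} = w j c)}" for j
  define P where "P = (\<Prod>c<r. p c ^ v c / fact (v c))"
  have sumw: "(\<Sum>c\<le>r. w j c) = S + j" for j
    by (simp add: S_def w_def lessThan_Suc_atMost[symmetric])
  have prodw: "(\<Prod>c\<le>r. p c ^ w j c / fact (w j c)) = P * (p r ^ j / fact j)" for j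
    by (simp add: P_def w_def lessThan_Suc_atMost[symmetric])
  let ?L = "\<lambda>j. {l \<in> {1..S + j} \<rightarrow>\<^sub>E {..r}. \<forall>c\<in>{..r}. card {i\<in>{1..S + j}. l i = c} = w j c}"
  have finL: "finite (?L j)" for j
    by (rule finite_subset[of _ "{1..S + j} \<rightarrow>\<^sub>E {..r}"]) (auto intro: finite_PiE)
  have AL: "A j = (\<Union>l\<in>?L j. E (S + j) l)" for j
  proof (intro equalityI subsetI)
    fix \<omega> assume \<omega>: "\<omega> \<in> A j"
    let ?l = "\<lambda>i\<in>{1..S + j}. lab (Z i \<omega>)"
    have c: "{i\<in>{1..S + j}. ?l i = c} = {i\<in>{1..S + j}. lab (Z i \<omega>) = c}" for c by auto
    have "?l \<in> ?L j" using \<omega> lab(2) unfolding mem_Collect_eq c by (auto simp: A_def)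
    moreover have "\<omega> \<in> E (S + j) ?l" using \<omega> by (auto simp: A_def E_def)
    ultimately show "\<omega> \<in> (\<Union>l\<in>?L j. E (S + j) l)" by blast
  next
    fix \<omega> assume "\<omega> \<in> (\<Union>l\<in>?L j. E (S + j) l)"
    then obtain l where l: "l \<in> ?L j" "\<omega> \<in> E (S + j) l" by blast
    have "{i\<in>{1..S + j}. lab (Z i \<omega>) = c} = {i\<in>{1..S + j}. l i = c}" for c
      using l(2) by (auto simp: E_def)
    thus "\<omega> \<in> A j" using l by (auto simp: A_def E_def)
  qed
  have PA: "prob (A j) = exp (- \<nu>) * \<nu> ^ S * P * ((\<nu> * p r) ^ j / fact j)" for j
  proof -
    have "prob (A j) = (\<Sum>l\<in>?L j. prob (E (S + j) l))"
      unfolding AL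
    proof (rule finite_measure_finite_Union)
      show "disjoint_family_on (E (S + j)) (?L j)"
        unfolding disjoint_family_on_def
      proof (intro ballI impI equals0I)
        fix l l' \<omega> assume l: "l \<in> ?L j" "l' \<in> ?L j" "l \<noteq> l'" "\<omega> \<in> E (S + j) l \<inter> E (S + j) l'"
        have "l = l'" by (rule PiE_ext[of l "{1..S + j}" "\<lambda>_. {..r}" l']) (use l in \<open>auto simp: E_def\<close>)
        thus False using l by simp
      qed
    qed (use finL Em in auto)
    also have "\<dots> = \<nu> ^ (S + j) / fact (S + j) * exp (- \<nu>) *
        (\<Sum>l\<in>?L j. \<Prod>i\<in>{1..S + j}. p (l i))"
      unfolding PE by (simp add: sum_distrib_left)
    also have "(\<Sum>l\<in>?L j. \<Prod>i\<in>{1..S + j}. p (l i)) =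
        (\<Sum>l\<in>{1..S + j} \<rightarrow>\<^sub>E {..r}. if \<forall>c\<in>{..r}. card {i\<in>{1..S + j}. l i = c} = w j c
           then \<Prod>i\<in>{1..S + j}. p (l i) else 0)"
      by (rule sum.inter_filter) (auto intro: finite_PiE)
    also have "\<dots> = fact (S + j) * (P * (p r ^ j / fact j))"
      using sumw[of j] by (subst sum_prod_labellings) (simp_all add: prodw)
    finally show ?thesis by (simp add: power_add power_mult_distrib field_simps)
  qed
  \<comment> \<open>Summing over the leftover count \<open>j\<close> is an exponential series in
    \<open>\<nu> * p r\<close>.\<close>
  have "(\<lambda>j. prob (A j)) sums prob (\<Union>j. A j)"
  proof (rule finite_measure_UNION)
    show "range A \<subseteq> events" unfolding AL using Em finL by auto
    show "disjoint_family A" by (auto simp: disjoint_family_on_def A_def)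
  qed
  moreover have "(\<lambda>j. prob (A j)) sums (exp (- \<nu>) * \<nu> ^ S * P * exp (\<nu> * p r))"
    unfolding PA using exp_converges[of "\<nu> * p r"] by (intro sums_mult) (simp add: divide_inverse mult_ac)
  ultimately have "prob (\<Union>j. A j) = exp (- \<nu>) * \<nu> ^ S * P * exp (\<nu> * p r)" by (rule sums_unique2)
  also have "(\<Union>j. A j) = {\<omega>\<in>space M. \<forall>c<r. card {i\<in>{1..N \<omega>}. lab (Z i \<omega>) = c} = v c}"
  proof (intro equalityI subsetI)
    fix \<omega> assume \<omega>: "\<omega> \<in> {\<omega>\<in>space M. \<forall>c<r. card {i\<in>{1..N \<omega>}. lab (Z i \<omega>) = c} = v c}"
    define j where "j = card {i\<in>{1..N \<omega>}. lab (Z i \<omega>) = r}"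
    have "{1..N \<omega>} = (\<Union>c\<in>{..r}. {i\<in>{1..N \<omega>}. lab (Z i \<omega>) = c})" using lab(2) by auto
    hence "card {1..N \<omega>} = card (\<Union>c\<in>{..r}. {i\<in>{1..N \<omega>}. lab (Z i \<omega>) = c})"
      by (rule arg_cong)
    also have "\<dots> = (\<Sum>c\<le>r. card {i\<in>{1..N \<omega>}. lab (Z i \<omega>) = c})"
      by (rule card_UN_disjoint) auto
    also have "\<dots> = (\<Sum>c\<le>r. w j c)"
      using \<omega> by (intro sum.cong) (auto simp: w_def j_def)
    finally have "N \<omega> = S + j" by (simp add: sumw)
    moreover have "\<forall>c\<le>r. card {i\<in>{1..N \<omega>}. lab (Z i \<omega>) = c} = w j c"
      using \<omega> by (auto simp: w_def j_def)
    ultimately have "\<omega> \<in> A j" using \<omega> by (simp add: A_def)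
    thus "\<omega> \<in> (\<Union>j. A j)" by blast
  qed (auto simp: A_def w_def)
  finally have res: "prob {\<omega>\<in>space M. \<forall>c<r. card {i\<in>{1..N \<omega>}. lab (Z i \<omega>) = c} = v c} =
    exp (- \<nu>) * \<nu> ^ S * P * exp (\<nu> * p r)" .
  \<comment> \<open>The total mass 1 turns \<open>exp (- \<nu>) * exp (\<nu> * p r)\<close> into the
    product of the Poisson normalizations of the labels below \<open>r\<close>.\<close>
  have "(\<Sum>c\<le>r. p c) = 1"
  proof -
    have "(\<Sum>c\<le>r. p c) = (\<Sum>c\<le>r. prob {\<omega>\<in>space M. lab (Z 1 \<omega>) = c})" using p[of 1] by simp
    also have "\<dots> = prob (\<Union>c\<le>r. {\<omega>\<in>space M. lab (Z 1 \<omega>) = c})"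
      using lZm[of 1] by (intro finite_measure_finite_Union[symmetric]) (auto simp: disjoint_family_on_def)
    also have "(\<Union>c\<le>r. {\<omega>\<in>space M. lab (Z 1 \<omega>) = c}) = space M" using lab(2) by auto
    finally show ?thesis by (simp add: prob_space)
  qed
  hence pr: "p r = 1 - (\<Sum>c<r. p c)" by (simp add: lessThan_Suc_atMost[symmetric])
  have p0: "p c \<ge> 0" for c using p[of 1 c] by (metis measure_nonneg le_refl)
  have "(\<Prod>c<r. pmf (poisson_law (\<nu> * p c)) (v c)) =
      (\<Prod>c<r. \<nu> ^ v c * (p c ^ v c / fact (v c)) * exp (- (\<nu> * p c)))"
    using p0 N(2) by (intro prod.cong refl) (simp add: pmf_poisson_law power_mult_distrib)
  also have "\<dots> = \<nu> ^ S * P * exp (- (\<nu> * (\<Sum>c<r. p c)))"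
    unfolding prod.distrib P_def S_def power_sum
    by (simp add: exp_sum sum_distrib_left sum_negf[symmetric])
  also have "\<dots> = exp (- \<nu>) * \<nu> ^ S * P * exp (\<nu> * p r)"
  proof -
    have "exp (- (\<nu> * (\<Sum>c<r. p c))) = exp (- \<nu>) * exp (\<nu> * p r)"
      unfolding exp_add[symmetric] pr by (simp add: algebra_simps)
    thus ?thesis by simp
  qed
  finally show ?thesis unfolding res ..
qed

section \<open>Cell counts of Poisson processes\<close>

lemma poisson_process_count_prob:
  assumes M: "prob_space M" and \<eta>: "poisson_process M \<eta> \<mu>"
    and B: "B \<in> sets \<mu>" "emeasure \<mu> B \<noteq> \<infinity>"
  shows "measure M {\<omega>\<in>space M. emeasure (\<eta> \<omega>) B = of_nat k} = pmf (poisson_law (measure \<mu> B)) k"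
    and "AE \<omega> in M. emeasure (\<eta> \<omega>) B \<noteq> \<infinity>"
proof -
  interpret prob_space M by fact
  have m[measurable]: "(\<lambda>\<omega>. emeasure (\<eta> \<omega>) B) \<in> borel_measurable M"
    and d: "distr M borel (\<lambda>\<omega>. emeasure (\<eta> \<omega>) B) =
      distr (measure_pmf (poisson_law (measure \<mu> B))) borel of_nat"
    using \<eta> B by (auto simp: poisson_process_def)
  have "measure M {\<omega>\<in>space M. emeasure (\<eta> \<omega>) B = of_nat k} =
      measure (distr M borel (\<lambda>\<omega>. emeasure (\<eta> \<omega>) B)) {of_nat k}"
    by (subst measure_distr) (auto intro!: arg_cong[where f = prob])
  also have "\<dots> = measure (measure_pmf (poisson_law (measure \<mu> B))) (of_nat -` {of_nat k :: ennreal})"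
    unfolding d by (subst measure_distr) auto
  also have "of_nat -` {of_nat k :: ennreal} = {k}" by auto
  finally show "measure M {\<omega>\<in>space M. emeasure (\<eta> \<omega>) B = of_nat k} = pmf (poisson_law (measure \<mu> B)) k"
    by (simp add: measure_pmf_single)
  have "AE x in distr M borel (\<lambda>\<omega>. emeasure (\<eta> \<omega>) B). x \<noteq> \<infinity>"
    unfolding d by (subst AE_distr_iff) auto
  thus "AE \<omega> in M. emeasure (\<eta> \<omega>) B \<noteq> \<infinity>" by (subst (asm) AE_distr_iff) auto
qed

lemma poisson_process_counts_prob:
  assumes M: "prob_space M" and \<eta>: "poisson_process M \<eta> \<mu>"
    and B: "\<And>c. c < (m::nat) \<Longrightarrow> B c \<in> sets \<mu>" "\<And>c. c < m \<Longrightarrow> emeasure \<mu> (B c) \<noteq> \<infinity>"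
      "disjoint_family_on B {..<m}"
  shows "measure M {\<omega>\<in>space M. \<forall>c<m. emeasure (\<eta> \<omega>) (B c) = of_nat (v c)} =
    (\<Prod>c<m. pmf (poisson_law (measure \<mu> (B c))) (v c))"
proof (cases "m = 0")
  case True
  thus ?thesis using M by (simp add: prob_space.prob_space)
next
  case False
  interpret prob_space M by fact
  have ind: "indep_vars (\<lambda>_. borel) (\<lambda>i \<omega>. emeasure (\<eta> \<omega>) (B i)) {..<m}"
    using \<eta> B by (auto simp: poisson_process_def)
  have "{\<omega>\<in>space M. \<forall>c<m. emeasure (\<eta> \<omega>) (B c) = of_nat (v c)} =
      (\<Inter>c\<in>{..<m}. (\<lambda>\<omega>. emeasure (\<eta> \<omega>) (B c)) -` {of_nat (v c)} \<inter> space M)"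
    using False by auto
  also have "prob \<dots> = (\<Prod>c<m. prob ((\<lambda>\<omega>. emeasure (\<eta> \<omega>) (B c)) -` {of_nat (v c)} \<inter> space M))"
    by (rule indep_varsD[OF ind]) (use False in auto)
  also have "\<dots> = (\<Prod>c<m. pmf (poisson_law (measure \<mu> (B c))) (v c))"
  proof (intro prod.cong refl)
    fix c assume c: "c \<in> {..<m}"
    have "(\<lambda>\<omega>. emeasure (\<eta> \<omega>) (B c)) -` {of_nat (v c)} \<inter> space M =
      {\<omega>\<in>space M. emeasure (\<eta> \<omega>) (B c) = of_nat (v c)}" by auto
    thus "prob ((\<lambda>\<omega>. emeasure (\<eta> \<omega>) (B c)) -` {of_nat (v c)} \<inter> space M) =
        pmf (poisson_law (measure \<mu> (B c))) (v c)"
      using poisson_process_count_prob(1)[OF M \<eta> B(1,2), of c "v c"] c by simp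
  qed
  finally show ?thesis .
qed

text \<open>Independence of the processes refers to their values on all Borel sets; a condition on
  finitely many of these values is an event of the product sigma-algebra, so the probability
  factors.\<close>

lemma indep_point_processes_counts:
  fixes \<eta> \<zeta> :: "'w \<Rightarrow> 'b::topological_space measure"
  assumes M: "prob_space M" and ind: "indep_point_processes M \<eta> \<zeta>"
    and B: "\<And>c. c < (m::nat) \<Longrightarrow> B c \<in> sets borel"
  shows "measure M {\<omega>\<in>space M. (\<forall>c<m. emeasure (\<eta> \<omega>) (B c) = of_nat (v c)) \<and>
      (\<forall>c<m. emeasure (\<zeta> \<omega>) (B c) = of_nat (w c))} =
    measure M {\<omega>\<in>space M. \<forall>c<m. emeasure (\<eta> \<omega>) (B c) = of_nat (v c)} *
    measure M {\<omega>\<in>space M. \<forall>c<m. emeasure (\<zeta> \<omega>) (B c) = of_nat (w c)}"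
proof -
  interpret prob_space M by fact
  let ?P = "PiM (sets (borel :: 'b measure)) (\<lambda>_. borel :: ennreal measure)"
  let ?T = "\<lambda>v. {y\<in>space ?P. \<forall>c\<in>{..<m}. y (B c) = of_nat (v c :: nat)}"
  have T: "?T v \<in> sets ?P" for v
  proof -
    have "(\<lambda>y. y (B c)) \<in> borel_measurable ?P" if "c \<in> {..<m}" for c
      using B[of c] that by (intro measurable_component_singleton) auto
    thus ?thesis by measurable
  qed
  have eq: "(\<lambda>\<omega>. \<lambda>B\<in>sets borel. emeasure (\<theta> \<omega>) B) -` ?T v \<inter> space M =
      {\<omega>\<in>space M. \<forall>c<m. emeasure (\<theta> \<omega>) (B c) = of_nat (v c)}"
    for \<theta> :: "'w \<Rightarrow> 'b measure" and v
    using B by (auto simp: space_PiM)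
  have "prob (((\<lambda>\<omega>. \<lambda>B\<in>sets borel. emeasure (\<eta> \<omega>) B) -` ?T v \<inter> space M) \<inter>
      ((\<lambda>\<omega>. \<lambda>B\<in>sets borel. emeasure (\<zeta> \<omega>) B) -` ?T w \<inter> space M)) =
    prob ((\<lambda>\<omega>. \<lambda>B\<in>sets borel. emeasure (\<eta> \<omega>) B) -` ?T v \<inter> space M) *
    prob ((\<lambda>\<omega>. \<lambda>B\<in>sets borel. emeasure (\<zeta> \<omega>) B) -` ?T w \<inter> space M)"
    using ind T unfolding indep_point_processes_def indep_pair_def
    by (intro indep_setD[where A = "{(\<lambda>\<omega>. \<lambda>B\<in>sets borel. emeasure (\<eta> \<omega>) B) -` S \<inter> space M |S. S \<in> sets ?P}"
      and B = "{(\<lambda>\<omega>. \<lambda>B\<in>sets borel. emeasure (\<zeta> \<omega>) B) -` S \<inter> space M |S. S \<in> sets ?P}"]) blast+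
  thus ?thesis unfolding eq by (simp add: Int_def conj_ac cong: conj_cong)
qed

subsection \<open>Geometry of the ellipsoid near its tips\<close>

text \<open>The parallelogram law without the norm of the sum. It is sharp for v = -u, the
  configuration of two opposite tips.\<close>

lemma norm_diff_sq_le:
  fixes u v :: "'a::real_inner"
  shows "(norm (u - v))\<^sup>2 \<le> 2 * (norm u)\<^sup>2 + 2 * (norm v)\<^sup>2"
proof -
  have "(norm (u - v))\<^sup>2 + (norm (u + v))\<^sup>2 = 2 * (norm u)\<^sup>2 + 2 * (norm v)\<^sup>2"
    by (simp add: power2_norm_eq_inner inner_add inner_diff inner_commute)
  thus ?thesis by (smt (verit) zero_le_power2)
qed

lemma norm_tilde_diff_sq: "(norm (tilde x - tilde y))\<^sup>2 = (\<Sum>k\<in>UNIV - {first}. (x $ k - y $ k)\<^sup>2)"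
proof -
  have "(norm (tilde x - tilde y))\<^sup>2 = (\<Sum>k\<in>UNIV. ((tilde x - tilde y) $ k)\<^sup>2)"
    unfolding norm_vec_def L2_set_def by (simp add: sum_nonneg)
  also have "\<dots> = (\<Sum>k\<in>UNIV - {first}. ((tilde x - tilde y) $ k)\<^sup>2)"
    by (subst sum.remove[of _ first]) (auto simp: tilde_def)
  also have "\<dots> = (\<Sum>k\<in>UNIV - {first}. (x $ k - y $ k)\<^sup>2)"
    by (intro sum.cong) (auto simp: tilde_def)
  finally show ?thesis .
qed

lemma norm_tilde_sq: "(norm (tilde (x :: (real, 'a::{finite,linorder}) vec)))\<^sup>2 = (\<Sum>k\<in>UNIV - {first}. (x $ k)\<^sup>2)"
proof -
  have "tilde 0 = (0 :: (real, 'a) vec)" by (simp add: tilde_def vec_eq_iff)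
  thus ?thesis using norm_tilde_diff_sq[of x 0] by simp
qed

lemma norm_sq_tilde:
  fixes x :: "real ^ 'd::{finite,linorder}"
  shows "(norm x)\<^sup>2 = (x $ first)\<^sup>2 + (norm (tilde x))\<^sup>2"
proof -
  have "(norm x)\<^sup>2 = (\<Sum>k\<in>UNIV. (x $ k)\<^sup>2)"
    unfolding norm_vec_def L2_set_def by (simp add: sum_nonneg)
  thus ?thesis by (simp add: norm_tilde_sq sum.remove[of _ first])
qed

lemma tilde_diff: "tilde (z - w) = tilde z - tilde w"
  by (simp add: tilde_def vec_eq_iff)

locale elongated_ellipsoid =
  fixes a :: "real ^ 'd::{finite,linorder}"
  assumes a_pos: "\<And>k. a $ k > 0"
    and a_first: "\<And>k. k \<noteq> first \<Longrightarrow> a $ k < a $ first"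
begin

abbreviation A :: real where "A \<equiv> a $ first"

text \<open>The ratio \<open>q < 1\<close> of the squared second to the squared first semi-axis is what separates the two
  tips from all other pairs at distance near \<open>2 A\<close>. The \<open>0\<close> only guards against an empty index set.\<close>

definition q :: real where "q = Max (insert 0 ((\<lambda>k. (a $ k / A)\<^sup>2) ` (UNIV - {first})))"

definition rad :: "(real, 'd) vec \<Rightarrow> real" where "rad z = (\<Sum>k\<in>UNIV - {first}. (z $ k / a $ k)\<^sup>2)"

text \<open>The height of a point inside the paraboloid: \<open>P_H a\<close> is where it is
  positive, and its power \<beta> is the density of \<open>Lambda a \<beta>\<close> there.\<close>

definition depth :: "(real, 'd) vec \<Rightarrow> real" where "depth x = 2 * x $ first / A - rad x"

text \<open>
  The first coordinate is quadratic rather than affine in \<open>z\<^sub>1\<close>, so that \<open>1 - z\<^sup>T \<Sigma>\<^sup>-\<^sup>1 z\<close> is exactly \<open>s\<close> times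
  \<open>depth (chart s z)\<close> and each half of the ellipsoid is mapped exactly into the closure of \<open>P_H a\<close>.
  The same map serves both tips.
\<close>

definition chart :: "real \<Rightarrow> (real, 'd) vec \<Rightarrow> (real, 'd) vec" where
  "chart s z = (\<chi> k. if k = first then A / 2 * (1 - (z $ first / A)\<^sup>2) / s else z $ k / sqrt s)"

lemma A_pos: "A > 0" by (rule a_pos)

lemma q_nonneg: "q \<ge> 0" by (simp add: q_def)

lemma q_less_1: "q < 1"
proof -
  have "(a $ k / A)\<^sup>2 < 1" if "k \<noteq> first" for k
    using a_pos[of k] A_pos a_first[OF that] by (simp add: power_less_one_iff abs_square_less_1)
  thus ?thesis by (auto simp: q_def)
qed

lemma a_sq_le: "k \<noteq> first \<Longrightarrow> (a $ k)\<^sup>2 \<le> q * A\<^sup>2"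
proof -
  assume "k \<noteq> first"
  hence "(a $ k / A)\<^sup>2 \<le> q" unfolding q_def by (intro Max_ge) auto
  thus ?thesis using A_pos by (simp add: power_divide divide_simps)
qed

lemma rad_nonneg: "rad z \<ge> 0" by (simp add: rad_def sum_nonneg)

lemma P_H_iff: "x \<in> P_H a \<longleftrightarrow> depth x > 0"
  by (simp add: P_H_def depth_def rad_def)

lemma sum_ratio_sq: "(\<Sum>k\<in>UNIV. (z $ k / a $ k)\<^sup>2) = (z $ first / A)\<^sup>2 + rad z"
  by (simp add: rad_def sum.remove[of _ first])

lemma ellipsoid_iff: "z \<in> ellipsoid a \<longleftrightarrow> (z $ first / A)\<^sup>2 + rad z \<le> 1"
  by (simp add: ellipsoid_def sum_ratio_sq)

lemma norm_tilde_sq_le: "(norm (tilde x))\<^sup>2 \<le> q * A\<^sup>2 * rad x"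
proof -
  have "(x $ k)\<^sup>2 \<le> q * A\<^sup>2 * (x $ k / a $ k)\<^sup>2" if "k \<noteq> first" for k
  proof -
    have "(x $ k)\<^sup>2 = (a $ k)\<^sup>2 * (x $ k / a $ k)\<^sup>2" using a_pos[of k] by (simp add: power_divide)
    thus ?thesis using a_sq_le[OF that] by (metis mult_right_mono zero_le_power2)
  qed
  thus ?thesis unfolding norm_tilde_sq rad_def sum_distrib_left by (intro sum_mono) auto
qed

lemma norm_tilde_diff_sq_le: "(norm (tilde x - tilde y))\<^sup>2 \<le> 2 * q * A\<^sup>2 * (rad x + rad y)"
  using norm_diff_sq_le[of "tilde x" "tilde y"] norm_tilde_sq_le[of x] norm_tilde_sq_le[of y]
  by (simp add: algebra_simps)

section \<open>Coercivity: pairs with small defect have bounded charts\<close>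

lemma P_H_rad_less: "x \<in> P_H a \<Longrightarrow> rad x < 2 * x $ first / A"
  by (simp add: P_H_iff depth_def)

lemma P_H_first_pos: "x \<in> P_H a \<Longrightarrow> x $ first > 0"
proof -
  assume "x \<in> P_H a"
  hence "0 < 2 * x $ first / A" using P_H_rad_less[of x] rad_nonneg[of x] by linarith
  thus ?thesis using A_pos by (simp add: zero_less_divide_iff)
qed

text \<open>On \<open>P_H a\<close> the values of \<open>rad\<close> add up to at most 2 (x_1 + y_1)
  / A, so the transverse term of \<open>G\<close> consumes at most the share \<open>q\<close> of x_1
  + y_1. This makes \<open>G\<close> nonnegative and confines the limit pairs with \<open>G\<close>
  at most K to first coordinates at most K / (1 - q).\<close>

lemma G_ge:
  assumes "x \<in> P_H a" "y \<in> P_H a"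
  shows "(1 - q) * (x $ first + y $ first) \<le> G a x y"
proof -
  have "rad x + rad y \<le> 2 * (x $ first + y $ first) / A"
    using P_H_rad_less[OF assms(1)] P_H_rad_less[OF assms(2)] by (simp add: add_divide_distrib)
  hence "2 * q * A\<^sup>2 * (rad x + rad y) \<le> 2 * q * A\<^sup>2 * (2 * (x $ first + y $ first) / A)"
    using q_nonneg by (intro mult_left_mono) auto
  also have "\<dots> = 4 * A * (q * (x $ first + y $ first))" using A_pos by (simp add: power2_eq_square)
  finally have "(norm (tilde x - tilde y))\<^sup>2 \<le> 4 * A * (q * (x $ first + y $ first))"
    using norm_tilde_diff_sq_le[of x y] by linarith
  hence "1 / (4 * A) * (norm (tilde x - tilde y))\<^sup>2 \<le> q * (x $ first + y $ first)"
    using A_pos by (simp add: field_simps)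
  thus ?thesis by (simp add: G_def algebra_simps)
qed

lemma P_H_bounded:
  assumes "R \<ge> 0"
  shows "\<exists>R'>0. \<forall>x\<in>P_H a. x $ first \<le> R \<longrightarrow> norm x \<le> R'"
\<comment> \<open>The root is the bound that \<open>norm_sq_tilde\<close> gives on the slice;
  \<open>+ 1\<close> keeps the radius positive even for R = 0.\<close>
proof (intro exI[of _ "sqrt (R\<^sup>2 + q * A\<^sup>2 * (2 * R / A)) + 1"] conjI ballI impI)
  show "0 < sqrt (R\<^sup>2 + q * A\<^sup>2 * (2 * R / A)) + 1"
    using assms A_pos q_nonneg by (intro add_nonneg_pos) auto
  fix x assume x: "x \<in> P_H a" "x $ first \<le> R"
  have "rad x \<le> 2 * R / A" using P_H_rad_less[OF x(1)] x(2) A_pos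
    by (smt (verit) divide_right_mono)
  hence "q * A\<^sup>2 * rad x \<le> q * A\<^sup>2 * (2 * R / A)" using q_nonneg by (intro mult_left_mono) auto
  moreover have "(x $ first)\<^sup>2 \<le> R\<^sup>2" using P_H_first_pos[OF x(1)] x(2) by (intro power_mono) auto
  ultimately have "(norm x)\<^sup>2 \<le> R\<^sup>2 + q * A\<^sup>2 * (2 * R / A)"
    using norm_sq_tilde[of x] norm_tilde_sq_le[of x] by linarith
  thus "norm x \<le> sqrt (R\<^sup>2 + q * A\<^sup>2 * (2 * R / A)) + 1" using real_le_rsqrt by fastforce
qed

lemma chart_first: "chart s z $ first = A / 2 * (1 - (z $ first / A)\<^sup>2) / s"
  by (simp add: chart_def)

text \<open>The chart is even in the first coordinate, so only the square can be recovered; the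
  sign, that is the choice of the tip, has to be carried separately.\<close>

lemma first_sq_chart: "s > 0 \<Longrightarrow> (z $ first)\<^sup>2 = A\<^sup>2 - 2 * A * s * chart s z $ first"
  using A_pos by (simp add: chart_first field_simps power2_eq_square)

lemma rad_chart:
  assumes "s > 0" shows "rad (chart s z) = rad z / s"
proof -
  have "rad (chart s z) = (\<Sum>k\<in>UNIV - {first}. (z $ k / a $ k)\<^sup>2 / s)"
    unfolding rad_def using assms
    by (intro sum.cong) (auto simp: chart_def power_divide power_mult_distrib)
  thus ?thesis by (simp add: rad_def sum_divide_distrib)
qed

lemma depth_chart:
  assumes "s > 0" shows "1 - (\<Sum>k\<in>UNIV. (z $ k / a $ k)\<^sup>2) = s * depth (chart s z)"
  unfolding sum_ratio_sq depth_def rad_chart[OF assms] chart_first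
  using assms A_pos by (simp add: field_simps)

lemma tilde_chart_dist:
  assumes "s > 0"
  shows "(norm (tilde z - tilde w))\<^sup>2 = s * (norm (tilde (chart s z) - tilde (chart s w)))\<^sup>2"
  unfolding norm_tilde_diff_sq sum_distrib_left using assms
  by (intro sum.cong) (auto simp: chart_def power_divide diff_divide_distrib[symmetric])

lemma norm_diff_sq_first: "(norm (z - w))\<^sup>2 = (z $ first - w $ first)\<^sup>2 + (norm (tilde z - tilde w))\<^sup>2"
  using norm_sq_tilde[of "z - w"] by (simp add: tilde_diff)

lemma ellipsoid_first_sq_le: "z \<in> ellipsoid a \<Longrightarrow> (z $ first)\<^sup>2 \<le> A\<^sup>2"
  using A_pos rad_nonneg[of z] by (simp add: ellipsoid_iff power_divide divide_simps) (smt (verit) mult_nonneg_nonneg zero_le_power2)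

text \<open>Unscaled form of \<open>G_ge\<close>: membership in the ellipsoid bounds the squared
  transverse displacement by q (4 A^2 - 2 z_1^2 - 2 w_1^2), hence by the share \<open>q\<close> of
  the deficit in the first coordinates.\<close>

lemma ellipsoid_gap:
  assumes "z \<in> ellipsoid a" "w \<in> ellipsoid a"
  shows "(1 - q) * (4 * A\<^sup>2 - (z $ first - w $ first)\<^sup>2) \<le> 4 * A\<^sup>2 - (norm (z - w))\<^sup>2"
proof -
  \<comment> \<open>To be used with U = 4 A^2, D the squared difference of the first coordinates and
    T the squared transverse displacement.\<close>
  have gap: "T \<le> q * (U - D) \<Longrightarrow> (1 - q) * (U - D) \<le> U - (D + T)" for T U D :: real
    by (simp add: algebra_simps)
  have r: "A\<^sup>2 * rad u \<le> A\<^sup>2 - (u $ first)\<^sup>2" if "u \<in> ellipsoid a" for u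
  proof -
    have "A\<^sup>2 * rad u \<le> A\<^sup>2 * (1 - (u $ first / A)\<^sup>2)"
      using that by (intro mult_left_mono) (auto simp: ellipsoid_iff)
    thus ?thesis using A_pos by (simp add: power_divide right_diff_distrib)
  qed
  have "(z $ first - w $ first)\<^sup>2 \<le> 2 * (z $ first)\<^sup>2 + 2 * (w $ first)\<^sup>2"
    using norm_diff_sq_le[of "z $ first" "w $ first"] by simp
  hence "2 * (A\<^sup>2 * rad z + A\<^sup>2 * rad w) \<le> 4 * A\<^sup>2 - (z $ first - w $ first)\<^sup>2"
    using r[OF assms(1)] r[OF assms(2)] by argo
  hence "q * (2 * (A\<^sup>2 * rad z + A\<^sup>2 * rad w)) \<le> q * (4 * A\<^sup>2 - (z $ first - w $ first)\<^sup>2)"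
    using q_nonneg by (rule mult_left_mono)
  moreover have "2 * q * A\<^sup>2 * (rad z + rad w) = q * (2 * (A\<^sup>2 * rad z + A\<^sup>2 * rad w))"
    by (simp add: algebra_simps)
  ultimately have "(norm (tilde z - tilde w))\<^sup>2 \<le> q * (4 * A\<^sup>2 - (z $ first - w $ first)\<^sup>2)"
    using norm_tilde_diff_sq_le[of z w] by linarith
  thus ?thesis unfolding norm_diff_sq_first[of z w] by (rule gap)
qed

text \<open>The gap inequality makes the squared deficit nonnegative. Hence the scaled defects are
  nonnegative, like the arrival times with which they are compared.\<close>

lemma ellipsoid_dist_le:
  assumes "z \<in> ellipsoid a" "w \<in> ellipsoid a"
  shows "norm (z - w) \<le> 2 * A"
proof -
  have "(z $ first - w $ first)\<^sup>2 \<le> 2 * (z $ first)\<^sup>2 + 2 * (w $ first)\<^sup>2"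
    using norm_diff_sq_le[of "z $ first" "w $ first"] by simp
  hence "0 \<le> (1 - q) * (4 * A\<^sup>2 - (z $ first - w $ first)\<^sup>2)"
    using ellipsoid_first_sq_le[OF assms(1)] ellipsoid_first_sq_le[OF assms(2)] q_less_1
    by (intro mult_nonneg_nonneg) auto
  hence "(norm (z - w))\<^sup>2 \<le> (2 * A)\<^sup>2" using ellipsoid_gap[OF assms] by (simp add: power2_eq_square)
  thus ?thesis using A_pos by (auto intro: power2_le_imp_le)
qed

text \<open>On the same side the first coordinates differ by at most \<open>A\<close>, so the gap
  inequality forces a squared deficit of at least 3 A^2 (1 - q), whereas \<open>far\<close> allows
  only 4 A s K; this is the origin of the smallness condition on \<open>s\<close>. Rewritten in
  charts, the gap inequality becomes (1 - q) (x_1 + y_1) \<le> K, the same bound as in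
  \<open>G_ge\<close>.\<close>

lemma far_pair:
  assumes E: "z \<in> ellipsoid a" "w \<in> ellipsoid a" and s: "s > 0" "K \<ge> 0" "4 * s * K < 3 * A * (1 - q)"
    and far: "2 * A - s * K \<le> norm (z - w)"
  shows "z $ first * w $ first < 0"
    and "chart s z $ first \<le> K / (1 - q)" "chart s w $ first \<le> K / (1 - q)"
proof -
  have q: "0 < 1 - q" "1 - q \<le> 1" using q_less_1 q_nonneg by auto
  have "3 * A * (1 - q) \<le> 3 * A * 1" using A_pos q by (intro mult_left_mono) auto
  hence "s * K \<le> 2 * A" using s A_pos by linarith
  hence "(2 * A - s * K)\<^sup>2 \<le> (norm (z - w))\<^sup>2" using far by (intro power_mono) auto
  hence "4 * A\<^sup>2 - (norm (z - w))\<^sup>2 \<le> 4 * A * (s * K)"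
    by (simp add: power2_eq_square algebra_simps) (smt (verit) mult_nonneg_nonneg s(1,2))
  hence gap: "(1 - q) * (4 * A\<^sup>2 - (z $ first - w $ first)\<^sup>2) \<le> 4 * A * (s * K)"
    using ellipsoid_gap[OF E] by linarith
  have z: "(z $ first)\<^sup>2 \<le> A\<^sup>2" and w: "(w $ first)\<^sup>2 \<le> A\<^sup>2"
    using ellipsoid_first_sq_le E by auto
  show neg: "z $ first * w $ first < 0"
  proof (rule ccontr)
    assume "\<not> ?thesis"
    hence nn: "z $ first * w $ first \<ge> 0" by simp
    have "\<bar>z $ first\<bar> \<le> A" "\<bar>w $ first\<bar> \<le> A" using z w A_pos by (auto simp: abs_le_square_iff[symmetric])
    moreover have "z $ first \<ge> 0 \<and> w $ first \<ge> 0 \<or> z $ first \<le> 0 \<and> w $ first \<le> 0"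
      using nn by (auto simp: zero_le_mult_iff)
    ultimately have "\<bar>z $ first - w $ first\<bar> \<le> \<bar>A\<bar>" using A_pos by auto
    hence "(z $ first - w $ first)\<^sup>2 \<le> A\<^sup>2" by (simp only: abs_le_square_iff)
    hence "(1 - q) * (3 * A\<^sup>2) \<le> (1 - q) * (4 * A\<^sup>2 - (z $ first - w $ first)\<^sup>2)"
      using q by (intro mult_left_mono) auto
    hence "A * (3 * A * (1 - q)) \<le> A * (4 * s * K)" using gap by (simp add: power2_eq_square mult_ac)
    thus False using s(3) A_pos by (simp add: mult_le_cancel_left_pos)
  qed
  have "(z $ first - w $ first)\<^sup>2 \<le> 2 * (z $ first)\<^sup>2 + 2 * (w $ first)\<^sup>2"
    using norm_diff_sq_le[of "z $ first" "w $ first"] by simp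
  \<comment> \<open>By \<open>first_sq_chart\<close>, 2 z_1^2 + 2 w_1^2 equals 4 A^2 - 4 A s (x_1 +
    y_1), where x and y are the charts.\<close>
  hence "4 * A * (s * (chart s z $ first + chart s w $ first)) \<le> 4 * A\<^sup>2 - (z $ first - w $ first)\<^sup>2"
    unfolding first_sq_chart[OF s(1), of z] first_sq_chart[OF s(1), of w] by (simp add: algebra_simps)
  hence "(1 - q) * (4 * A * (s * (chart s z $ first + chart s w $ first))) \<le> 4 * A * (s * K)"
    using gap q by (smt (verit) mult_left_mono)
  hence "(4 * A * s) * ((1 - q) * (chart s z $ first + chart s w $ first)) \<le> (4 * A * s) * K"
    by (simp add: mult_ac)
  hence *: "(1 - q) * (chart s z $ first + chart s w $ first) \<le> K"
    using A_pos s(1) by (subst (asm) mult_le_cancel_left_pos) auto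
  have pos: "chart s u $ first \<ge> 0" if "(u $ first)\<^sup>2 \<le> A\<^sup>2" for u
    using that A_pos s(1) by (simp add: chart_first power_divide divide_simps)
  have "chart s z $ first + chart s w $ first \<le> K / (1 - q)" using * q by (simp add: field_simps)
  thus "chart s z $ first \<le> K / (1 - q)" "chart s w $ first \<le> K / (1 - q)"
    using pos[OF z] pos[OF w] by linarith+
qed

text \<open>Compactness turns the continuity of \<open>G\<close> into a mesh size for the cells that
  works in both arguments at once.\<close>

lemma G_uniform:
  assumes "\<epsilon> > 0"
  shows "\<exists>\<delta>>0. \<forall>x\<in>cball 0 R. \<forall>y\<in>cball 0 R. \<forall>x'\<in>cball 0 R. \<forall>y'\<in>cball 0 R.
    dist x x' < \<delta> \<longrightarrow> dist y y' < \<delta> \<longrightarrow> \<bar>G a x y - G a x' y'\<bar> < \<epsilon>"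
proof -
  let ?S = "cball 0 R \<times> cball 0 R :: ((real, 'd) vec \<times> (real, 'd) vec) set"
  have "continuous_on ?S (\<lambda>(x, y). G a x y)"
    unfolding G_def norm_tilde_diff_sq case_prod_unfold by (intro continuous_intros)
  hence "uniformly_continuous_on ?S (\<lambda>(x, y). G a x y)"
    by (intro compact_uniformly_continuous compact_Times) auto
  then obtain \<delta> where \<delta>: "\<delta> > 0" and
    d: "\<And>u u'. u \<in> ?S \<Longrightarrow> u' \<in> ?S \<Longrightarrow> dist u' u < \<delta> \<Longrightarrow>
      dist (case u' of (x, y) \<Rightarrow> G a x y) (case u of (x, y) \<Rightarrow> G a x y) < \<epsilon>"
    using assms unfolding uniformly_continuous_on_def by metis
  show ?thesis
  proof (intro exI[of _ "\<delta> / 2"] conjI ballI impI)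
    fix x y x' y' :: "(real, 'd) vec"
    assume *: "x \<in> cball 0 R" "y \<in> cball 0 R" "x' \<in> cball 0 R" "y' \<in> cball 0 R"
      "dist x x' < \<delta> / 2" "dist y y' < \<delta> / 2"
    have "dist (x, y) (x', y') \<le> dist x x' + dist y y'"
      unfolding dist_Pair_Pair by (rule sqrt_sum_squares_le_sum) auto
    hence "dist (x, y) (x', y') < \<delta>" using * by linarith
    thus "\<bar>G a x y - G a x' y'\<bar> < \<epsilon>" using d[of "(x', y')" "(x, y)"] * by (simp add: dist_real_def)
  qed (use \<delta> in auto)
qed

text \<open>Write 2 A - |z - w| as (4 A^2 - |z - w|^2) / (2 A + |z - w|). In the charts the
  numerator is divisible by \<open>s\<close>, so the scaled defect extends continuously to s = 0;
  uniform continuity on a compact set then makes the error uniform over all pairs with bounded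
  charts.\<close>

lemma distance_expansion:
  assumes R: "R > 0" and \<epsilon>: "\<epsilon> > 0"
  shows "\<exists>s0>0. \<forall>s z w. 0 < s \<and> s < s0 \<and> z $ first < 0 \<and> 0 < w $ first \<and>
    norm (chart s z) \<le> R \<and> norm (chart s w) \<le> R \<longrightarrow>
    \<bar>(2 * A - norm (z - w)) / s - G a (chart s z) (chart s w)\<bar> < \<epsilon>"
proof -
  define p where "p s x = sqrt (A\<^sup>2 - 2 * A * s * x $ first)" for s and x :: "(real, 'd) vec"
  define nt where "nt x y = (\<Sum>k\<in>UNIV - {first}. (x $ k - y $ k)\<^sup>2)" for x y :: "(real, 'd) vec"
  \<comment> \<open>the scaled defect as a function of \<open>s\<close> and the charts, with the cancellation in
    \<open>A\<^sup>2 - p * p\<close> resolved so that it is continuous up to \<open>s = 0\<close>, where it equals \<open>G\<close>\<close>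
  define \<Phi> where "\<Phi> = (\<lambda>(s, x, y). (2 * A * (x $ first + y $ first) +
      2 * ((2 * A ^ 3 * (x $ first + y $ first) - 4 * A\<^sup>2 * s * (x $ first * y $ first)) / (A\<^sup>2 + p s x * p s y))
      - nt x y) / (2 * A + sqrt ((p s x + p s y)\<^sup>2 + s * nt x y)))"
  \<comment> \<open>For s up to \<open>s1\<close> the number 2 A s x_1 stays below A^2 on the whole
    compact set, so \<open>p\<close> is the root of a nonnegative number and the denominators of
    \<open>\<Phi>\<close> cannot vanish.\<close>
  define s1 where "s1 = A / (2 * (R + 1))"
  let ?S = "{0..s1} \<times> cball 0 R \<times> cball 0 R :: (real \<times> (real, 'd) vec \<times> (real, 'd) vec) set"
  have s1: "s1 > 0" using A_pos R by (simp add: s1_def)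
  have nt0: "nt x y \<ge> 0" for x y by (simp add: nt_def sum_nonneg)
  have p0: "p s x \<ge> 0" if "s \<in> {0..s1}" "x \<in> cball 0 R" for s x
  proof -
    have "x $ first \<le> R" using that(2) component_le_norm_cart[of x first] by auto
    hence "s * x $ first \<le> s1 * (R + 1)"
      using that(1) R s1 by (smt (verit) atLeastAtMost_iff mult_left_mono mult_right_mono)
    also have "\<dots> = A / 2" using R by (simp add: s1_def field_simps)
    finally have "2 * A * (s * x $ first) \<le> 2 * A * (A / 2)" using A_pos by (intro mult_left_mono) auto
    thus ?thesis by (simp add: p_def power2_eq_square mult_ac)
  qed
  have d1: "A\<^sup>2 + p s x * p s y > 0" if "s \<in> {0..s1}" "x \<in> cball 0 R" "y \<in> cball 0 R" for s x y
    using p0[OF that(1,2)] p0[OF that(1,3)] A_pos by (intro add_pos_nonneg) auto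
  have d2: "2 * A + sqrt ((p s x + p s y)\<^sup>2 + s * nt x y) > 0" if "s \<ge> 0" for s x y
    using A_pos nt0 that by (intro add_pos_nonneg) auto
  have "continuous_on ?S \<Phi>"
    unfolding \<Phi>_def case_prod_unfold nt_def[abs_def] p_def[abs_def]
  proof (intro continuous_intros ballI)
    fix u :: "real \<times> (real, 'd) vec \<times> (real, 'd) vec" assume u: "u \<in> ?S"
    show "A\<^sup>2 + sqrt (A\<^sup>2 - 2 * A * fst u * fst (snd u) $ first) *
        sqrt (A\<^sup>2 - 2 * A * fst u * snd (snd u) $ first) \<noteq> 0"
      using d1[of "fst u" "fst (snd u)" "snd (snd u)"] u by (auto simp: p_def)
    show "2 * A + sqrt ((sqrt (A\<^sup>2 - 2 * A * fst u * fst (snd u) $ first) +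
        sqrt (A\<^sup>2 - 2 * A * fst u * snd (snd u) $ first))\<^sup>2 +
        fst u * (\<Sum>k\<in>UNIV - {first}. (fst (snd u) $ k - snd (snd u) $ k)\<^sup>2)) \<noteq> 0"
      using d2[of "fst u" "fst (snd u)" "snd (snd u)"] u by (auto simp: p_def nt_def)
  qed
  hence "uniformly_continuous_on ?S \<Phi>"
    by (intro compact_uniformly_continuous compact_Times) auto
  then obtain \<delta> where \<delta>: "\<delta> > 0" and
    d: "\<And>u u'. u \<in> ?S \<Longrightarrow> u' \<in> ?S \<Longrightarrow> dist u' u < \<delta> \<Longrightarrow> dist (\<Phi> u') (\<Phi> u) < \<epsilon>"
    using \<epsilon> unfolding uniformly_continuous_on_def by metis
  show ?thesis
  proof (intro exI[of _ "min \<delta> s1"] conjI allI impI; (elim conjE)?)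
    fix s z w assume s: "0 < s" "s < min \<delta> s1" and z: "z $ first < 0" and w: "0 < w $ first"
      and R1: "norm (chart s z) \<le> R" and R2: "norm (chart s w) \<le> R"
    define x y where "x = chart s z" and "y = chart s w"
    have "A\<^sup>2 - 2 * A * s * x $ first = (z $ first)\<^sup>2" "A\<^sup>2 - 2 * A * s * y $ first = (w $ first)\<^sup>2"
      using first_sq_chart[OF s(1), of z] first_sq_chart[OF s(1), of w] by (simp_all add: x_def y_def)
    \<comment> \<open>\<open>p\<close> recovers the distance from the equatorial plane; since the
      signs are opposite, the difference of the first coordinates has modulus
      \<open>p s x + p s y\<close>.\<close>
    hence px: "p s x = - z $ first" and py: "p s y = w $ first"
      unfolding p_def using z w by simp_all
    have nrm: "(norm (z - w))\<^sup>2 = (p s x + p s y)\<^sup>2 + s * nt x y"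
    proof -
      have "nt x y = (norm (tilde x - tilde y))\<^sup>2" by (simp add: nt_def norm_tilde_diff_sq)
      moreover have "(p s x + p s y)\<^sup>2 = (z $ first - w $ first)\<^sup>2"
        unfolding px py by (simp add: power2_commute)
      ultimately show ?thesis
        using norm_diff_sq_first[of z w] tilde_chart_dist[OF s(1), of z w] by (simp add: x_def y_def)
    qed
    have x2: "2 * A * s * x $ first = A\<^sup>2 - (p s x)\<^sup>2" and y2: "2 * A * s * y $ first = A\<^sup>2 - (p s y)\<^sup>2"
      unfolding px py using first_sq_chart[OF s(1), of z] first_sq_chart[OF s(1), of w]
      by (simp_all add: x_def y_def)
    have D1: "A\<^sup>2 + p s x * p s y > 0"
      using z w A_pos unfolding px py by (intro add_pos_nonneg mult_nonneg_nonneg) auto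
    \<comment> \<open>With u = A^2 - (p s x)^2 and v = A^2 - (p s y)^2 the right-hand side is A^2 u
      + A^2 v - u v, which is the difference of the squares of A^2 and
      \<open>p s x * p s y\<close>.\<close>
    have "s * (2 * A ^ 3 * (x $ first + y $ first) - 4 * A\<^sup>2 * s * (x $ first * y $ first)) =
      A\<^sup>2 * (2 * A * s * x $ first) + A\<^sup>2 * (2 * A * s * y $ first) - (2 * A * s * x $ first) * (2 * A * s * y $ first)"
      by (simp add: algebra_simps power2_eq_square power3_eq_cube)
    also have "\<dots> = (A\<^sup>2 - p s x * p s y) * (A\<^sup>2 + p s x * p s y)"
      unfolding x2 y2 by (simp add: algebra_simps power2_eq_square)
    finally have t: "s * ((2 * A ^ 3 * (x $ first + y $ first) - 4 * A\<^sup>2 * s * (x $ first * y $ first)) /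
        (A\<^sup>2 + p s x * p s y)) = A\<^sup>2 - p s x * p s y" using D1 by (simp add: divide_simps)
    have sq: "sqrt ((p s x + p s y)\<^sup>2 + s * nt x y) = norm (z - w)"
      unfolding nrm[symmetric] by simp
    have D2: "2 * A + norm (z - w) > 0" using A_pos by (intro add_pos_nonneg) auto
    have num: "s * (2 * A * (x $ first + y $ first) +
      2 * ((2 * A ^ 3 * (x $ first + y $ first) - 4 * A\<^sup>2 * s * (x $ first * y $ first)) / (A\<^sup>2 + p s x * p s y))
      - nt x y) = (2 * A - norm (z - w)) * (2 * A + norm (z - w))" (is "s * (_ + 2 * ?Q - _) = _")
    proof -
      have "s * (2 * A * (x $ first + y $ first) + 2 * ?Q - nt x y) =
          2 * A * s * x $ first + 2 * A * s * y $ first + 2 * (s * ?Q) - s * nt x y"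
        by (simp add: algebra_simps)
      also have "\<dots> = 4 * A\<^sup>2 - (norm (z - w))\<^sup>2"
        unfolding t x2 y2 nrm by (simp add: algebra_simps power2_eq_square)
      finally show ?thesis by (simp add: algebra_simps power2_eq_square)
    qed
    have "\<Phi> (s, x, y) = ((2 * A - norm (z - w)) * (2 * A + norm (z - w)) / s) / (2 * A + norm (z - w))"
      unfolding num[symmetric] \<Phi>_def prod.case sq using s(1) by simp
    hence "\<Phi> (s, x, y) = (2 * A - norm (z - w)) / s" using D2 by simp
    moreover have "\<Phi> (0, x, y) = G a x y"
    proof -
      have p0: "p 0 u = A" for u using A_pos by (simp add: p_def)
      have "2 * A ^ 3 * (x $ first + y $ first) / (A\<^sup>2 + A * A) = A * (x $ first + y $ first)"
        using A_pos by (simp add: power2_eq_square power3_eq_cube divide_simps)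
      moreover have "sqrt ((A + A)\<^sup>2) = 2 * A" using A_pos by (subst real_sqrt_abs) simp
      ultimately have "\<Phi> (0, x, y) = (4 * A * (x $ first + y $ first) - nt x y) / (4 * A)"
        unfolding \<Phi>_def prod.case p0 by (simp add: algebra_simps)
      also have "\<dots> = G a x y"
        unfolding G_def norm_tilde_diff_sq nt_def using A_pos by (simp add: diff_divide_distrib)
      finally show ?thesis .
    qed
    moreover have "dist (\<Phi> (s, x, y)) (\<Phi> (0, x, y)) < \<epsilon>"
      by (rule d) (use s R1 R2 s1 in \<open>auto simp: x_def y_def dist_Pair_Pair\<close>)
    ultimately show "\<bar>(2 * A - norm (z - w)) / s - G a (chart s z) (chart s w)\<bar> < \<epsilon>"
      by (simp add: dist_real_def x_def y_def)
  qed (use \<delta> s1 in auto)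
qed

text \<open>The boundary is a linear image of the unit sphere. Discarding it makes the depth
  strictly positive, so that sample charts lie in the open paraboloid and not merely in its
  closure.\<close>

lemma boundary_negligible: "AE z in lborel. (\<Sum>k\<in>UNIV. (z $ k / a $ k)\<^sup>2) \<noteq> 1"
proof -
  let ?f = "\<lambda>u :: (real, 'd) vec. \<chi> k. a $ k * u $ k"
  have lin: "linear ?f" by (rule linearI) (auto simp: vec_eq_iff algebra_simps)
  have "{z. (\<Sum>k\<in>UNIV. (z $ k / a $ k)\<^sup>2) = 1} \<subseteq> ?f ` sphere 0 1"
  proof
    fix z assume z: "z \<in> {z. (\<Sum>k\<in>UNIV. (z $ k / a $ k)\<^sup>2) = 1}"
    have "z = ?f (\<chi> k. z $ k / a $ k)" using a_pos by (simp add: vec_eq_iff less_imp_neq[symmetric])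
    moreover have "(\<chi> k. z $ k / a $ k) \<in> sphere 0 1"
      using z by (simp add: norm_vec_def L2_set_def power_divide)
    ultimately show "z \<in> ?f ` sphere 0 1" by blast
  qed
  hence "negligible {z. (\<Sum>k\<in>UNIV. (z $ k / a $ k)\<^sup>2) = 1}"
    by (rule negligible_subset[rotated])
      (intro negligible_differentiable_image_negligible linear_imp_differentiable_on lin negligible_sphere order_refl)
  hence "{z. (\<Sum>k\<in>UNIV. (z $ k / a $ k)\<^sup>2) = 1} \<in> null_sets lebesgue"
    by (simp add: negligible_iff_null_sets)
  moreover have "{z :: (real, 'd) vec. (\<Sum>k\<in>UNIV. (z $ k / a $ k)\<^sup>2) = 1} \<in> sets borel" by measurable
  ultimately have "{z. (\<Sum>k\<in>UNIV. (z $ k / a $ k)\<^sup>2) = 1} \<in> null_sets lborel"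
    by (simp add: null_sets_def)
  thus ?thesis by (rule AE_I') auto
qed

text \<open>\<open>matrix_inv\<close> is a choice operator, so the diagonal inverse has to be
  identified as the only two-sided inverse before the form can be computed.\<close>

lemma quadratic_form: "z \<bullet> (matrix_inv (Sigma_mat a) *v z) = (\<Sum>k\<in>UNIV. (z $ k / a $ k)\<^sup>2)"
proof -
  let ?B = "(\<chi> i j. if i = j then 1 / (a $ i)\<^sup>2 else 0) :: ((real, 'd) vec, 'd) vec"
  have a: "a $ k \<noteq> 0" for k using a_pos[of k] by simp
  have SB: "Sigma_mat a ** ?B = mat 1" and BS: "?B ** Sigma_mat a = mat 1"
    unfolding Sigma_mat_def matrix_matrix_mult_def mat_def
    by (simp_all add: vec_eq_iff if_distrib[of "\<lambda>x. x * _"] if_distrib[of "\<lambda>x. _ * x"] a cong: if_cong)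
  have "matrix_inv (Sigma_mat a) = ?B"
    unfolding matrix_inv_def
  proof (rule some_equality)
    show "Sigma_mat a ** ?B = mat 1 \<and> ?B ** Sigma_mat a = mat 1" using SB BS ..
    fix C assume C: "Sigma_mat a ** C = mat 1 \<and> C ** Sigma_mat a = mat 1"
    have "C = C ** (Sigma_mat a ** ?B)" unfolding SB by (simp only: matrix_mul_rid)
    also have "\<dots> = ?B" unfolding matrix_mul_assoc C[THEN conjunct2] by (simp only: matrix_mul_lid)
    finally show "C = ?B" .
  qed
  thus ?thesis
    unfolding inner_vec_def matrix_vector_mult_def
    by (simp add: if_distrib[of "\<lambda>x. x * _"] power2_eq_square cong: if_cong)
qed

end

subsection \<open>Mass near the tips\<close>

text \<open>The first chart coordinate has derivative - t / (A s), so the weight |t| / A is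
  \<open>s\<close> times the modulus of that derivative. Keeping the weight on this side avoids a
  singular Jacobian at t = 0, and near a tip it is close to 1.\<close>

lemma nn_integral_parabola_substitution:
  fixes \<phi> :: "real \<Rightarrow> ennreal"
  assumes [measurable]: "\<phi> \<in> borel_measurable borel" and A: "A > 0" and s: "s > 0" and \<sigma>: "\<sigma> = 1 \<or> \<sigma> = -1"
  shows "(\<integral>\<^sup>+t. ennreal (\<bar>t\<bar> / A) * \<phi> (A / 2 * (1 - (t / A)\<^sup>2) / s) * indicator {t. 0 \<le> \<sigma> * t \<and> \<sigma> * t \<le> A} t \<partial>lborel) =
    ennreal s * (\<integral>\<^sup>+x. \<phi> x * indicator {0..A / (2 * s)} x \<partial>lborel)"
proof -
  let ?g = "\<lambda>t. A / 2 * (1 - (t / A)\<^sup>2) / s"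
  \<comment> \<open>This is the half on which the map increases, as the substitution rule demands;
    the other half follows by reflection.\<close>
  have left: "(\<integral>\<^sup>+t. ennreal (\<bar>t\<bar> / A) * \<phi> (?g t) * indicator {-A..0} t \<partial>lborel) =
    ennreal s * (\<integral>\<^sup>+x. \<phi> x * indicator {0..A / (2 * s)} x \<partial>lborel)"
  proof -
    have "(\<integral>\<^sup>+x. \<phi> x * indicator {?g (- A)..?g 0} x \<partial>lborel) =
        (\<integral>\<^sup>+t. \<phi> (?g t) * ennreal (- t / (A * s)) * indicator {- A..0} t \<partial>lborel)"
    proof (rule nn_integral_substitution_aux)
      show "(?g has_real_derivative - t / (A * s)) (at t)" for t
        using A s by (auto intro!: derivative_eq_intros simp: field_simps power2_eq_square)
      show "continuous_on {- A..0} (\<lambda>t. - t / (A * s))"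
        using A s by (intro continuous_intros) auto
      show "0 \<le> - t / (A * s)" if "t \<in> {- A..0}" for t
        using that A s by (intro divide_nonneg_pos) auto
    qed (use A in auto)
    moreover have "?g (- A) = 0" "?g 0 = A / (2 * s)" using A by simp_all
    ultimately have "ennreal s * (\<integral>\<^sup>+x. \<phi> x * indicator {0..A / (2 * s)} x \<partial>lborel) =
        ennreal s * (\<integral>\<^sup>+t. \<phi> (?g t) * ennreal (- t / (A * s)) * indicator {- A..0} t \<partial>lborel)"
      by (simp only:)
    also have "\<dots> = (\<integral>\<^sup>+t. ennreal s * (\<phi> (?g t) * ennreal (- t / (A * s)) * indicator {- A..0} t) \<partial>lborel)"
      by (rule nn_integral_cmult[symmetric]) measurable
    also have "\<dots> = (\<integral>\<^sup>+t. ennreal (\<bar>t\<bar> / A) * \<phi> (?g t) * indicator {-A..0} t \<partial>lborel)"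
    proof (rule nn_integral_cong)
      fix t :: real
      show "ennreal s * (\<phi> (?g t) * ennreal (- t / (A * s)) * indicator {- A..0} t) =
          ennreal (\<bar>t\<bar> / A) * \<phi> (?g t) * indicator {-A..0} t"
      proof (cases "t \<in> {- A..0}")
        case True
        have "ennreal s * ennreal (- t / (A * s)) = ennreal (\<bar>t\<bar> / A)"
          using True A s by (subst ennreal_mult'[symmetric]) (auto simp: field_simps)
        thus ?thesis using True by (simp add: mult_ac) (metis mult.assoc mult.commute)
      qed simp
    qed
    finally show ?thesis ..
  qed
  show ?thesis
  proof (cases "\<sigma> = 1")
    case False
    hence "\<sigma> = -1" using \<sigma> by auto
    moreover have "{t::real. 0 \<le> - t \<and> - t \<le> A} = {- A..0}" by auto
    ultimately show ?thesis using left by simp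
  next
    case True
    have "(\<integral>\<^sup>+t. ennreal (\<bar>t\<bar> / A) * \<phi> (?g t) * indicator {t. 0 \<le> \<sigma> * t \<and> \<sigma> * t \<le> A} t \<partial>lborel) =
      ennreal \<bar>-1\<bar> * (\<integral>\<^sup>+t. ennreal (\<bar>0 + (-1) * t\<bar> / A) * \<phi> (?g (0 + (-1) * t)) *
        indicator {t. 0 \<le> \<sigma> * t \<and> \<sigma> * t \<le> A} (0 + (-1) * t) \<partial>lborel)"
    proof (rule nn_integral_real_affine)
      have [measurable]: "{t. 0 \<le> \<sigma> * t \<and> \<sigma> * t \<le> A} \<in> sets borel"
        by (intro borel_closed closed_Collect_conj closed_Collect_le continuous_intros)
      show "(\<lambda>t. ennreal (\<bar>t\<bar> / A) * \<phi> (?g t) * indicator {t. 0 \<le> \<sigma> * t \<and> \<sigma> * t \<le> A} t)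
        \<in> borel_measurable borel" by measurable
    qed simp
    also have "\<dots> = (\<integral>\<^sup>+t. ennreal (\<bar>t\<bar> / A) * \<phi> (?g t) * indicator {-A..0} t \<partial>lborel)"
      using True by (auto intro!: nn_integral_cong simp: indicator_def)
    finally show ?thesis unfolding left .
  qed
qed

lemma prod_if_zero:
  fixes c :: "'b \<Rightarrow> ennreal"
  assumes "finite S"
  shows "(\<Prod>b\<in>S. c b * (if P b then 1 else 0)) = (\<Prod>b\<in>S. c b) * (if \<forall>b\<in>S. P b then 1 else 0)"
  using assms by (induction S rule: finite_induct) (auto simp: mult_ac)

context elongated_ellipsoid
begin

lemma measurable_chart [measurable]:
  assumes "s > 0" shows "chart s \<in> borel_measurable borel"
proof (rule borel_measurable_continuous_onI)
  show "continuous_on UNIV (chart s)"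
    unfolding chart_def
  proof (rule continuous_on_vec_lambda)
    fix k :: 'd
    show "continuous_on UNIV (\<lambda>z :: (real, 'd) vec. if k = first then A / 2 * (1 - (z $ first / A)\<^sup>2) / s else z $ k / sqrt s)"
      using A_pos assms by (cases "k = first") (auto intro!: continuous_intros)
  qed
qed

text \<open>The preimage of a box under the chart is again a box, so the two measures can be compared on boxes,
  where both are products of one-dimensional integrals.\<close>

lemma chart_pushforward:
  assumes s: "s > 0" and \<sigma>: "\<sigma> = 1 \<or> \<sigma> = -1"
  defines "c \<equiv> s powr ((real CARD('d) + 1) / 2)"
  shows "distr (density lborel (\<lambda>z. ennreal (\<bar>z $ first\<bar> / A) *
      indicator {z. 0 \<le> \<sigma> * z $ first \<and> \<sigma> * z $ first \<le> A} z)) borel (chart s) =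
    density lborel (\<lambda>x. ennreal c * indicator {x. 0 \<le> x $ first \<and> x $ first \<le> A / (2 * s)} x)"
    (is "?M = ?N")
proof (rule measure_eqI_generator_eq[symmetric])
  note [measurable] = measurable_chart[OF s]
  let ?E = "range (\<lambda>(l, u). box l u :: (real, 'd) vec set)"
  show "Int_stable ?E" by (auto simp: Int_stable_def box_Int_box)
  show "?E \<subseteq> Pow UNIV" by simp
  show "sets ?M = sigma_sets UNIV ?E" "sets ?N = sigma_sets UNIV ?E" by (simp_all add: borel_eq_box)
  let ?A = "\<lambda>n::nat. box (- (real n *\<^sub>R One)) (real n *\<^sub>R One) :: (real, 'd) vec set"
  show "range ?A \<subseteq> ?E" "(\<Union>i. ?A i) = UNIV" unfolding UN_box_eq_UNIV by auto
  let ?e = "axis first 1 :: (real, 'd) vec"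
  have e: "?e \<in> Basis" by (simp add: axis_in_Basis_iff)
  have ze: "z \<bullet> ?e = z $ first" for z :: "(real, 'd) vec" by (simp add: inner_axis)
  have chart_inner: "chart s z \<bullet> b = (if b = ?e then A / 2 * (1 - ((z \<bullet> b) / A)\<^sup>2) / s else (z \<bullet> b) / sqrt s)"
    if "b \<in> Basis" for z b
    using that by (auto simp: Basis_vec_def inner_axis chart_def axis_eq_axis)
  show "emeasure ?N (?A n) \<noteq> \<infinity>" for n
  proof -
    have "emeasure ?N (?A n) \<le> (\<integral>\<^sup>+x. ennreal c * indicator (?A n) x \<partial>lborel)"
      by (subst emeasure_density, measurable) (auto intro!: nn_integral_mono simp: indicator_def)
    also have "\<dots> = ennreal c * emeasure lborel (?A n)"
      by (rule nn_integral_cmult_indicator) measurable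
    also have "\<dots> < \<infinity>"
      using emeasure_lborel_box_finite[of "- (real n *\<^sub>R One) :: (real, 'd) vec" "real n *\<^sub>R One"]
      by (simp only: ennreal_mult_less_top infinity_ennreal_def ennreal_less_top simp_thms)
    finally show ?thesis by simp
  qed
  fix X assume "X \<in> ?E"
  then obtain l u where X: "X = box l u" by auto
  \<comment> \<open>Both integrands factor over the coordinates: \<open>cf\<close> and
    \<open>cg\<close> carry the weights, \<open>Pf\<close> and \<open>Pg\<close> the constraints
    that come from the box and from the range of the first coordinate.\<close>
  define cf where "cf b t = (if b = ?e then ennreal (\<bar>t\<bar> / A) else 1)" for b :: "(real, 'd) vec" and t :: real
  define Pf where "Pf b t \<longleftrightarrow> (if b = ?e
      then (0 \<le> \<sigma> * t \<and> \<sigma> * t \<le> A) \<and> l \<bullet> b < A / 2 * (1 - (t / A)\<^sup>2) / s \<and> A / 2 * (1 - (t / A)\<^sup>2) / s < u \<bullet> b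
      else l \<bullet> b < t / sqrt s \<and> t / sqrt s < u \<bullet> b)" for b :: "(real, 'd) vec" and t :: real
  define cg where "cg b = (if b = ?e then ennreal s else ennreal (sqrt s))" for b :: "(real, 'd) vec"
  define Pg where "Pg b t \<longleftrightarrow> (if b = ?e then 0 \<le> t \<and> t \<le> A / (2 * s) else True) \<and> l \<bullet> b < t \<and> t < u \<bullet> b"
    for b :: "(real, 'd) vec" and t :: real
  have [measurable]: "(\<lambda>t. cf b t * (if Pf b t then 1 else 0)) \<in> borel_measurable borel" for b
    unfolding cf_def Pf_def by measurable
  have [measurable]: "(\<lambda>t. cg b * (if Pg b t then 1 else 0)) \<in> borel_measurable borel" for b
    unfolding cg_def Pg_def by measurable
  have one: "(\<integral>\<^sup>+t. cf b t * (if Pf b t then 1 else 0) \<partial>lborel) = (\<integral>\<^sup>+t. cg b * (if Pg b t then 1 else 0) \<partial>lborel)"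
    for b
  proof (cases "b = ?e")
    case True
    have "(\<integral>\<^sup>+t. cf b t * (if Pf b t then 1 else 0) \<partial>lborel) =
      (\<integral>\<^sup>+t. ennreal (\<bar>t\<bar> / A) * indicator {l \<bullet> b<..<u \<bullet> b} (A / 2 * (1 - (t / A)\<^sup>2) / s) *
        indicator {t. 0 \<le> \<sigma> * t \<and> \<sigma> * t \<le> A} t \<partial>lborel)"
      using True by (auto intro!: nn_integral_cong simp: cf_def Pf_def indicator_def)
    also have "\<dots> = ennreal s * (\<integral>\<^sup>+t. indicator {l \<bullet> b<..<u \<bullet> b} t * indicator {0..A / (2 * s)} t \<partial>lborel)"
      by (rule nn_integral_parabola_substitution[OF _ A_pos s \<sigma>]) measurable
    also have "\<dots> = (\<integral>\<^sup>+t. ennreal s * (indicator {l \<bullet> b<..<u \<bullet> b} t * indicator {0..A / (2 * s)} t) \<partial>lborel)"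
      by (rule nn_integral_cmult[symmetric]) measurable
    also have "\<dots> = (\<integral>\<^sup>+t. cg b * (if Pg b t then 1 else 0) \<partial>lborel)"
      using True by (auto intro!: nn_integral_cong simp: cg_def Pg_def indicator_def)
    finally show ?thesis .
  next
    case False
    let ?\<phi> = "indicator {l \<bullet> b<..<u \<bullet> b} :: real \<Rightarrow> ennreal"
    have "(\<integral>\<^sup>+t. cf b t * (if Pf b t then 1 else 0) \<partial>lborel) = (\<integral>\<^sup>+t. ?\<phi> (t / sqrt s) \<partial>lborel)"
      using False by (auto intro!: nn_integral_cong simp: cf_def Pf_def indicator_def)
    also have "\<dots> = ennreal \<bar>sqrt s\<bar> * (\<integral>\<^sup>+t. ?\<phi> ((0 + sqrt s * t) / sqrt s) \<partial>lborel)"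
      using s by (intro nn_integral_real_affine) auto
    also have "\<dots> = ennreal (sqrt s) * (\<integral>\<^sup>+t. ?\<phi> t \<partial>lborel)"
      using s by simp
    also have "\<dots> = (\<integral>\<^sup>+t. ennreal (sqrt s) * ?\<phi> t \<partial>lborel)"
      by (rule nn_integral_cmult[symmetric]) measurable
    also have "\<dots> = (\<integral>\<^sup>+t. cg b * (if Pg b t then 1 else 0) \<partial>lborel)"
      using False by (auto intro!: nn_integral_cong simp: cg_def Pg_def indicator_def)
    finally show ?thesis .
  qed
  have cfp: "(\<Prod>b\<in>Basis. cf b (z \<bullet> b)) = ennreal (\<bar>z $ first\<bar> / A)" for z
  proof -
    have "(\<Prod>b\<in>Basis. cf b (z \<bullet> b)) = (\<Prod>b\<in>Basis. if b = ?e then ennreal (\<bar>z $ first\<bar> / A) else 1)"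
      by (intro prod.cong) (auto simp: cf_def ze)
    thus ?thesis using e by simp
  qed
  \<comment> \<open>One factor \<open>s\<close> from the first coordinate and one factor
    \<open>sqrt s\<close> from each of the d - 1 others give the exponent (d + 1) / 2.\<close>
  have cgp: "(\<Prod>b\<in>Basis. cg b) = ennreal c"
  proof -
    have "(\<Prod>b\<in>Basis. cg b) = ennreal s * (\<Prod>b\<in>Basis - {?e}. ennreal (sqrt s))"
      using e by (simp add: prod.remove[of _ ?e] cg_def)
    also have "(\<Prod>b\<in>Basis - {?e}. ennreal (sqrt s)) = ennreal (sqrt s ^ (CARD('d) - 1))"
      using e s by (simp add: card_Diff_singleton ennreal_power)
    also have "ennreal s * \<dots> = ennreal (s * sqrt s ^ (CARD('d) - 1))"
      using s by (simp add: ennreal_mult)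
    also have "s * sqrt s ^ (CARD('d) - 1) = c"
    proof -
      have "sqrt s ^ (CARD('d) - 1) = s powr (1/2 * real (CARD('d) - 1))"
        using s powr_realpow[of "s powr (1/2)" "CARD('d) - 1"]
        by (simp only: powr_half_sqrt[symmetric] powr_powr less_imp_le powr_gt_zero)
      hence "s * sqrt s ^ (CARD('d) - 1) = s powr (1 + 1/2 * real (CARD('d) - 1))"
        using s by (simp add: powr_add)
      also have "1 + 1/2 * real (CARD('d) - 1) = (real CARD('d) + 1) / 2"
        by (simp add: of_nat_diff Suc_leI field_simps)
      finally show ?thesis by (simp add: c_def)
    qed
    finally show ?thesis .
  qed
  have allPf: "(\<forall>b\<in>Basis. Pf b (z \<bullet> b)) \<longleftrightarrow>
      chart s z \<in> box l u \<and> 0 \<le> \<sigma> * z $ first \<and> \<sigma> * z $ first \<le> A" for z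
    unfolding mem_box using e by (auto simp: Pf_def chart_inner ze split: if_splits)
  have allPg: "(\<forall>b\<in>Basis. Pg b (x \<bullet> b)) \<longleftrightarrow> x \<in> box l u \<and> 0 \<le> x $ first \<and> x $ first \<le> A / (2 * s)" for x
  proof -
    have "Pg b t \<longleftrightarrow> (l \<bullet> b < t \<and> t < u \<bullet> b) \<and> (b = ?e \<longrightarrow> 0 \<le> t \<and> t \<le> A / (2 * s))" for b t
      by (auto simp: Pg_def)
    hence "(\<forall>b\<in>Basis. Pg b (x \<bullet> b)) \<longleftrightarrow> (\<forall>b\<in>Basis. l \<bullet> b < x \<bullet> b \<and> x \<bullet> b < u \<bullet> b) \<and>
        0 \<le> x \<bullet> ?e \<and> x \<bullet> ?e \<le> A / (2 * s)" using e by blast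
    thus ?thesis unfolding mem_box ze .
  qed
  let ?W = "\<lambda>z :: (real, 'd) vec. ennreal (\<bar>z $ first\<bar> / A) *
      indicator {z. 0 \<le> \<sigma> * z $ first \<and> \<sigma> * z $ first \<le> A} z"
  let ?V = "\<lambda>x :: (real, 'd) vec. ennreal c * indicator {x. 0 \<le> x $ first \<and> x $ first \<le> A / (2 * s)} x"
  have XB: "X \<in> sets borel" by (simp add: X)
  have CX: "chart s -` X \<in> sets lborel"
    using measurable_sets[OF measurable_chart[OF s], of X] XB by simp
  have "{z :: (real, 'd) vec. 0 \<le> \<sigma> * z $ first \<and> \<sigma> * z $ first \<le> A} \<in> sets borel"
    by (intro borel_closed closed_Collect_conj closed_Collect_le continuous_intros)
  hence Wm: "?W \<in> borel_measurable lborel" by measurable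
  have "{x :: (real, 'd) vec. 0 \<le> x $ first \<and> x $ first \<le> A / (2 * s)} \<in> sets borel"
    by (intro borel_closed closed_Collect_conj closed_Collect_le continuous_intros)
  hence Vm: "?V \<in> borel_measurable lborel" by measurable
  have "emeasure ?M X = emeasure (density lborel ?W) (chart s -` X)"
    using emeasure_distr[of "chart s" "density lborel ?W" borel X] measurable_chart[OF s] XB by simp
  also have "\<dots> = (\<integral>\<^sup>+z. ?W z * indicator (chart s -` X) z \<partial>lborel)"
    using Wm CX by (rule emeasure_density)
  also have "\<dots> = (\<integral>\<^sup>+z. (\<Prod>b\<in>Basis. cf b (z \<bullet> b) * (if Pf b (z \<bullet> b) then 1 else 0)) \<partial>lborel)"
    unfolding prod_if_zero[OF finite_Basis] cfp allPf X
    by (intro nn_integral_cong) (auto simp: indicator_def)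
  also have "\<dots> = (\<Prod>b\<in>Basis. \<integral>\<^sup>+t. cf b t * (if Pf b t then 1 else 0) \<partial>lborel)"
    by (rule nn_integral_lborel_prod) auto
  also have "\<dots> = (\<Prod>b\<in>Basis. \<integral>\<^sup>+t. cg b * (if Pg b t then 1 else 0) \<partial>lborel)"
    unfolding one ..
  also have "\<dots> = (\<integral>\<^sup>+x. (\<Prod>b\<in>Basis. cg b * (if Pg b (x \<bullet> b) then 1 else 0)) \<partial>lborel)"
    by (rule nn_integral_lborel_prod[symmetric]) auto
  also have "\<dots> = (\<integral>\<^sup>+x. ennreal c * indicator {x. 0 \<le> x $ first \<and> x $ first \<le> A / (2 * s)} x * indicator X x \<partial>lborel)"
    unfolding prod_if_zero[OF finite_Basis] cgp allPg X
    by (intro nn_integral_cong) (auto simp: indicator_def)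
  also have "\<dots> = emeasure ?N X"
    using Vm XB by (intro emeasure_density[symmetric]) auto
  finally show "emeasure ?N X = emeasure ?M X" ..
qed

lemma chart_nn_integral:
  assumes s: "s > 0" and \<sigma>: "\<sigma> = 1 \<or> \<sigma> = -1" and F[measurable]: "F \<in> borel_measurable borel"
  shows "(\<integral>\<^sup>+z. ennreal (\<bar>z $ first\<bar> / A) *
      indicator {z. 0 \<le> \<sigma> * z $ first \<and> \<sigma> * z $ first \<le> A} z * F (chart s z) \<partial>lborel) =
    ennreal (s powr ((real CARD('d) + 1) / 2)) *
      (\<integral>\<^sup>+x. indicator {x. 0 \<le> x $ first \<and> x $ first \<le> A / (2 * s)} x * F x \<partial>lborel)"
proof -
  note [measurable] = measurable_chart[OF s]
  have "(\<integral>\<^sup>+z. ennreal (\<bar>z $ first\<bar> / A) *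
      indicator {z. 0 \<le> \<sigma> * z $ first \<and> \<sigma> * z $ first \<le> A} z * F (chart s z) \<partial>lborel) =
    (\<integral>\<^sup>+x. F x \<partial>distr (density lborel (\<lambda>z. ennreal (\<bar>z $ first\<bar> / A) *
      indicator {z. 0 \<le> \<sigma> * z $ first \<and> \<sigma> * z $ first \<le> A} z)) borel (chart s))"
    by (subst nn_integral_distr; (measurable)?) (subst nn_integral_density; measurable)
  also have "\<dots> = (\<integral>\<^sup>+x. ennreal (s powr ((real CARD('d) + 1) / 2)) *
      (indicator {x. 0 \<le> x $ first \<and> x $ first \<le> A / (2 * s)} x * F x) \<partial>lborel)"
    unfolding chart_pushforward[OF s \<sigma>]
    by (subst nn_integral_density) (measurable, simp add: mult.assoc)
  also have "\<dots> = ennreal (s powr ((real CARD('d) + 1) / 2)) *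
      (\<integral>\<^sup>+x. indicator {x. 0 \<le> x $ first \<and> x $ first \<le> A / (2 * s)} x * F x \<partial>lborel)"
    by (rule nn_integral_cmult) measurable
  finally show ?thesis .
qed

lemma interior_ellipsoidI:
  assumes "(\<Sum>k\<in>UNIV. (z $ k / a $ k)\<^sup>2) < 1"
  shows "z \<in> interior (ellipsoid a)"
proof (rule interiorI)
  show "open {z :: (real, 'd) vec. (\<Sum>k\<in>UNIV. (z $ k / a $ k)\<^sup>2) < 1}"
    using a_pos by (intro open_Collect_less continuous_intros) (simp add: less_imp_neq[symmetric])
  show "{z. (\<Sum>k\<in>UNIV. (z $ k / a $ k)\<^sup>2) < 1} \<subseteq> ellipsoid a" by (auto simp: ellipsoid_def)
qed (use assms in simp)

text \<open>A bounded chart means closeness to the tip: the first coordinate is off by at most 2 s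
  R, the transverse part only by order \<open>sqrt s\<close>, whence a bound for the squared
  distance. The tip itself is excluded because the density hypothesis is a punctured limit, and the
  bounds on |z_1| / A control the Jacobian weight.\<close>

lemma chart_near_tip:
  assumes s: "s > 0" and \<sigma>: "\<sigma> = 1 \<or> \<sigma> = -1" and z: "\<sigma> * z $ first > 0"
    and x: "chart s z \<in> P_H a" "chart s z $ first \<le> R"
  shows "z \<in> interior (ellipsoid a)" "z \<noteq> axis first (\<sigma> * A)"
    "(dist z (axis first (\<sigma> * A)))\<^sup>2 \<le> (2 * s * R)\<^sup>2 + 2 * q * A * s * R"
    "1 - 2 * s * R / A \<le> \<bar>z $ first\<bar> / A" "\<bar>z $ first\<bar> \<le> A"
proof -
  have d: "1 - (\<Sum>k\<in>UNIV. (z $ k / a $ k)\<^sup>2) > 0"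
    unfolding depth_chart[OF s] using s x(1) by (simp add: P_H_iff)
  thus "z \<in> interior (ellipsoid a)" by (intro interior_ellipsoidI) simp
  show "z \<noteq> axis first (\<sigma> * A)"
  proof
    assume "z = axis first (\<sigma> * A)"
    hence "(\<Sum>k\<in>UNIV. (z $ k / a $ k)\<^sup>2) \<ge> 1"
      unfolding sum_ratio_sq using \<sigma> A_pos rad_nonneg[of z] by (auto simp: axis_def)
    thus False using d by simp
  qed
  define x1 where "x1 = chart s z $ first"
  have x1: "0 < x1" "x1 \<le> R" using P_H_first_pos[OF x(1)] x(2) by (auto simp: x1_def)
  have R: "R > 0" using x1 by simp
  have sq: "(z $ first)\<^sup>2 = A\<^sup>2 - 2 * A * s * x1" using first_sq_chart[OF s, of z] by (simp add: x1_def)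
  have sqR: "A\<^sup>2 - 2 * A * s * R \<le> (z $ first)\<^sup>2"
    unfolding sq using x1 A_pos s by (intro diff_left_mono mult_left_mono) auto
  have "(z $ first)\<^sup>2 \<le> A\<^sup>2" unfolding sq using x1 A_pos s by simp
  thus le: "\<bar>z $ first\<bar> \<le> A" using A_pos by (simp add: abs_le_square_iff[symmetric])
  have ge: "A * (A - 2 * s * R) \<le> A * \<bar>z $ first\<bar>"
  proof -
    have "A * (A - 2 * s * R) = A\<^sup>2 - 2 * A * s * R" by (simp add: algebra_simps power2_eq_square)
    also have "\<dots> \<le> \<bar>z $ first\<bar> * \<bar>z $ first\<bar>" using sqR by (simp add: power2_eq_square)
    also have "\<dots> \<le> A * \<bar>z $ first\<bar>" using le by (intro mult_right_mono) auto
    finally show ?thesis .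
  qed
  hence ge': "A - 2 * s * R \<le> \<bar>z $ first\<bar>" using A_pos by simp
  thus "1 - 2 * s * R / A \<le> \<bar>z $ first\<bar> / A"
    using divide_right_mono[OF ge', of A] A_pos by (simp add: diff_divide_distrib)
  have "dist z (axis first (\<sigma> * A)) = norm (z - axis first (\<sigma> * A))" by (simp add: dist_norm)
  moreover have "(norm (z - axis first (\<sigma> * A)))\<^sup>2 = (z $ first - \<sigma> * A)\<^sup>2 + (norm (tilde z))\<^sup>2"
  proof -
    have "tilde (axis first (\<sigma> * A)) = (0 :: (real, 'd) vec)" by (simp add: tilde_def vec_eq_iff axis_def)
    thus ?thesis using norm_diff_sq_first[of z "axis first (\<sigma> * A)"] by simp
  qed
  moreover have "(z $ first - \<sigma> * A)\<^sup>2 \<le> (2 * s * R)\<^sup>2"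
  proof -
    have "\<bar>z $ first - \<sigma> * A\<bar> \<le> \<bar>2 * s * R\<bar>" using \<sigma> z le ge' s R by auto
    thus ?thesis by (simp only: abs_le_square_iff)
  qed
  moreover have "(norm (tilde z))\<^sup>2 \<le> 2 * q * A * s * R"
  proof -
    have "rad z = s * rad (chart s z)" using rad_chart[OF s, of z] s by simp
    also have "\<dots> \<le> s * (2 * R / A)"
    proof -
      have "rad (chart s z) \<le> 2 * x1 / A" using P_H_rad_less[OF x(1)] by (simp add: x1_def)
      also have "\<dots> \<le> 2 * R / A" using x1 A_pos by (simp add: divide_right_mono)
      finally show ?thesis using s by (intro mult_left_mono) auto
    qed
    finally have "q * A\<^sup>2 * rad z \<le> q * A\<^sup>2 * (s * (2 * R / A))"
      using q_nonneg by (intro mult_left_mono) auto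
    also have "\<dots> = 2 * q * A * s * R" using A_pos by (simp add: power2_eq_square)
    finally show ?thesis using norm_tilde_sq_le[of z] by linarith
  qed
  ultimately show "(dist z (axis first (\<sigma> * A)))\<^sup>2 \<le> (2 * s * R)\<^sup>2 + 2 * q * A * s * R" by simp
qed

lemma measurable_depth [measurable]: "depth \<in> borel_measurable borel"
  unfolding depth_def[abs_def] rad_def[abs_def] by measurable

lemma P_H_borel [measurable]: "P_H a \<in> sets borel"
proof -
  have "P_H a = {x. depth x > 0}" using P_H_iff by auto
  thus ?thesis by simp
qed

lemma Lambda_eq:
  assumes C: "C \<in> sets borel" "C \<subseteq> P_H a"
  shows "emeasure (Lambda a \<beta>) C = (\<integral>\<^sup>+x. ennreal (depth x powr \<beta>) * indicator C x \<partial>lborel)"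
proof -
  note [measurable] = C(1)
  have L: "Lambda a \<beta> = density lborel (\<lambda>z. ennreal (depth z powr \<beta> * indicator (P_H a) z))"
    unfolding Lambda_def depth_def rad_def ..
  have "emeasure (Lambda a \<beta>) C = (\<integral>\<^sup>+x. ennreal (depth x powr \<beta> * indicator (P_H a) x) * indicator C x \<partial>lborel)"
    unfolding L by (rule emeasure_density) (use C in measurable)
  also have "\<dots> = (\<integral>\<^sup>+x. ennreal (depth x powr \<beta>) * indicator C x \<partial>lborel)"
    using C by (intro nn_integral_cong) (auto simp: indicator_def)
  finally show ?thesis .
qed

text \<open>Near the tip the density ratio and the Jacobian weight are both close to 1, uniformly
  over charts with first coordinate at most R, so one \<open>s0\<close> serves all \<open>C\<close>.
  Multiplicative bounds make sense before \<open>Lambda a \<beta>\<close> is known to be finite on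
  \<open>C\<close>. In the exponent, (d + 1) / 2 stems from the volume and \<beta> from the
  density.\<close>

lemma tip_mass:
  fixes f :: "(real, 'd) vec \<Rightarrow> real"
  assumes \<sigma>: "\<sigma> = 1 \<or> \<sigma> = -1" and \<alpha>: "\<alpha> > 0" and R: "R \<ge> 0" and e: "0 < e" "e < 1"
    and f: "((\<lambda>z. f z / (\<alpha> * (1 - z \<bullet> (matrix_inv (Sigma_mat a) *v z)) powr \<beta>)) \<longlongrightarrow> 1)
        (at (axis first (\<sigma> * A)) within interior (ellipsoid a))"
  shows "\<exists>s0>0. \<forall>s C. 0 < s \<and> s < s0 \<and> C \<in> sets borel \<and> C \<subseteq> P_H a \<inter> {x. x $ first \<le> R} \<longrightarrow>
    ennreal ((1 - e) * \<alpha> * s powr ((real CARD('d) + 1) / 2 + \<beta>)) * emeasure (Lambda a \<beta>) C \<le>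
      (\<integral>\<^sup>+z. ennreal (f z * indicator (ellipsoid a) z) *
        indicator {z. \<sigma> * z $ first > 0 \<and> chart s z \<in> C} z \<partial>lborel) \<and>
    (\<integral>\<^sup>+z. ennreal (f z * indicator (ellipsoid a) z) *
        indicator {z. \<sigma> * z $ first > 0 \<and> chart s z \<in> C} z \<partial>lborel) \<le>
      ennreal ((1 + e) * \<alpha> * s powr ((real CARD('d) + 1) / 2 + \<beta>)) * emeasure (Lambda a \<beta>) C"
proof -
  let ?p = "axis first (\<sigma> * A) :: (real, 'd) vec"
  \<comment> \<open>Two errors combine: the density ratio lies between 1 - e' and 1 + e', and the
    Jacobian weight between 1 - e' and 1. A third of \<open>e\<close> suffices because e <
    1.\<close>
  define e' where "e' = e / 3"
  have e': "0 < e'" "e' < 1" "(1 + e') \<le> (1 + e) * (1 - e')"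
  proof -
    have "e * e \<le> e * 1" using e by (intro mult_left_mono) auto
    moreover have "(1 + e) * (1 - e') = 1 + 2 / 3 * e - e * e / 3" by (simp add: e'_def field_simps)
    ultimately show "(1 + e') \<le> (1 + e) * (1 - e')" unfolding e'_def by linarith
  qed (use e in \<open>auto simp: e'_def\<close>)
  have "eventually (\<lambda>z. dist (f z / (\<alpha> * (1 - z \<bullet> (matrix_inv (Sigma_mat a) *v z)) powr \<beta>)) 1 < e')
      (at ?p within interior (ellipsoid a))"
    using f e'(1) by (rule tendstoD)
  then obtain \<delta> where \<delta>: "\<delta> > 0" and
    near: "\<And>z. z \<in> interior (ellipsoid a) \<Longrightarrow> z \<noteq> ?p \<Longrightarrow> dist z ?p < \<delta> \<Longrightarrow>
      dist (f z / (\<alpha> * (1 - z \<bullet> (matrix_inv (Sigma_mat a) *v z)) powr \<beta>)) 1 < e'"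
    unfolding eventually_at by blast
  have "((\<lambda>s. (2 * s * R)\<^sup>2 + 2 * q * A * s * R) \<longlongrightarrow> (2 * 0 * R)\<^sup>2 + 2 * q * A * 0 * R) (at_right 0)"
    by (intro tendsto_intros)
  hence ev1: "eventually (\<lambda>s. (2 * s * R)\<^sup>2 + 2 * q * A * s * R < \<delta>\<^sup>2) (at_right 0)"
    using \<delta> by (intro order_tendstoD) auto
  have "((\<lambda>s. 2 * s * R / A) \<longlongrightarrow> 2 * 0 * R / A) (at_right 0)" by (intro tendsto_intros) (use A_pos in auto)
  hence ev2: "eventually (\<lambda>s. 2 * s * R / A < e') (at_right 0)" using e' by (intro order_tendstoD) auto
  from eventually_conj[OF ev1 ev2] obtain s0 where s0: "s0 > 0" and
    small: "\<And>s. 0 < s \<Longrightarrow> s < s0 \<Longrightarrow> (2 * s * R)\<^sup>2 + 2 * q * A * s * R < \<delta>\<^sup>2 \<and> 2 * s * R / A < e'"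
    unfolding eventually_at_right_field by blast
  show ?thesis
  proof (intro exI[of _ s0] conjI allI impI s0; (elim conjE)?)
    fix s C assume s: "0 < s" "s < s0" and C: "C \<in> sets borel" "C \<subseteq> P_H a \<inter> {x. x $ first \<le> R}"
    note [measurable] = C(1) measurable_chart[OF s(1)]
    define H where "H = {z :: (real, 'd) vec. 0 \<le> \<sigma> * z $ first \<and> \<sigma> * z $ first \<le> A}"
    define F where "F x = ennreal (depth x powr \<beta>) * indicator C x" for x
    define J where "J z = ennreal (\<bar>z $ first\<bar> / A) * indicator H z * F (chart s z)" for z
    define I where "I z = ennreal (f z * indicator (ellipsoid a) z) *
        indicator {z. \<sigma> * z $ first > 0 \<and> chart s z \<in> C} z" for z
    have [measurable]: "F \<in> borel_measurable borel" unfolding F_def by measurable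
    have [measurable]: "H \<in> sets borel" unfolding H_def by measurable
    have JL: "(\<integral>\<^sup>+z. J z \<partial>lborel) = ennreal (s powr ((real CARD('d) + 1) / 2)) * emeasure (Lambda a \<beta>) C"
    proof -
      \<comment> \<open>The pushforward stops at A / (2 s), the first chart coordinate of the
        equator; for small \<open>s\<close> this lies beyond \<open>R\<close>, so nothing of
        \<open>C\<close> is cut off.\<close>
      have "2 * s * R / A < 1" using small[OF s] e' by linarith
      hence "R \<le> A / (2 * s)" using s A_pos by (simp add: field_simps)
      hence "indicator {x. 0 \<le> x $ first \<and> x $ first \<le> A / (2 * s)} x * F x = F x" for x
        using C P_H_first_pos[of x] by (cases "x \<in> C") (auto simp: F_def indicator_def)
      moreover have "emeasure (Lambda a \<beta>) C = (\<integral>\<^sup>+x. F x \<partial>lborel)"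
        unfolding F_def using C by (intro Lambda_eq) auto
      ultimately show ?thesis
        unfolding J_def H_def using chart_nn_integral[OF s(1) \<sigma>, of F] by simp
    qed
    have bounds: "ennreal ((1 - e) * \<alpha> * s powr \<beta>) * J z \<le> I z \<and> I z \<le> ennreal ((1 + e) * \<alpha> * s powr \<beta>) * J z" for z
    proof (cases "\<sigma> * z $ first > 0 \<and> chart s z \<in> C")
      case False
      \<comment> \<open>The equator belongs to \<open>H\<close> but to neither open half; the weight
        |z_1| / A vanishes there.\<close>
      hence "z $ first = 0 \<or> z \<notin> H \<or> chart s z \<notin> C" using \<sigma> by (auto simp: H_def)
      hence "J z = 0" by (auto simp: J_def F_def)
      moreover have "I z = 0" using False by (simp add: I_def)
      ultimately show ?thesis by simp
    next
      case True
      have x: "chart s z \<in> P_H a" "chart s z $ first \<le> R" using True C by auto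
      note tip = chart_near_tip[OF s(1) \<sigma> True[THEN conjunct1] x]
      have "(dist z ?p)\<^sup>2 < \<delta>\<^sup>2" using tip(3) small[OF s] by linarith
      hence "dist z ?p < \<delta>" using \<delta> by (simp add: power2_less_imp_less)
      hence r: "dist (f z / (\<alpha> * (1 - z \<bullet> (matrix_inv (Sigma_mat a) *v z)) powr \<beta>)) 1 < e'"
        using tip(1,2) by (intro near)
      define w where "w = \<alpha> * s powr \<beta> * depth (chart s z) powr \<beta>"
      have dp: "depth (chart s z) > 0" using x(1) by (simp add: P_H_iff)
      have w: "w > 0" unfolding w_def using \<alpha> s dp by simp
      have "\<alpha> * (1 - z \<bullet> (matrix_inv (Sigma_mat a) *v z)) powr \<beta> = w"
        unfolding quadratic_form depth_chart[OF s(1)] w_def using s dp by (simp add: powr_mult)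
      hence "\<bar>f z / w - 1\<bar> < e'" using r by (simp add: dist_real_def)
      hence fz: "(1 - e') * w \<le> f z" "f z \<le> (1 + e') * w"
        using w by (auto simp: abs_less_iff field_simps)
      define j where "j = \<bar>z $ first\<bar> / A"
      have j: "1 - e' \<le> j" "j \<le> 1" "0 \<le> j" using tip(4,5) small[OF s] A_pos by (auto simp: j_def)
      have "(1 - e) * (w * j) \<le> (1 - e') * w"
        using w j e e' by (intro mult_mono mult_left_le) (auto simp: e'_def)
      hence lo: "(1 - e) * (w * j) \<le> f z" using fz by linarith
      have "(1 + e') * w \<le> ((1 + e) * (1 - e')) * w" using e' w by (intro mult_right_mono) auto
      also have "\<dots> \<le> ((1 + e) * j) * w" using j e w by (intro mult_right_mono mult_left_mono) auto
      finally have up: "f z \<le> (1 + e) * (w * j)" using fz by (simp add: mult_ac)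
      have zE: "z \<in> ellipsoid a" using tip(1) interior_subset by blast
      have Iz: "I z = ennreal (f z)" using zE True by (simp add: I_def)
      have zH: "z \<in> H" using True tip(5) \<sigma> by (auto simp: H_def)
      have Jz: "ennreal (t * \<alpha> * s powr \<beta>) * J z = ennreal (t * (w * j))" if "t \<ge> 0" for t
      proof -
        have "J z = ennreal (j * depth (chart s z) powr \<beta>)"
          using zH True j(3) by (simp add: J_def F_def j_def[symmetric] ennreal_mult)
        thus ?thesis using that \<alpha> j(3)
          by (simp add: ennreal_mult[symmetric] w_def mult_ac)
      qed
      show ?thesis unfolding Iz using Jz[of "1 - e"] Jz[of "1 + e"] e lo up
        by (simp add: ennreal_leI)
    qed
    have pw: "ennreal (t * \<alpha> * s powr \<beta>) * (\<integral>\<^sup>+z. J z \<partial>lborel) =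
        ennreal (t * \<alpha> * s powr ((real CARD('d) + 1) / 2 + \<beta>)) * emeasure (Lambda a \<beta>) C" if "t \<ge> 0" for t
      unfolding JL mult.assoc[symmetric] using that \<alpha> s
      by (simp add: ennreal_mult[symmetric] powr_add mult_ac)
    have [measurable]: "J \<in> borel_measurable borel" unfolding J_def by measurable
    have "ennreal ((1 - e) * \<alpha> * s powr \<beta>) * (\<integral>\<^sup>+z. J z \<partial>lborel) \<le> (\<integral>\<^sup>+z. I z \<partial>lborel)"
      using bounds by (subst nn_integral_cmult[symmetric]) (auto intro!: nn_integral_mono)
    thus "ennreal ((1 - e) * \<alpha> * s powr ((real CARD('d) + 1) / 2 + \<beta>)) * emeasure (Lambda a \<beta>) C \<le>
      (\<integral>\<^sup>+z. ennreal (f z * indicator (ellipsoid a) z) *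
        indicator {z. \<sigma> * z $ first > 0 \<and> chart s z \<in> C} z \<partial>lborel)"
      using pw[of "1 - e"] e by (simp add: I_def)
    have "(\<integral>\<^sup>+z. I z \<partial>lborel) \<le> ennreal ((1 + e) * \<alpha> * s powr \<beta>) * (\<integral>\<^sup>+z. J z \<partial>lborel)"
      using bounds by (subst nn_integral_cmult[symmetric]) (auto intro!: nn_integral_mono)
    thus "(\<integral>\<^sup>+z. ennreal (f z * indicator (ellipsoid a) z) *
        indicator {z. \<sigma> * z $ first > 0 \<and> chart s z \<in> C} z \<partial>lborel) \<le>
      ennreal ((1 + e) * \<alpha> * s powr ((real CARD('d) + 1) / 2 + \<beta>)) * emeasure (Lambda a \<beta>) C"
      using pw[of "1 + e"] e by (simp add: I_def)
  qed
qed

end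

subsection \<open>Discretization\<close>

text \<open>The compact closure is covered by finitely many balls, and each point goes to the first
  centre within \<delta>. The centres are chosen in \<open>B\<close> itself, so that values of
  \<open>G\<close> at centres are again nonnegative.\<close>

lemma finite_cells:
  fixes B :: "'a::euclidean_space set"
  assumes "bounded B" "\<delta> > 0"
  shows "\<exists>m (cell :: 'a \<Rightarrow> nat) (\<mu> :: nat \<Rightarrow> 'a). cell \<in> measurable borel (count_space UNIV) \<and>
    (\<forall>x\<in>B. cell x < m \<and> \<mu> (cell x) \<in> B \<and> dist x (\<mu> (cell x)) < \<delta>)"
proof -
  have "closure B \<subseteq> (\<Union>x\<in>B. ball x \<delta>)"
  proof
    fix y assume "y \<in> closure B"
    then obtain x where "x \<in> B" "dist x y < \<delta>" using assms(2) closure_approachable by blast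
    thus "y \<in> (\<Union>x\<in>B. ball x \<delta>)" by auto
  qed
  moreover have "compact (closure B)" using assms(1) by (simp add: compact_closure)
  ultimately obtain k where k: "k \<subseteq> B" "finite k" "closure B \<subseteq> (\<Union>x\<in>k. ball x \<delta>)"
    by (metis (no_types, lifting) compactE_image open_ball)
  obtain m and \<mu> :: "nat \<Rightarrow> 'a" where \<mu>: "k = \<mu> ` {i. i < m}"
    using k(2) finite_imp_nat_seg_image_inj_on by blast
  \<comment> \<open>The alternative \<open>m \<le> c\<close> makes the least index exist everywhere,
    with the default \<open>m\<close> off the balls; this gives a total measurable map.\<close>
  define cell where "cell x = (LEAST c. m \<le> c \<or> dist x (\<mu> c) < \<delta>)" for x
  have "cell \<in> measurable borel (count_space UNIV)" unfolding cell_def by measurable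
  moreover have "cell x < m \<and> \<mu> (cell x) \<in> B \<and> dist x (\<mu> (cell x)) < \<delta>" if "x \<in> B" for x
  proof -
    have "x \<in> closure B" using that closure_subset by blast
    then obtain c where c: "c < m" "dist x (\<mu> c) < \<delta>" using k(3) by (auto simp: \<mu> dist_commute)
    have Q: "m \<le> c \<or> dist x (\<mu> c) < \<delta>" using c by simp
    have "m \<le> cell x \<or> dist x (\<mu> (cell x)) < \<delta>"
      using LeastI[of "\<lambda>c. m \<le> c \<or> dist x (\<mu> c) < \<delta>", OF Q] unfolding cell_def .
    moreover have "cell x \<le> c"
      using Least_le[of "\<lambda>c. m \<le> c \<or> dist x (\<mu> c) < \<delta>", OF Q] unfolding cell_def .
    ultimately show ?thesis using c k(1) by (auto simp: \<mu>)
  qed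
  ultimately show ?thesis by blast
qed

text \<open>A pair of cells contributes the product of its two counts. Once values depend only on
  cells, the order statistics of the pairs are therefore functions of the counts.\<close>

lemma attained_cells_iff:
  fixes g :: "nat \<Rightarrow> nat \<Rightarrow> real"
  assumes "finite L" "finite R" "\<And>p. p \<in> L \<Longrightarrow> cl p < m" "\<And>p. p \<in> R \<Longrightarrow> cr p < m"
  shows "attained i (L \<times> R) (\<lambda>(p, r). g (cl p) (cr r)) t \<longleftrightarrow>
    i \<le> (\<Sum>c<m. \<Sum>c'<m. if g c c' \<le> t then card {p\<in>L. cl p = c} * card {p\<in>R. cr p = c'} else 0)"
proof -
  have "card {x \<in> L \<times> R. (case x of (p, r) \<Rightarrow> g (cl p) (cr r)) \<le> t} =
      (\<Sum>x\<in>L \<times> R. if (case x of (p, r) \<Rightarrow> g (cl p) (cr r)) \<le> t then 1 else 0)"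
    using assms(1,2) by (simp add: sum.inter_filter[symmetric])
  also have "\<dots> = (\<Sum>p\<in>L. \<Sum>r\<in>R. if g (cl p) (cr r) \<le> t then 1 else 0)"
    by (simp add: sum.cartesian_product case_prod_unfold)
  also have "\<dots> = (\<Sum>p\<in>L. \<Sum>c'<m. card {p\<in>R. cr p = c'} * (if g (cl p) c' \<le> t then 1 else 0))"
    using assms by (intro sum.cong refl, subst sum_fun_comp[where g = cr and R = "{..<m}"]) auto
  also have "\<dots> = (\<Sum>c<m. card {p\<in>L. cl p = c} * (\<Sum>c'<m. card {p\<in>R. cr p = c'} * (if g c c' \<le> t then 1 else 0)))"
    using assms by (subst sum_fun_comp[where g = cl and R = "{..<m}"]) auto
  also have "\<dots> = (\<Sum>c<m. \<Sum>c'<m. if g c c' \<le> t then card {p\<in>L. cl p = c} * card {p\<in>R. cr p = c'} else 0)"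
    unfolding sum_distrib_left by (intro sum.cong refl) simp
  finally show ?thesis using assms(1,2) by (simp add: attained_iff_card)
qed

text \<open>Unordered index pairs against pairs with one index at each tip: forward, a pair is
  turned so that its index in \<open>L\<close> comes first; backward, it is sorted, which is
  injective because \<open>L\<close> and \<open>R\<close> are disjoint. The level \<open>K\<close>
  enters forward, where \<open>far\<close> has to locate the pair.\<close>

lemma attained_pairs_close:
  fixes val g :: "nat \<Rightarrow> nat \<Rightarrow> real"
  assumes LR: "L \<subseteq> {1..N}" "R \<subseteq> {1..N}" "L \<inter> R = {}"
    and sym: "\<And>i j. val i j = val j i"
    and far: "\<And>i j. i \<in> {1..N} \<Longrightarrow> j \<in> {1..N} \<Longrightarrow> val i j \<le> K \<Longrightarrow> i \<in> L \<and> j \<in> R \<or> j \<in> L \<and> i \<in> R"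
    and close: "\<And>i j. i \<in> L \<Longrightarrow> j \<in> R \<Longrightarrow> \<bar>val i j - g i j\<bar> \<le> e"
  shows "attained k {(i, j). 1 \<le> i \<and> i < j \<and> j \<le> N} (\<lambda>(i, j). val i j) t \<Longrightarrow> t \<le> K \<Longrightarrow>
      attained k (L \<times> R) (\<lambda>(i, j). g i j) (t + e)"
    and "attained k (L \<times> R) (\<lambda>(i, j). g i j) t \<Longrightarrow>
      attained k {(i, j). 1 \<le> i \<and> i < j \<and> j \<le> N} (\<lambda>(i, j). val i j) (t + e)"
proof -
  assume att: "attained k {(i, j). 1 \<le> i \<and> i < j \<and> j \<le> N} (\<lambda>(i, j). val i j) t" and "t \<le> K"
  let ?\<phi> = "\<lambda>(i, j). if i \<in> L then (i, j) else (j, i)"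
  show "attained k (L \<times> R) (\<lambda>(i, j). g i j) (t + e)"
  proof (rule attained_inj[OF att, where \<phi> = ?\<phi>])
    fix p assume p: "p \<in> {(i, j). 1 \<le> i \<and> i < j \<and> j \<le> N}" "(case p of (i, j) \<Rightarrow> val i j) \<le> t"
    obtain i j where ij: "p = (i, j)" by (cases p)
    have v: "val i j \<le> t" "val i j \<le> K" using p ij \<open>t \<le> K\<close> by auto
    have "i \<in> L \<and> j \<in> R \<or> j \<in> L \<and> i \<in> R" using p ij v by (intro far) auto
    thus "?\<phi> p \<in> L \<times> R \<and> (case ?\<phi> p of (i, j) \<Rightarrow> g i j) \<le> t + e"
      using close[of i j] close[of j i] sym[of j i] v LR(3) ij by (auto simp: abs_le_iff)
  next
    show "inj_on ?\<phi> {p \<in> {(i, j). 1 \<le> i \<and> i < j \<and> j \<le> N}. (case p of (i, j) \<Rightarrow> val i j) \<le> t}"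
      by (auto simp: inj_on_def split: if_splits)
  qed
next
  assume att: "attained k (L \<times> R) (\<lambda>(i, j). g i j) t"
  let ?\<phi> = "\<lambda>(i, j). (min i j, max i j)"
  show "attained k {(i, j). 1 \<le> i \<and> i < j \<and> j \<le> N} (\<lambda>(i, j). val i j) (t + e)"
  proof (rule attained_inj[OF att, where \<phi> = ?\<phi>])
    fix p assume p: "p \<in> L \<times> R" "(case p of (i, j) \<Rightarrow> g i j) \<le> t"
    obtain i j where ij: "p = (i, j)" by (cases p)
    have "i \<noteq> j" using p ij LR(3) by auto
    moreover have "val i j \<le> t + e" using close[of i j] p ij by (auto simp: abs_le_iff)
    moreover have "i \<in> {1..N}" "j \<in> {1..N}" using p ij LR by auto
    ultimately show "?\<phi> p \<in> {(i, j). 1 \<le> i \<and> i < j \<and> j \<le> N} \<and> (case ?\<phi> p of (i, j) \<Rightarrow> val i j) \<le> t + e"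
      using ij sym[of i j] by (auto simp: min_def max_def)
  next
    show "inj_on ?\<phi> {p \<in> L \<times> R. (case p of (i, j) \<Rightarrow> g i j) \<le> t}"
    proof (rule inj_onI)
      fix p p' assume p: "p \<in> {p \<in> L \<times> R. (case p of (i, j) \<Rightarrow> g i j) \<le> t}"
        "p' \<in> {p \<in> L \<times> R. (case p of (i, j) \<Rightarrow> g i j) \<le> t}" "?\<phi> p = ?\<phi> p'"
      obtain i j i' j' where ij: "p = (i, j)" "p' = (i', j')" by (cases p, cases p') auto
      have "i = i' \<and> j = j' \<or> i = j' \<and> j = i'"
        using p(3) ij by (auto simp: min_def max_def split: if_splits)
      thus "p = p'" using p(1,2) ij LR(3) by auto
    qed
  qed
qed

text \<open>Counterpart for the limit, where a pair already has one member from each process and the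
  identity map serves both directions.\<close>

lemma attained_restrict:
  fixes val g :: "'p \<Rightarrow> real"
  assumes "S' \<subseteq> S"
    and far: "\<And>p. p \<in> S \<Longrightarrow> val p \<le> K \<Longrightarrow> p \<in> S'"
    and close: "\<And>p. p \<in> S' \<Longrightarrow> \<bar>val p - g p\<bar> \<le> e"
  shows "attained k S val t \<Longrightarrow> t \<le> K \<Longrightarrow> attained k S' g (t + e)"
    and "attained k S' g t \<Longrightarrow> attained k S val (t + e)"
proof -
  assume "attained k S val t" "t \<le> K"
  thus "attained k S' g (t + e)"
  proof (elim attained_inj[where \<phi> = "\<lambda>p. p"])
    fix p assume p: "p \<in> S" "val p \<le> t"
    hence "p \<in> S'" using \<open>t \<le> K\<close> by (intro far) auto
    thus "p \<in> S' \<and> g p \<le> t + e" using close[of p] p by (auto simp: abs_le_iff)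
  qed simp
next
  assume "attained k S' g t"
  thus "attained k S val (t + e)"
  proof (elim attained_inj[where \<phi> = "\<lambda>p. p"])
    fix p assume p: "p \<in> S'" "g p \<le> t"
    thus "p \<in> S \<and> val p \<le> t + e" using close[of p] assms(1) by (auto simp: abs_le_iff)
  qed simp
qed

section \<open>Arrival times as random variables\<close>

lemma arrival_point_masses:
  assumes "i \<ge> 1"
  shows "arrival i (point_masses I v) = Inf {t. attained i {p\<in>I. 0 \<le> v p} v t}"
proof -
  have "of_nat i \<le> emeasure (point_masses I v) {0..t} \<longleftrightarrow> attained i {p\<in>I. 0 \<le> v p} v t" for t
  proof -
    have eq: "v -` {0..t} \<inter> I = {p \<in> {p\<in>I. 0 \<le> v p}. v p \<le> t}" by auto
    have "emeasure (point_masses I v) {0..t} = emeasure (count_space I) (v -` {0..t} \<inter> I)"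
      unfolding point_masses_def by (subst emeasure_distr) auto
    also have "\<dots> = emeasure (count_space {p\<in>I. 0 \<le> v p}) {p \<in> {p\<in>I. 0 \<le> v p}. v p \<le> t}"
      unfolding eq by (subst (1 2) emeasure_count_space) auto
    finally show ?thesis by (simp only: attained_iff_emeasure)
  qed
  thus ?thesis by (simp add: arrival_def)
qed

text \<open>The set of attained levels is upward closed, so its infimum lies below \<open>c\<close>
  as soon as a rational below \<open>c\<close> belongs to it; at a fixed level, attainment is a
  union over the countably many index sets of size \<open>i\<close>.\<close>

lemma measurable_arrival:
  fixes v :: "'p \<Rightarrow> 'w \<Rightarrow> real"
  assumes i: "i \<ge> 1" and I: "countable I" and v: "\<And>p. p \<in> I \<Longrightarrow> v p \<in> borel_measurable M"
  shows "(\<lambda>\<omega>. arrival i (point_masses I (\<lambda>p. v p \<omega>))) \<in> borel_measurable M"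
proof -
  define T where "T \<omega> = {t. attained i {p\<in>I. 0 \<le> v p \<omega>} (\<lambda>p. v p \<omega>) t}" for \<omega>
  define \<F> where "\<F> = {F. finite F \<and> F \<subseteq> I \<and> card F = i}"
  have cF: "countable \<F>"
    using countable_Collect_finite_subset[OF I] by (rule countable_subset[rotated]) (auto simp: \<F>_def)
  have Tset: "{\<omega>\<in>space M. t \<in> T \<omega>} \<in> sets M" for t
  proof -
    have "{\<omega>\<in>space M. t \<in> T \<omega>} = (\<Union>F\<in>\<F>. {\<omega>\<in>space M. \<forall>p\<in>F. 0 \<le> v p \<omega> \<and> v p \<omega> \<le> t})"
      unfolding T_def \<F>_def attained_def by blast
    also have "\<dots> \<in> sets M"
    proof (intro sets.countable_UN'' cF)
      fix F assume F: "F \<in> \<F>"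
      have "v p \<in> borel_measurable M" if "p \<in> F" for p using F that v by (auto simp: \<F>_def)
      thus "{\<omega>\<in>space M. \<forall>p\<in>F. 0 \<le> v p \<omega> \<and> v p \<omega> \<le> t} \<in> sets M"
        using F i by (intro sets.sets_Collect_finite_All' sets.sets_Collect_conj) (auto simp: \<F>_def)
    qed
    finally show ?thesis .
  qed
  have up: "u \<in> T \<omega>" if "t \<in> T \<omega>" "t \<le> u" for t u \<omega>
    using that by (auto simp: T_def intro: attained_mono)
  have bdd: "bdd_below (T \<omega>)" for \<omega>
    unfolding bdd_below_def using attained_nonneg[OF _ i] by (intro exI[of _ 0]) (auto simp: T_def)
  \<comment> \<open>Where no level is attained, \<open>Inf\<close> takes the fixed value
    \<open>Inf {}\<close>; the second part of the union accounts for this event.\<close>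
  have "{\<omega>\<in>space M. Inf (T \<omega>) < c} =
      (\<Union>r\<in>{r\<in>\<rat>. r < c}. {\<omega>\<in>space M. r \<in> T \<omega>}) \<union>
      (if Inf {} < c then space M - (\<Union>r\<in>\<rat>. {\<omega>\<in>space M. r \<in> T \<omega>}) else {})" for c
  proof (intro set_eqI)
    fix \<omega>
    show "\<omega> \<in> {\<omega>\<in>space M. Inf (T \<omega>) < c} \<longleftrightarrow> \<omega> \<in> (\<Union>r\<in>{r\<in>\<rat>. r < c}. {\<omega>\<in>space M. r \<in> T \<omega>}) \<union>
      (if Inf {} < c then space M - (\<Union>r\<in>\<rat>. {\<omega>\<in>space M. r \<in> T \<omega>}) else {})"
    proof (cases "T \<omega> = {}")
      case True
      thus ?thesis by auto
    next
      case False
      then obtain t where t: "t \<in> T \<omega>" by auto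
      obtain r where "r \<in> \<rat>" "t < r" using Rats_dense_in_real[of t "t + 1"] by auto
      hence r: "r \<in> \<rat>" "r \<in> T \<omega>" using up[OF t] by auto
      have "Inf (T \<omega>) < c \<longleftrightarrow> (\<exists>t\<in>T \<omega>. t < c)" using False bdd by (rule cInf_less_iff)
      also have "\<dots> \<longleftrightarrow> (\<exists>r\<in>\<rat>. r < c \<and> r \<in> T \<omega>)"
      proof
        assume "\<exists>t\<in>T \<omega>. t < c"
        then obtain t where "t \<in> T \<omega>" "t < c" by auto
        moreover obtain r where "r \<in> \<rat>" "t < r" "r < c" using Rats_dense_in_real[OF \<open>t < c\<close>] by auto
        ultimately show "\<exists>r\<in>\<rat>. r < c \<and> r \<in> T \<omega>" using up[of t \<omega> r] by auto
      qed auto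
      finally show ?thesis using r by auto
    qed
  qed
  moreover have "(\<Union>r\<in>{r\<in>\<rat>. r < c}. {\<omega>\<in>space M. r \<in> T \<omega>}) \<union>
      (if Inf {} < c then space M - (\<Union>r\<in>\<rat>. {\<omega>\<in>space M. r \<in> T \<omega>}) else {}) \<in> sets M" for c
  proof -
    have "countable {r\<in>\<rat>. r < c}" by (rule countable_subset[OF _ countable_rat]) auto
    hence "(\<Union>r\<in>{r\<in>\<rat>. r < c}. {\<omega>\<in>space M. r \<in> T \<omega>}) \<in> sets M"
      using Tset by (intro sets.countable_UN'') auto
    moreover have "(\<Union>r\<in>\<rat>. {\<omega>\<in>space M. r \<in> T \<omega>}) \<in> sets M"
      using Tset countable_rat by (intro sets.countable_UN'') auto
    ultimately show ?thesis by auto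
  qed
  ultimately have "(\<lambda>\<omega>. Inf (T \<omega>)) \<in> borel_measurable M"
    unfolding borel_measurable_iff_less by simp
  thus ?thesis unfolding arrival_point_masses[OF i] T_def .
qed

lemma expectation_close:
  fixes U U' :: "'w \<Rightarrow> real"
  assumes M: "prob_space M" and m: "U \<in> borel_measurable M" "U' \<in> borel_measurable M"
    and Gd: "Gd \<in> sets M"
    and b: "\<And>\<omega>. \<bar>U \<omega>\<bar> \<le> C" "\<And>\<omega>. \<bar>U' \<omega>\<bar> \<le> C"
    and close: "AE \<omega> in M. \<omega> \<in> Gd \<longrightarrow> \<bar>U \<omega> - U' \<omega>\<bar> \<le> \<eta>" and \<eta>: "\<eta> \<ge> 0"
  shows "\<bar>(\<integral>\<omega>. U \<omega> \<partial>M) - (\<integral>\<omega>. U' \<omega> \<partial>M)\<bar> \<le> \<eta> + 2 * C * (1 - measure M Gd)"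
proof -
  interpret prob_space M by fact
  have iU: "integrable M U" "integrable M U'"
    using m b by (auto intro!: integrable_const_bound[where B = C])
  have iG: "integrable M (indicator Gd :: 'w \<Rightarrow> real)"
    by (rule integrable_const_bound[where B = 1]) (use Gd in \<open>auto simp: indicator_def\<close>)
  have C: "C \<ge> 0" using b(1)[of undefined] by linarith
  have "\<bar>(\<integral>\<omega>. U \<omega> \<partial>M) - (\<integral>\<omega>. U' \<omega> \<partial>M)\<bar> = \<bar>\<integral>\<omega>. U \<omega> - U' \<omega> \<partial>M\<bar>"
    using iU by simp
  also have "\<dots> \<le> (\<integral>\<omega>. \<bar>U \<omega> - U' \<omega>\<bar> \<partial>M)" by (rule integral_abs_bound)
  also have "\<dots> \<le> (\<integral>\<omega>. \<eta> + 2 * C * (1 - indicator Gd \<omega>) \<partial>M)"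
  proof (rule integral_mono_AE)
    show "AE \<omega> in M. \<bar>U \<omega> - U' \<omega>\<bar> \<le> \<eta> + 2 * C * (1 - indicator Gd \<omega>)"
      using close
    proof eventually_elim
      case (elim \<omega>)
      show ?case
        using elim b(1)[of \<omega>] b(2)[of \<omega>] \<eta> by (cases "\<omega> \<in> Gd") auto
    qed
  qed (use iU iG in auto)
  also have "\<dots> = \<eta> + 2 * C * (1 - measure M Gd)"
    using iG Gd by (simp add: prob_space)
  finally show ?thesis .
qed

section \<open>Vectors of cell counts\<close>

lemma map_upt_eq_iff:
  assumes "length l = r"
  shows "map f [0..<r] = l \<longleftrightarrow> (\<forall>c<r. f c = l ! c)"
  by (subst list_eq_iff_nth_eq) (simp add: assms)

text \<open>Lists keep all count vectors in one countable type, although the number of cells depends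
  on the accuracy required and cannot be an index type.\<close>

lemma measurable_map_counts:
  fixes F :: "nat \<Rightarrow> 'w \<Rightarrow> nat"
  assumes "\<And>c. F c \<in> measurable M (count_space UNIV)"
  shows "(\<lambda>\<omega>. map (\<lambda>c. F c \<omega>) [0..<r]) \<in> measurable M (count_space UNIV)"
proof -
  have "(\<lambda>\<omega>. map (\<lambda>c. F c \<omega>) [0..<r]) -` {l} \<inter> space M \<in> sets M" for l
  proof (cases "length l = r")
    case True
    have "(\<lambda>\<omega>. map (\<lambda>c. F c \<omega>) [0..<r]) -` {l} \<inter> space M = {\<omega>\<in>space M. \<forall>c\<in>{..<r}. F c \<omega> = l ! c}"
      unfolding vimage_def Int_def mem_Collect_eq singleton_iff map_upt_eq_iff[OF True] by auto
    also have "\<dots> \<in> sets M" using assms by measurable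
    finally show ?thesis .
  next
    case False
    hence "(\<lambda>\<omega>. map (\<lambda>c. F c \<omega>) [0..<r]) -` {l} \<inter> space M = {}" by auto
    thus ?thesis by simp
  qed
  thus ?thesis by (subst measurable_count_space_eq_countable) auto
qed

lemma sample_count_vector:
  fixes Z :: "nat \<Rightarrow> 'w \<Rightarrow> 'b::topological_space" and lab :: "'b \<Rightarrow> nat"
  assumes M: "prob_space M"
    and Z: "prob_space.indep_vars M (\<lambda>_. borel) Z {1..}"
    and N: "distr M (count_space UNIV) N = measure_pmf (poisson_law \<nu>)" "\<nu> \<ge> 0"
    and NZ: "indep_pair M (count_space UNIV) N (PiM {1..} (\<lambda>_. borel)) (\<lambda>\<omega>. \<lambda>i\<in>{1..}. Z i \<omega>)"
    and lab: "lab \<in> measurable borel (count_space UNIV)" "\<And>z. lab z \<le> r"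
    and p: "\<And>i c. i \<ge> 1 \<Longrightarrow> measure M {\<omega>\<in>space M. lab (Z i \<omega>) = c} = p c"
  defines "V \<equiv> \<lambda>\<omega>. map (\<lambda>c. card {i\<in>{1..N \<omega>}. lab (Z i \<omega>) = c}) [0..<r]"
  shows "V \<in> measurable M (count_space UNIV)"
    and "measure M {\<omega>\<in>space M. V \<omega> = l} =
      (if length l = r then \<Prod>c<r. pmf (poisson_law (\<nu> * p c)) (l ! c) else 0)"
proof -
  interpret prob_space M by fact
  have [measurable]: "N \<in> measurable M (count_space UNIV)" using NZ by (simp add: indep_pair_def)
  have Zm: "Z i \<in> borel_measurable M" if "i \<ge> 1" for i
    using Z that by (auto simp: indep_vars_def)
  have lZm[measurable]: "(\<lambda>\<omega>. lab (Z i \<omega>)) \<in> measurable M (count_space UNIV)" if "i \<ge> 1" for i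
    using Zm[OF that] lab(1) by measurable
  have "{\<omega>\<in>space M. i \<in> {i\<in>{1..N \<omega>}. lab (Z i \<omega>) = c}} \<in> sets M" for i c
  proof (cases "i \<ge> 1")
    case True
    have "{\<omega>\<in>space M. i \<in> {i\<in>{1..N \<omega>}. lab (Z i \<omega>) = c}} =
        {\<omega>\<in>space M. i \<le> N \<omega>} \<inter> {\<omega>\<in>space M. lab (Z i \<omega>) = c}" using True by auto
    thus ?thesis using lZm[OF True] by simp
  qed simp
  hence "(\<lambda>\<omega>. card {i\<in>{1..N \<omega>}. lab (Z i \<omega>) = c}) \<in> measurable M (count_space UNIV)" for c
    by (rule measurable_card)
  thus "V \<in> measurable M (count_space UNIV)" unfolding V_def by (rule measurable_map_counts)
  show "measure M {\<omega>\<in>space M. V \<omega> = l} =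
      (if length l = r then \<Prod>c<r. pmf (poisson_law (\<nu> * p c)) (l ! c) else 0)"
  proof (cases "length l = r")
    case True
    have "{\<omega>\<in>space M. V \<omega> = l} =
        {\<omega>\<in>space M. \<forall>c<r. card {i\<in>{1..N \<omega>}. lab (Z i \<omega>) = c} = l ! c}"
      unfolding V_def map_upt_eq_iff[OF True] ..
    thus ?thesis using poissonized_label_counts[OF M Z N NZ lab p, of "\<lambda>c. l ! c"] True by simp
  next
    case False
    hence e: "{\<omega>\<in>space M. V \<omega> = l} = {}" by (auto simp: V_def)
    show ?thesis unfolding e using False by simp
  qed
qed

lemma emeasure_point_masses:
  assumes "B \<in> sets borel"
  shows "emeasure (point_masses I x) B =
    (if finite {i\<in>I. x i \<in> B} then of_nat (card {i\<in>I. x i \<in> B}) else \<infinity>)"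
proof -
  have "x -` B \<inter> I = {i\<in>I. x i \<in> B}" by auto
  thus ?thesis unfolding point_masses_def using assms
    by (simp add: emeasure_distr emeasure_count_space)
qed

text \<open>Both processes go into one list, with the right-hand cells shifted by \<open>m\<close>
  to match the labels of the sample. Since \<open>card\<close> is 0 on infinite sets, the entries
  agree with the measures of the cells only almost surely, on the event that all these counts are
  finite.\<close>

lemma poisson_count_vector:
  fixes X Y :: "nat \<Rightarrow> 'w \<Rightarrow> 'b::topological_space" and C :: "nat \<Rightarrow> 'b set"
  assumes M: "prob_space M"
    and Xm: "\<And>i. i \<ge> 1 \<Longrightarrow> X i \<in> borel_measurable M" and Ym: "\<And>i. i \<ge> 1 \<Longrightarrow> Y i \<in> borel_measurable M"
    and PX: "poisson_process M (\<lambda>\<omega>. point_masses {1..} (\<lambda>i. X i \<omega>)) \<mu>X"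
    and PY: "poisson_process M (\<lambda>\<omega>. point_masses {1..} (\<lambda>i. Y i \<omega>)) \<mu>Y"
    and XY: "indep_point_processes M (\<lambda>\<omega>. point_masses {1..} (\<lambda>i. X i \<omega>))
        (\<lambda>\<omega>. point_masses {1..} (\<lambda>i. Y i \<omega>))"
    and sets: "sets \<mu>X = sets borel" "sets \<mu>Y = sets borel"
    and C: "\<And>c. C c \<in> sets borel" "disjoint_family_on C {..<m}"
    and fin: "\<And>c. c < m \<Longrightarrow> emeasure \<mu>X (C c) \<noteq> \<infinity>" "\<And>c. c < m \<Longrightarrow> emeasure \<mu>Y (C c) \<noteq> \<infinity>"
  defines "V \<equiv> \<lambda>\<omega>. map (\<lambda>c. if c < m then card {i\<in>{1..}. X i \<omega> \<in> C c}
      else card {i\<in>{1..}. Y i \<omega> \<in> C (c - m)}) [0..<m + m]"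
  shows "V \<in> measurable M (count_space UNIV)"
    and "AE \<omega> in M. \<forall>c<m. finite {i\<in>{1..}. X i \<omega> \<in> C c} \<and> finite {i\<in>{1..}. Y i \<omega> \<in> C c}"
    and "measure M {\<omega>\<in>space M. V \<omega> = l} =
      (if length l = m + m then \<Prod>c<m + m. pmf (poisson_law
        (if c < m then measure \<mu>X (C c) else measure \<mu>Y (C (c - m)))) (l ! c) else 0)"
proof -
  interpret prob_space M by fact
  let ?eX = "\<lambda>\<omega> c. emeasure (point_masses {1..} (\<lambda>i. X i \<omega>)) (C c)"
  let ?eY = "\<lambda>\<omega> c. emeasure (point_masses {1..} (\<lambda>i. Y i \<omega>)) (C c)"
  have cm: "(\<lambda>\<omega>. card {i\<in>{1..}. U i \<omega> \<in> C c}) \<in> measurable M (count_space UNIV)"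
    if "\<And>i. i \<ge> 1 \<Longrightarrow> U i \<in> borel_measurable M" for U :: "nat \<Rightarrow> 'w \<Rightarrow> 'b" and c
  proof (rule measurable_card)
    fix i :: nat
    show "{\<omega>\<in>space M. i \<in> {i\<in>{1..}. U i \<omega> \<in> C c}} \<in> sets M"
    proof (cases "i \<ge> 1")
      case True
      have "{\<omega>\<in>space M. i \<in> {i\<in>{1..}. U i \<omega> \<in> C c}} = U i -` C c \<inter> space M" using True by auto
      thus ?thesis using measurable_sets[OF that[OF True] C(1)] by simp
    qed simp
  qed
  show V: "V \<in> measurable M (count_space UNIV)"
    unfolding V_def
  proof (rule measurable_map_counts)
    fix c
    show "(\<lambda>\<omega>. if c < m then card {i\<in>{1..}. X i \<omega> \<in> C c} else card {i\<in>{1..}. Y i \<omega> \<in> C (c - m)})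
        \<in> measurable M (count_space UNIV)"
    proof (cases "c < m")
      case True
      show ?thesis unfolding if_P[OF True] using Xm by (rule cm)
    next
      case False
      show ?thesis unfolding if_not_P[OF False] using Ym by (rule cm)
    qed
  qed
  have finX: "AE \<omega> in M. \<forall>c\<in>{..<m}. ?eX \<omega> c \<noteq> \<infinity>"
    using poisson_process_count_prob(2)[OF M PX] C(1) sets fin(1) by (intro AE_finite_allI) auto
  have finY: "AE \<omega> in M. \<forall>c\<in>{..<m}. ?eY \<omega> c \<noteq> \<infinity>"
    using poisson_process_count_prob(2)[OF M PY] C(1) sets fin(2) by (intro AE_finite_allI) auto
  show fin': "AE \<omega> in M. \<forall>c<m. finite {i\<in>{1..}. X i \<omega> \<in> C c} \<and> finite {i\<in>{1..}. Y i \<omega> \<in> C c}"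
    using finX finY
    by eventually_elim (use C(1) in \<open>auto simp: emeasure_point_masses split: if_splits\<close>)
  show "measure M {\<omega>\<in>space M. V \<omega> = l} =
      (if length l = m + m then \<Prod>c<m + m. pmf (poisson_law
        (if c < m then measure \<mu>X (C c) else measure \<mu>Y (C (c - m)))) (l ! c) else 0)"
  proof (cases "length l = m + m")
    case True
    have iff: "V \<omega> = l \<longleftrightarrow> (\<forall>c<m. ?eX \<omega> c = of_nat (l ! c)) \<and> (\<forall>c<m. ?eY \<omega> c = of_nat (l ! (m + c)))"
      if f: "\<forall>c<m. finite {i\<in>{1..}. X i \<omega> \<in> C c} \<and> finite {i\<in>{1..}. Y i \<omega> \<in> C c}" for \<omega>
    proof -
      have "V \<omega> = l \<longleftrightarrow> (\<forall>c<m + m. V \<omega> ! c = l ! c)"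
        using True by (subst list_eq_iff_nth_eq) (simp add: V_def)
      also have "\<dots> \<longleftrightarrow> (\<forall>c<m. V \<omega> ! c = l ! c) \<and> (\<forall>c<m. V \<omega> ! (m + c) = l ! (m + c))"
      proof safe
        fix c assume *: "\<forall>c<m. V \<omega> ! c = l ! c" "\<forall>c<m. V \<omega> ! (m + c) = l ! (m + c)" "c < m + m"
        show "V \<omega> ! c = l ! c"
        proof (cases "c < m")
          case False
          thus ?thesis using *(2)[rule_format, of "c - m"] *(3) by simp
        qed (use * in simp)
      qed auto
      also have "\<dots> \<longleftrightarrow> (\<forall>c<m. ?eX \<omega> c = of_nat (l ! c)) \<and> (\<forall>c<m. ?eY \<omega> c = of_nat (l ! (m + c)))"
        using f C(1) by (simp add: V_def emeasure_point_masses)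
      finally show ?thesis .
    qed
    have eXm: "(\<lambda>\<omega>. ?eX \<omega> c) \<in> borel_measurable M" "(\<lambda>\<omega>. ?eY \<omega> c) \<in> borel_measurable M" for c
      using PX PY C(1) sets by (auto simp: poisson_process_def)
    have "measure M {\<omega>\<in>space M. V \<omega> = l} =
      measure M {\<omega>\<in>space M. (\<forall>c<m. ?eX \<omega> c = of_nat (l ! c)) \<and> (\<forall>c<m. ?eY \<omega> c = of_nat (l ! (m + c)))}"
    proof (rule finite_measure_eq_AE)
      show "AE \<omega> in M. (\<omega> \<in> {\<omega>\<in>space M. V \<omega> = l}) = (\<omega> \<in> {\<omega>\<in>space M.
          (\<forall>c<m. ?eX \<omega> c = of_nat (l ! c)) \<and> (\<forall>c<m. ?eY \<omega> c = of_nat (l ! (m + c)))})"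
        using fin' by eventually_elim (simp add: iff)
      show "{\<omega>\<in>space M. V \<omega> = l} \<in> sets M" using V by simp
      have "{\<omega>\<in>space M. (\<forall>c\<in>{..<m}. ?eX \<omega> c = of_nat (l ! c)) \<and> (\<forall>c\<in>{..<m}. ?eY \<omega> c = of_nat (l ! (m + c)))} \<in> sets M"
        using eXm by measurable
      thus "{\<omega>\<in>space M. (\<forall>c<m. ?eX \<omega> c = of_nat (l ! c)) \<and> (\<forall>c<m. ?eY \<omega> c = of_nat (l ! (m + c)))} \<in> sets M"
        by (simp only: Ball_def lessThan_iff)
    qed
    also have "\<dots> = measure M {\<omega>\<in>space M. \<forall>c<m. ?eX \<omega> c = of_nat (l ! c)} *
        measure M {\<omega>\<in>space M. \<forall>c<m. ?eY \<omega> c = of_nat (l ! (m + c))}"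
      using C(1) by (rule indep_point_processes_counts[OF M XY])
    also have "measure M {\<omega>\<in>space M. \<forall>c<m. ?eX \<omega> c = of_nat (l ! c)} =
        (\<Prod>c<m. pmf (poisson_law (measure \<mu>X (C c))) (l ! c))"
      using C sets fin by (intro poisson_process_counts_prob[OF M PX]) auto
    also have "measure M {\<omega>\<in>space M. \<forall>c<m. ?eY \<omega> c = of_nat (l ! (m + c))} =
        (\<Prod>c<m. pmf (poisson_law (measure \<mu>Y (C c))) (l ! (m + c)))"
      using C sets fin by (intro poisson_process_counts_prob[OF M PY]) auto
    finally have "measure M {\<omega>\<in>space M. V \<omega> = l} = (\<Prod>c<m. pmf (poisson_law (measure \<mu>X (C c))) (l ! c)) *
      (\<Prod>c<m. pmf (poisson_law (measure \<mu>Y (C c))) (l ! (m + c)))" .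
    moreover have "(\<Prod>c<m + j. F c) = (\<Prod>c<m. F c) * (\<Prod>c<j. F (m + c))" for F :: "nat \<Rightarrow> real" and j
      by (induction j) (auto simp: mult_ac)
    ultimately show ?thesis using True by simp
  next
    case False
    hence e: "{\<omega>\<in>space M. V \<omega> = l} = {}" by (auto simp: V_def)
    show ?thesis unfolding e using False by simp
  qed
qed

text \<open>\<open>Inf_close\<close> in every component. Having \<open>CARD('k)\<close> values at
  level \<open>K - 2\<close> covers all smaller indices and leaves room for a shift by
  \<open>e\<close>; the common box is where the test function will be uniformly continuous.\<close>

lemma Inf_vectors_close:
  fixes w h :: "real ^ 'k::{finite,linorder}" and e K :: real
  assumes S: "\<And>p. p \<in> S \<Longrightarrow> val p \<ge> 0" "\<And>p. p \<in> S' \<Longrightarrow> g p \<ge> 0"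
    and trans: "\<And>i t. attained i S val t \<Longrightarrow> t \<le> K \<Longrightarrow> attained i S' g (t + e)"
      "\<And>i t. attained i S' g t \<Longrightarrow> attained i S val (t + e)"
    and att: "attained CARD('k) S' g (K - 2)" and e: "0 \<le> e" "e \<le> 1"
    and w: "\<And>i. w $ i = Inf {t. attained (card {..i}) S val t}"
    and h: "\<And>i. h $ i = Inf {t. attained (card {..i}) S' g t}"
  shows "w \<in> cbox 0 (\<chi> i. K)" "h \<in> cbox 0 (\<chi> i. K)" "norm (w - h) \<le> CARD('k) * e"
proof -
  have *: "\<bar>w $ i - h $ i\<bar> \<le> e \<and> 0 \<le> h $ i \<and> h $ i \<le> K - e \<and> 0 \<le> w $ i \<and> w $ i \<le> K" for i
  proof -
    let ?SA = "{t. attained (card {..i}) S val t}" and ?SB = "{t. attained (card {..i}) S' g t}"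
    have i: "card {..i} \<ge> 1" "card {..i} \<le> CARD('k)" by (auto simp: Suc_le_eq card_gt_0_iff intro: card_mono)
    have a: "\<And>t. t \<in> ?SA \<Longrightarrow> 0 \<le> t" "\<And>t. t \<in> ?SB \<Longrightarrow> 0 \<le> t"
      using attained_nonneg[OF _ i(1)] S by blast+
    have b: "K - e \<in> ?SB" using attained_mono[OF att i(2)] e by simp
    have c: "\<And>t. t \<in> ?SA \<Longrightarrow> t \<le> K \<Longrightarrow> t + e \<in> ?SB" "\<And>t. t \<in> ?SB \<Longrightarrow> t \<le> K \<Longrightarrow> t + e \<in> ?SA"
      using trans by auto
    show ?thesis unfolding w h using Inf_close[OF a b c e(1)] by blast
  qed
  show "w \<in> cbox 0 (\<chi> i. K)" using * by (auto simp: mem_box_cart)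
  have "h $ i \<le> K" for i using *[of i] e by linarith
  thus "h \<in> cbox 0 (\<chi> i. K)" using * by (auto simp: mem_box_cart)
  have "norm (w - h) \<le> (\<Sum>i\<in>UNIV. \<bar>(w - h) $ i\<bar>)" by (rule norm_le_l1_cart)
  also have "\<dots> \<le> (\<Sum>i\<in>(UNIV :: 'k set). e)" using * by (intro sum_mono) simp
  finally show "norm (w - h) \<le> CARD('k) * e" by simp
qed

lemma borel_measurable_vec_lambda:
  fixes F :: "'k::finite \<Rightarrow> 'w \<Rightarrow> real"
  assumes "\<And>k. F k \<in> borel_measurable M"
  shows "(\<lambda>\<omega>. \<chi> k. F k \<omega>) \<in> borel_measurable M"
proof -
  have "(\<lambda>\<omega>. (\<chi> k. F k \<omega>) \<bullet> b) \<in> borel_measurable M" if "b \<in> Basis" for b :: "real ^ 'k"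
    using that assms by (auto simp: Basis_vec_def inner_axis)
  thus ?thesis by (subst borel_measurable_euclidean_space) auto
qed

context elongated_ellipsoid
begin

text \<open>The origin of the normalizing exponent: for this \<open>s\<close> the power in
  \<open>tip_mass\<close> equals 1 / n, so n times the probability is \<alpha> times the measure of
  \<open>C\<close> up to factors arbitrarily close to 1.\<close>

lemma tip_rate:
  fixes f :: "(real, 'd) vec \<Rightarrow> real" and P :: "nat \<Rightarrow> real" and s :: "nat \<Rightarrow> real"
  assumes \<sigma>: "\<sigma> = 1 \<or> \<sigma> = -1" and \<alpha>: "\<alpha> > 0" and R: "R \<ge> 0" and \<beta>: "real CARD('d) + 1 + 2 * \<beta> > 0"
    and f: "((\<lambda>z. f z / (\<alpha> * (1 - z \<bullet> (matrix_inv (Sigma_mat a) *v z)) powr \<beta>)) \<longlongrightarrow> 1)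
        (at (axis first (\<sigma> * A)) within interior (ellipsoid a))"
    and C: "C \<in> sets borel" "C \<subseteq> P_H a \<inter> {x. x $ first \<le> R}"
    and s: "\<And>n. n \<ge> 1 \<Longrightarrow> s n = real n powr (- (2 / (real CARD('d) + 1 + 2 * \<beta>)))"
    and P: "\<And>n. n \<ge> 1 \<Longrightarrow> ennreal (P n) = (\<integral>\<^sup>+z. ennreal (f z * indicator (ellipsoid a) z) *
        indicator {z. \<sigma> * z $ first > 0 \<and> chart (s n) z \<in> C} z \<partial>lborel)" "\<And>n. P n \<ge> 0"
  shows "emeasure (Lambda a \<beta>) C \<noteq> \<infinity>" "(\<lambda>n. real n * P n) \<longlonglongrightarrow> \<alpha> * measure (Lambda a \<beta>) C"
proof -
  define \<gamma> where "\<gamma> = real CARD('d) + 1 + 2 * \<beta>"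
  have \<gamma>: "\<gamma> > 0" using \<beta> by (simp add: \<gamma>_def)
  have sn: "s n > 0" "s n powr ((real CARD('d) + 1) / 2 + \<beta>) = 1 / real n" if "n \<ge> 1" for n
  proof -
    show "s n > 0" using that s[OF that] by simp
    have "(real CARD('d) + 1) / 2 + \<beta> = \<gamma> / 2" by (simp add: \<gamma>_def field_simps)
    hence "s n powr ((real CARD('d) + 1) / 2 + \<beta>) = real n powr (- (2 / \<gamma>) * (\<gamma> / 2))"
      using s[OF that] by (simp only: powr_powr \<gamma>_def[symmetric])
    also have "- (2 / \<gamma>) * (\<gamma> / 2) = -1" using \<gamma> by simp
    finally show "s n powr ((real CARD('d) + 1) / 2 + \<beta>) = 1 / real n"
      using that by (simp add: powr_minus_divide)
  qed
  have pow0: "(\<lambda>n. real n powr (- (2 / \<gamma>))) \<longlonglongrightarrow> 0"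
    using \<gamma> by (intro tendsto_neg_powr filterlim_real_sequentially) auto
  have s0: "eventually (\<lambda>n. s n < s0) sequentially" if "s0 > 0" for s0
  proof -
    have "eventually (\<lambda>n. real n powr (- (2 / \<gamma>)) < s0) sequentially"
      using that pow0 by (intro order_tendstoD)
    thus ?thesis using eventually_ge_at_top[of 1]
      by eventually_elim (simp add: s \<gamma>_def)
  qed
  have bounds: "eventually (\<lambda>n. ennreal ((1 - e) * \<alpha>) * emeasure (Lambda a \<beta>) C \<le> ennreal (real n * P n) \<and>
      ennreal (real n * P n) \<le> ennreal ((1 + e) * \<alpha>) * emeasure (Lambda a \<beta>) C) sequentially"
    if e: "0 < e" "e < 1" for e
  proof -
    from tip_mass[OF \<sigma> \<alpha> R e f] obtain s0 where s0p: "s0 > 0" and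
      tm: "\<And>s C. 0 < s \<Longrightarrow> s < s0 \<Longrightarrow> C \<in> sets borel \<Longrightarrow> C \<subseteq> P_H a \<inter> {x. x $ first \<le> R} \<Longrightarrow>
      ennreal ((1 - e) * \<alpha> * s powr ((real CARD('d) + 1) / 2 + \<beta>)) * emeasure (Lambda a \<beta>) C \<le>
      (\<integral>\<^sup>+z. ennreal (f z * indicator (ellipsoid a) z) *
        indicator {z. \<sigma> * z $ first > 0 \<and> chart s z \<in> C} z \<partial>lborel) \<and>
      (\<integral>\<^sup>+z. ennreal (f z * indicator (ellipsoid a) z) *
        indicator {z. \<sigma> * z $ first > 0 \<and> chart s z \<in> C} z \<partial>lborel) \<le>
      ennreal ((1 + e) * \<alpha> * s powr ((real CARD('d) + 1) / 2 + \<beta>)) * emeasure (Lambda a \<beta>) C"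
      by meson
    show ?thesis using s0[OF s0p] eventually_ge_at_top[of 1]
    proof eventually_elim
      case (elim n)
      have n: "n \<ge> 1" "real n > 0" using elim by auto
      have scale: "ennreal (real n) * (ennreal (t * \<alpha> * (1 / real n)) * x) = ennreal (t * \<alpha>) * x"
        if "t \<ge> 0" for t x
      proof -
        have "ennreal (real n) * ennreal (t * \<alpha> * (1 / real n)) = ennreal (t * \<alpha>)"
          using n that \<alpha> by (subst ennreal_mult[symmetric]) auto
        thus ?thesis by (simp only: mult.assoc[symmetric])
      qed
      have nP: "ennreal (real n * P n) = ennreal (real n) * ennreal (P n)"
        using n P(2) by (simp add: ennreal_mult)
      from tm[OF sn(1)[OF n(1)] elim(1) C] have
        "ennreal ((1 - e) * \<alpha> * (1 / real n)) * emeasure (Lambda a \<beta>) C \<le> ennreal (P n)"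
        "ennreal (P n) \<le> ennreal ((1 + e) * \<alpha> * (1 / real n)) * emeasure (Lambda a \<beta>) C"
        unfolding sn(2)[OF n(1)] P(1)[OF n(1)] by auto
      from mult_left_mono[OF this(1), of "ennreal (real n)"] mult_left_mono[OF this(2), of "ennreal (real n)"]
      show ?case unfolding nP using scale[of "1 - e"] scale[of "1 + e"] e by simp
    qed
  qed
  \<comment> \<open>finiteness comes for free: \<open>real n * P n\<close> is finite and dominates half of the limit\<close>
  show fin: "emeasure (Lambda a \<beta>) C \<noteq> \<infinity>"
  proof
    assume inf: "emeasure (Lambda a \<beta>) C = \<infinity>"
    from bounds[of "1/2"] obtain n where "ennreal ((1 - 1/2) * \<alpha>) * emeasure (Lambda a \<beta>) C \<le> ennreal (real n * P n)"
      by (auto simp: eventually_sequentially)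
    thus False unfolding inf using \<alpha> by (simp add: ennreal_mult_top top_unique)
  qed
  define \<theta> where "\<theta> = \<alpha> * measure (Lambda a \<beta>) C"
  have \<theta>0: "\<theta> \<ge> 0" using \<alpha> by (simp add: \<theta>_def)
  have Leq: "emeasure (Lambda a \<beta>) C = ennreal (measure (Lambda a \<beta>) C)"
    using fin by (intro emeasure_eq_ennreal_measure) auto
  have "(\<lambda>n. real n * P n) \<longlonglongrightarrow> \<theta>"
  proof (rule LIMSEQ_I)
    fix r :: real assume r: "r > 0"
    \<comment> \<open>\<open>\<theta> + 1\<close> guards against a vanishing limit, and the cap 1/2
      keeps \<open>e\<close> in the range of \<open>bounds\<close>.\<close>
    define e where "e = min (1/2) (r / (\<theta> + 1) / 2)"
    have e: "0 < e" "e < 1" using r \<theta>0 by (auto simp: e_def)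
    have "e * \<theta> \<le> e * (\<theta> + 1)" using e by simp
    also have "\<dots> \<le> r / (\<theta> + 1) / 2 * (\<theta> + 1)" using \<theta>0 by (intro mult_right_mono) (auto simp: e_def)
    also have "\<dots> = r / 2" using \<theta>0 by (simp add: field_simps)
    also have "\<dots> < r" using r by simp
    finally have er: "e * \<theta> < r" .
    have "eventually (\<lambda>n. norm (real n * P n - \<theta>) < r) sequentially"
      using bounds[OF e]
    proof eventually_elim
      case (elim n)
      have m: "ennreal (t * \<alpha>) * emeasure (Lambda a \<beta>) C = ennreal (t * \<theta>)" if "t \<ge> 0" for t
        unfolding Leq \<theta>_def using that \<alpha> by (simp add: ennreal_mult[symmetric] mult.assoc)
      have nn: "0 \<le> real n * P n" "0 \<le> (1 + e) * \<theta>" using P(2)[of n] e \<theta>0 by auto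
      have "ennreal ((1 - e) * \<theta>) \<le> ennreal (real n * P n)" "ennreal (real n * P n) \<le> ennreal ((1 + e) * \<theta>)"
        using elim m[of "1 - e"] m[of "1 + e"] e by auto
      hence "(1 - e) * \<theta> \<le> real n * P n" "real n * P n \<le> (1 + e) * \<theta>"
        using P(2)[of n] e \<theta>0 by (simp_all only: ennreal_le_iff nn)
      thus ?case using er by (simp add: algebra_simps abs_less_iff)
    qed
    thus "\<exists>no. \<forall>n\<ge>no. norm (real n * P n - \<theta>) < r" by (simp add: eventually_sequentially)
  qed
  thus "(\<lambda>n. real n * P n) \<longlonglongrightarrow> \<alpha> * measure (Lambda a \<beta>) C" by (simp add: \<theta>_def)
qed

end

subsection \<open>The limit theorem\<close>

lemma tendsto_pmf_poisson_law:
  assumes "x \<longlonglongrightarrow> l" "\<And>n. x n \<ge> 0"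
  shows "(\<lambda>n. pmf (poisson_law (x n)) k) \<longlonglongrightarrow> pmf (poisson_law l) k"
proof -
  have "l \<ge> 0" using assms by (intro LIMSEQ_le_const) auto
  moreover have "(\<lambda>n. x n ^ k / fact k * exp (- x n)) \<longlonglongrightarrow> l ^ k / fact k * exp (- l)"
    by (intro tendsto_intros assms(1)) auto
  ultimately show ?thesis using assms(2) by (simp add: pmf_poisson_law)
qed

text \<open>A Poisson count of mean 0 is almost surely 0. Applied to the complement of
  \<open>P_H a\<close>, this puts all points of both processes into the paraboloid, where
  \<open>G\<close> is nonnegative.\<close>

lemma poisson_process_null:
  fixes X :: "nat \<Rightarrow> 'w \<Rightarrow> 'b::topological_space"
  assumes M: "prob_space M" and P: "poisson_process M (\<lambda>\<omega>. point_masses {1..} (\<lambda>i. X i \<omega>)) \<mu>"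
    and B: "B \<in> sets borel" "B \<in> sets \<mu>" "emeasure \<mu> B = 0"
  shows "AE \<omega> in M. \<forall>i\<ge>1. X i \<omega> \<notin> B"
proof -
  interpret prob_space M by fact
  let ?e = "\<lambda>\<omega>. emeasure (point_masses {1..} (\<lambda>i. X i \<omega>)) B"
  have "prob {\<omega>\<in>space M. ?e \<omega> = of_nat 0} = pmf (poisson_law 0) 0"
    using poisson_process_count_prob(1)[OF M P B(2), of 0] B(3) by (simp add: measure_def)
  hence "prob {\<omega>\<in>space M. ?e \<omega> = 0} = 1" by (simp add: poisson_law_def)
  moreover have "{\<omega>\<in>space M. ?e \<omega> = 0} \<in> events"
  proof -
    have "?e \<in> borel_measurable M" using P B(2) by (auto simp: poisson_process_def)
    thus ?thesis by measurable
  qed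
  ultimately have "AE \<omega> in M. \<omega> \<in> {\<omega>\<in>space M. ?e \<omega> = 0}" by (simp add: prob_eq_1)
  thus ?thesis
  proof eventually_elim
    case (elim \<omega>)
    hence "{i\<in>{1..}. X i \<omega> \<in> B} = {}"
      by (auto simp: emeasure_point_masses[OF B(1)] split: if_splits)
    thus ?case by auto
  qed
qed

lemma (in elongated_ellipsoid) Lambda_complement: "emeasure (Lambda a \<beta>) (- P_H a) = 0"
proof -
  have L: "Lambda a \<beta> = density lborel (\<lambda>z. ennreal (depth z powr \<beta> * indicator (P_H a) z))"
    unfolding Lambda_def depth_def rad_def ..
  have "emeasure (Lambda a \<beta>) (- P_H a) =
      (\<integral>\<^sup>+z. ennreal (depth z powr \<beta> * indicator (P_H a) z) * indicator (- P_H a) z \<partial>lborel)"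
    unfolding L by (rule emeasure_density) (use P_H_borel in \<open>auto intro: borel_comp\<close>)
  also have "\<dots> = (\<integral>\<^sup>+z. 0 \<partial>(lborel :: (real, 'd) vec measure))"
    by (intro nn_integral_cong) (auto simp: indicator_def)
  finally show ?thesis by simp
qed

theorem theorem4:
  fixes a :: "real ^ 'd::{finite,linorder}"
    and f :: "real ^ 'd::{finite,linorder} \<Rightarrow> real"
    and \<alpha>l \<alpha>r \<beta> :: real
    and M :: "'w measure"
    and Z :: "nat \<Rightarrow> 'w \<Rightarrow> real ^ 'd::{finite,linorder}"
    and N :: "nat \<Rightarrow> 'w \<Rightarrow> nat"
    and D :: "nat \<Rightarrow> nat \<Rightarrow> 'w \<Rightarrow> real"
    and M' :: "'v measure"
    and X Y :: "nat \<Rightarrow> 'v \<Rightarrow> real ^ 'd::{finite,linorder}"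
  assumes dim: "CARD('d) \<ge> 2"
    and a_pos: "\<And>k. a $ k > 0"
    and a_mono: "\<And>i j. i \<le> j \<Longrightarrow> a $ j \<le> a $ i"
    and a_first: "\<And>k. k \<noteq> first \<Longrightarrow> a $ k < a $ first"
    and f_meas: "set_borel_measurable lborel (ellipsoid a) f"
    and f_nonneg: "\<And>z. z \<in> ellipsoid a \<Longrightarrow> f z \<ge> 0"
    and f_int: "(LINT z:ellipsoid a|lborel. f z) = 1"
    and params: "\<alpha>l > 0" "\<alpha>r > 0" "\<beta> > -1"
    and f_left: "((\<lambda>z. f z / (\<alpha>l * (1 - z \<bullet> (matrix_inv (Sigma_mat a) *v z)) powr \<beta>)) \<longlongrightarrow> 1)
        (at (axis first (- (a $ first))) within interior (ellipsoid a))"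
    and f_right: "((\<lambda>z. f z / (\<alpha>r * (1 - z \<bullet> (matrix_inv (Sigma_mat a) *v z)) powr \<beta>)) \<longlongrightarrow> 1)
        (at (axis first (a $ first)) within interior (ellipsoid a))"
    and M: "prob_space M"
    and Z_density: "\<And>i. i \<ge> 1 \<Longrightarrow>
        distributed M lborel (Z i) (\<lambda>z. ennreal (f z * indicator (ellipsoid a) z))"
    and Z_indep: "prob_space.indep_vars M (\<lambda>_. borel) Z {1..}"
    and N_poisson: "\<And>n. distr M (count_space UNIV) (N n) = measure_pmf (poisson_law (real n))"
    and N_indep: "\<And>n. indep_pair M (count_space UNIV) (N n)
        (PiM {1..} (\<lambda>_. borel)) (\<lambda>\<omega>. \<lambda>i\<in>{1..}. Z i \<omega>)"
    and D_meas: "\<And>n i. i \<in> {1..CARD('k::{finite,linorder})} \<Longrightarrow> D n i \<in> borel_measurable M"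
    and D_largest: "\<And>n i \<omega>. \<lbrakk>\<omega> \<in> space M; i \<in> {1..CARD('k)};
        CARD('k) \<le> size (pair_distances (\<lambda>j. Z j \<omega>) (N n \<omega>))\<rbrakk>
        \<Longrightarrow> D n i \<omega> = ith_largest i (pair_distances (\<lambda>j. Z j \<omega>) (N n \<omega>))"
    and M': "prob_space M'"
    and X_meas: "\<And>i. i \<ge> 1 \<Longrightarrow> X i \<in> borel_measurable M'"
    and Y_meas: "\<And>j. j \<ge> 1 \<Longrightarrow> Y j \<in> borel_measurable M'"
    and X_poisson: "poisson_process M' (\<lambda>\<omega>. point_masses {1..} (\<lambda>i. X i \<omega>))
        (scale_measure (ennreal \<alpha>l) (Lambda a \<beta>))"
    and Y_poisson: "poisson_process M' (\<lambda>\<omega>. point_masses {1..} (\<lambda>j. Y j \<omega>))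
        (scale_measure (ennreal \<alpha>r) (Lambda a \<beta>))"
    and XY_indep: "indep_point_processes M'
        (\<lambda>\<omega>. point_masses {1..} (\<lambda>i. X i \<omega>)) (\<lambda>\<omega>. point_masses {1..} (\<lambda>j. Y j \<omega>))"
  shows "converges_in_distribution M
      (\<lambda>n \<omega>. (real n powr (2 / (real CARD('d) + 1 + 2 * \<beta>))) *\<^sub>R
         (\<chi> i :: 'k. 2 * a $ first - D n (card {..i}) \<omega>))
      M'
      (\<lambda>\<omega>. \<chi> i :: 'k. arrival (card {..i})
         (point_masses ({1..} \<times> {1..}) (\<lambda>(i, j). G a (X i \<omega>) (Y j \<omega>))))"
proof -
  interpret E: elongated_ellipsoid a using a_pos a_first by unfold_locales
  interpret PM: prob_space M by (rule M)
  interpret PM': prob_space M' by (rule M')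
  define \<gamma> where "\<gamma> = real CARD('d) + 1 + 2 * \<beta>"
  have "real CARD('d) \<ge> 2" using dim by simp
  hence \<gamma>: "\<gamma> > 0" using params(3) unfolding \<gamma>_def by linarith
  \<comment> \<open>The value at n = 0 keeps \<open>s n\<close> positive throughout, since 0 powr x
    is 0.\<close>
  define s :: "nat \<Rightarrow> real" where "s n = (if n = 0 then 1 else real n powr (- (2 / \<gamma>)))" for n
  have s_pos: "s n > 0" for n by (simp add: s_def)
  have s_inv: "real n powr (2 / \<gamma>) = 1 / s n" if "n \<ge> 1" for n
    using that by (simp add: s_def powr_minus_divide)
  have s_lim: "eventually (\<lambda>n. s n < s0) sequentially" if "s0 > 0" for s0
  proof -
    have "(\<lambda>n. real n powr (- (2 / \<gamma>))) \<longlonglongrightarrow> 0"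
      using \<gamma> by (intro tendsto_neg_powr filterlim_real_sequentially) auto
    hence "eventually (\<lambda>n. real n powr (- (2 / \<gamma>)) < s0) sequentially"
      using that by (intro order_tendstoD)
    thus ?thesis using eventually_ge_at_top[of 1] by eventually_elim (simp add: s_def)
  qed
  have idx: "card {..i :: 'k} \<in> {1..CARD('k)}" for i
    by (auto simp: Suc_le_eq card_gt_0_iff intro: card_mono)
  define W where "W n \<omega> = (real n powr (2 / \<gamma>)) *\<^sub>R (\<chi> i :: 'k. 2 * a $ first - D n (card {..i}) \<omega>)" for n \<omega>
  define I where "I = ({1..} \<times> {1..} :: (nat \<times> nat) set)"
  define v where "v = (\<lambda>\<omega> (i, j). G a (X i \<omega>) (Y j \<omega>))"
  define arr where "arr i \<omega> = arrival i (point_masses I (v \<omega>))" for i \<omega>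
  define W' where "W' \<omega> = (\<chi> i :: 'k. arr (card {..i}) \<omega>)" for \<omega>
  have Wm: "W n \<in> borel_measurable M" for n
    unfolding W_def
    by (intro borel_measurable_scaleR borel_measurable_const borel_measurable_vec_lambda
      borel_measurable_diff D_meas idx)
  have arrm: "arr i \<in> borel_measurable M'" if "i \<ge> 1" for i
    unfolding arr_def
  proof (rule measurable_arrival[where v = "\<lambda>p \<omega>. v \<omega> p", OF that])
    show "countable I" by simp
    fix p assume p: "p \<in> I"
    have "(\<lambda>\<omega>. G a (X (fst p) \<omega>) (Y (snd p) \<omega>)) \<in> borel_measurable M'"
    proof (rule borel_measurable_continuous_Pair[where H = "G a"])
      show "X (fst p) \<in> borel_measurable M'" "Y (snd p) \<in> borel_measurable M'"
        using p X_meas Y_meas by (auto simp: I_def)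
      show "continuous_on UNIV (\<lambda>x. G a (fst x) (snd x))"
        unfolding G_def norm_tilde_diff_sq by (intro continuous_intros)
    qed
    thus "(\<lambda>\<omega>. v \<omega> p) \<in> borel_measurable M'" by (simp add: v_def case_prod_unfold)
  qed
  have W'm: "W' \<in> borel_measurable M'"
    unfolding W'_def using arrm idx by (intro borel_measurable_vec_lambda) auto
  have sLam: "sets (scale_measure r (Lambda a \<beta>)) = sets borel" for r
    by (simp add: Lambda_def)
  have null: "emeasure (scale_measure r (Lambda a \<beta>)) (- P_H a) = 0" for r
    by (simp add: E.Lambda_complement)
  have "AE \<omega> in M'. \<forall>i\<ge>1. X i \<omega> \<notin> - P_H a"
    by (rule poisson_process_null[OF M' X_poisson]) (use E.P_H_borel null sLam in \<open>auto intro: borel_comp\<close>)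
  moreover have "AE \<omega> in M'. \<forall>i\<ge>1. Y i \<omega> \<notin> - P_H a"
    by (rule poisson_process_null[OF M' Y_poisson]) (use E.P_H_borel null sLam in \<open>auto intro: borel_comp\<close>)
  ultimately have XYP: "AE \<omega> in M'. \<forall>i\<ge>1. X i \<omega> \<in> P_H a \<and> Y i \<omega> \<in> P_H a"
    by eventually_elim auto
  have ZE: "AE \<omega> in M. \<forall>i\<ge>1. (\<Sum>k\<in>UNIV. (Z i \<omega> $ k / a $ k)\<^sup>2) < 1"
  proof -
    have "AE \<omega> in M. i \<ge> 1 \<longrightarrow> (\<Sum>k\<in>UNIV. (Z i \<omega> $ k / a $ k)\<^sup>2) < 1" for i
    proof (cases "i \<ge> 1")
      case True
      have "AE z in lborel. 0 < ennreal (f z * indicator (ellipsoid a) z) \<longrightarrow> (\<Sum>k\<in>UNIV. (z $ k / a $ k)\<^sup>2) < 1"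
        using E.boundary_negligible
        by eventually_elim (auto simp: indicator_def ellipsoid_def split: if_splits)
      moreover have d: "distr M lborel (Z i) = density lborel (\<lambda>z. ennreal (f z * indicator (ellipsoid a) z))"
        "(\<lambda>z. ennreal (f z * indicator (ellipsoid a) z)) \<in> borel_measurable lborel"
        "Z i \<in> measurable M lborel"
        using Z_density[OF True] by (simp_all add: distributed_def)
      ultimately have "AE z in distr M lborel (Z i). (\<Sum>k\<in>UNIV. (z $ k / a $ k)\<^sup>2) < 1"
        unfolding d(1) AE_density[OF d(2)] by simp
      hence "AE \<omega> in M. (\<Sum>k\<in>UNIV. (Z i \<omega> $ k / a $ k)\<^sup>2) < 1"
        by (rule AE_distrD[OF d(3)])
      thus ?thesis by eventually_elim simp
    qed simp
    thus ?thesis by (simp add: AE_all_countable)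
  qed
  have conv: "(\<lambda>n. \<integral>\<omega>. g (W n \<omega>) \<partial>M) \<longlonglongrightarrow> (\<integral>\<omega>. g (W' \<omega>) \<partial>M')"
    if g: "continuous_on UNIV g" "bounded (range g)" for g :: "(real, 'k) vec \<Rightarrow> real"
  proof (rule LIMSEQ_I)
    fix r :: real assume r: "r > 0"
    obtain C where C: "\<bar>g x\<bar> \<le> C" for x using g(2) by (auto simp: bounded_iff)
    have C0: "C \<ge> 0" using C[of undefined] by linarith
    \<comment> \<open>The final estimate adds up to 3 \<eta> + 4 C \<eta>, which is less than 4 (C +
      1) \<eta> = r.\<close>
    define \<eta> where "\<eta> = r / (4 * (C + 1))"
    have \<eta>: "\<eta> > 0" using r C0 by (simp add: \<eta>_def)
    have k1: "CARD('k) \<ge> 1" by (simp add: Suc_le_eq)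

    \<comment> \<open>Choice of the level and of the cells\<close>
    define Am where "Am j = {\<omega>\<in>space M'. arr CARD('k) \<omega> > real j}" for j :: nat
    have Am: "Am j \<in> sets M'" for j using arrm[OF k1] unfolding Am_def by measurable
    have "(\<lambda>j. measure M' (Am j)) \<longlonglongrightarrow> measure M' (\<Inter>j. Am j)"
      using Am by (intro PM'.finite_Lim_measure_decseq) (auto simp: Am_def decseq_def)
    moreover have "(\<Inter>j. Am j) = {}"
    proof -
      have "\<exists>j. \<omega> \<notin> Am j" for \<omega>
        using reals_Archimedean2[of "arr CARD('k) \<omega>"] by (auto simp: Am_def not_less intro: less_imp_le)
      thus ?thesis by auto
    qed
    ultimately have "(\<lambda>j. measure M' (Am j)) \<longlonglongrightarrow> 0" by simp
    hence "eventually (\<lambda>j. measure M' (Am j) < \<eta>) sequentially" using \<eta> by (intro order_tendstoD)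
    then obtain j0 where j0: "measure M' (Am j0) < \<eta>" by (auto simp: eventually_sequentially)
    \<comment> \<open>Four units of slack: an arrival by \<open>j0\<close> = \<open>K - 4\<close>
      has an attained level below \<open>K - 3\<close>, passing to cell centres adds at most 1, and
      the level \<open>K - 2\<close> reached there leaves room for one more shift below
      \<open>K\<close>.\<close>
    define K where "K = real j0 + 4"
    have K: "K \<ge> 4" by (simp add: K_def)
    \<comment> \<open>The common constant of \<open>far_pair\<close> and \<open>G_ge\<close>, so
      that sample and limit can be restricted to the same bounded set \<open>B\<close>.\<close>
    define R where "R = K / (1 - E.q)"
    have R: "R \<ge> 0" using K E.q_less_1 by (simp add: R_def)
    define B where "B = P_H a \<inter> {x. x $ first \<le> R}"
    have B_borel: "B \<in> sets borel"
    proof -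
      have "{x :: (real, 'd) vec. x $ first \<le> R} \<in> sets borel"
        by (intro borel_closed closed_Collect_le continuous_intros)
      thus ?thesis using E.P_H_borel by (simp add: B_def)
    qed
    obtain R' where R': "R' > 0" "\<And>x. x \<in> B \<Longrightarrow> norm x \<le> R'"
      using E.P_H_bounded[OF R] by (auto simp: B_def)
    have "uniformly_continuous_on (cbox 0 (\<chi> i. K)) g"
      using g(1) by (intro compact_uniformly_continuous compact_cbox) (auto intro: continuous_on_subset)
    then obtain \<delta> where \<delta>: "\<delta> > 0" and uc: "\<And>x x'. x \<in> cbox 0 (\<chi> i. K) \<Longrightarrow> x' \<in> cbox 0 (\<chi> i. K) \<Longrightarrow>
        dist x' x < \<delta> \<Longrightarrow> dist (g x') (g x) < \<eta>"
      using \<eta> unfolding uniformly_continuous_on_def by metis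
    \<comment> \<open>The \<open>CARD('k)\<close> components each contribute at most
      \<open>e\<close> to the norm of the difference, which must stay below \<delta>.\<close>
    define e where "e = min 1 (\<delta> / (2 * real CARD('k)))"
    have e: "0 < e" "e \<le> 1" using \<delta> by (auto simp: e_def)
    have "e * real CARD('k) \<le> \<delta> / (2 * real CARD('k)) * real CARD('k)"
      by (intro mult_right_mono) (auto simp: e_def)
    also have "\<dots> = \<delta> / 2" by simp
    finally have ek: "real CARD('k) * e < \<delta>" using \<delta> by (simp add: mult.commute)
    \<comment> \<open>Half of \<open>e\<close> is for the expansion of the distance, the other half
      for the variation of \<open>G\<close> within cells.\<close>
    have e2: "e / 2 > 0" using e by simp
    obtain \<delta>G where \<delta>G: "\<delta>G > 0" and Gu: "\<And>x y x' y'. x \<in> cball 0 R' \<Longrightarrow> y \<in> cball 0 R' \<Longrightarrow> x' \<in> cball 0 R' \<Longrightarrow>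
        y' \<in> cball 0 R' \<Longrightarrow> dist x x' < \<delta>G \<Longrightarrow> dist y y' < \<delta>G \<Longrightarrow> \<bar>G a x y - G a x' y'\<bar> < e / 2"
      using E.G_uniform[OF e2, of R'] by blast
    have "bounded B" using R'(2) by (auto simp: bounded_iff)
    then obtain m and cell :: "(real, 'd) vec \<Rightarrow> nat" and \<mu> :: "nat \<Rightarrow> (real, 'd) vec" where
      cell_meas: "cell \<in> measurable borel (count_space UNIV)" and
      cell: "\<And>x. x \<in> B \<Longrightarrow> cell x < m \<and> \<mu> (cell x) \<in> B \<and> dist x (\<mu> (cell x)) < \<delta>G"
      using finite_cells[OF _ \<delta>G] by metis
    have cell_neq: "cell x \<noteq> m + c" if "x \<in> B" for x c using cell[OF that] by simp
    obtain s0 where s0: "s0 > 0" and expand: "\<And>s z w. 0 < s \<Longrightarrow> s < s0 \<Longrightarrow> z $ first < 0 \<Longrightarrow> 0 < w $ first \<Longrightarrow>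
        norm (E.chart s z) \<le> R' \<Longrightarrow> norm (E.chart s w) \<le> R' \<Longrightarrow>
        \<bar>(2 * a $ first - norm (z - w)) / s - G a (E.chart s z) (E.chart s w)\<bar> < e / 2"
      using E.distance_expansion[OF R'(1) e2] by blast
    define gm where "gm c c' = G a (\<mu> c) (\<mu> c')" for c c'
    have BP: "x \<in> P_H a" if "x \<in> B" for x using that by (simp add: B_def)
    have G0: "G a x y \<ge> 0" if "x \<in> P_H a" "y \<in> P_H a" for x y
    proof -
      have "0 \<le> (1 - E.q) * (x $ first + y $ first)"
        using E.q_less_1 E.P_H_first_pos[OF that(1)] E.P_H_first_pos[OF that(2)]
        by (intro mult_nonneg_nonneg) auto
      thus ?thesis using E.G_ge[OF that] by linarith
    qed
    have gm0: "gm (cell x) (cell y) \<ge> 0" if "x \<in> B" "y \<in> B" for x y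
      unfolding gm_def using that cell BP by (intro G0) auto
    have gm_close: "\<bar>G a x y - gm (cell x) (cell y)\<bar> \<le> e / 2" if "x \<in> B" "y \<in> B" for x y
      unfolding gm_def using that cell R'(2)
      by (intro less_imp_le Gu) (auto simp: mem_cball_0)
    \<comment> \<open>These functions see only a count list and the fixed cell centres.
      \<open>Hv\<close> is the vector of order statistics shared by both sides, and
      \<open>good\<close> says that its last entry is attained with room to spare below
      \<open>K\<close>.\<close>
    define cnt where "cnt l t = (\<Sum>c<m. \<Sum>c'<m. if gm c c' \<le> t then l ! c * l ! (m + c') else 0)"
      for l :: "nat list" and t
    define Hv where "Hv l = (\<chi> i :: 'k. Inf {t. card {..i} \<le> cnt l t})" for l
    define good where "good l \<longleftrightarrow> CARD('k) \<le> cnt l (K - 2)" for l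

    have att_iff: "attained i (L \<times> Q) (\<lambda>(p, p'). gm (cell (x p)) (cell (y p'))) t \<longleftrightarrow> i \<le> cnt l t"
      if fin: "finite L" "finite Q" and xy: "\<And>p. p \<in> L \<Longrightarrow> x p \<in> B" "\<And>p. p \<in> Q \<Longrightarrow> y p \<in> B"
        and l: "\<And>c. c < m \<Longrightarrow> l ! c = card {p\<in>L. cell (x p) = c}"
          "\<And>c. c < m \<Longrightarrow> l ! (m + c) = card {p\<in>Q. cell (y p) = c}"
      for L Q :: "nat set" and x y :: "nat \<Rightarrow> (real, 'd) vec" and l i t
    proof -
      have "attained i (L \<times> Q) (\<lambda>(p, p'). gm (cell (x p)) (cell (y p'))) t \<longleftrightarrow>
        i \<le> (\<Sum>c<m. \<Sum>c'<m. if gm c c' \<le> t then card {p\<in>L. cell (x p) = c} * card {p\<in>Q. cell (y p) = c'} else 0)"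
        by (rule attained_cells_iff) (use fin xy cell in auto)
      also have "(\<Sum>c<m. \<Sum>c'<m. if gm c c' \<le> t then card {p\<in>L. cell (x p) = c} * card {p\<in>Q. cell (y p) = c'} else 0) = cnt l t"
        unfolding cnt_def by (intro sum.cong refl) (simp add: l)
      finally show ?thesis .
    qed
    \<comment> \<open>One argument for both sides: \<open>S\<close> holds the actual pairs,
      \<open>S'\<close> those with values taken at the cell centres.\<close>
    have compare: "\<bar>g w - g (Hv l)\<bar> \<le> \<eta>"
      if S: "\<And>p. p \<in> S \<Longrightarrow> val p \<ge> 0" and S': "\<And>p. p \<in> S' \<Longrightarrow> gg p \<ge> 0"
        and tr: "\<And>i t. attained i S val t \<Longrightarrow> t \<le> K \<Longrightarrow> attained i S' gg (t + e)"
          "\<And>i t. attained i S' gg t \<Longrightarrow> attained i S val (t + e)"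
        and ai: "\<And>i t. attained i S' gg t \<longleftrightarrow> i \<le> cnt l t" and gd: "good l"
        and w: "\<And>i. w $ i = Inf {t. attained (card {..i}) S val t}"
      for S S' :: "(nat \<times> nat) set" and val gg l and w :: "(real, 'k) vec"
    proof -
      have h: "Hv l $ i = Inf {t. attained (card {..i}) S' gg t}" for i by (simp add: Hv_def ai)
      have at: "attained CARD('k) S' gg (K - 2)" using gd by (simp add: ai good_def)
      note c = Inf_vectors_close[OF S S' tr at less_imp_le[OF e(1)] e(2) w h]
      have "dist w (Hv l) < \<delta>" using c(3) ek by (simp add: dist_norm)
      hence "dist (g w) (g (Hv l)) < \<eta>" using c(1,2) by (intro uc)
      thus ?thesis by (simp add: dist_real_def)
    qed

    define Cc where "Cc c = {x \<in> B. cell x = c}" for c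
    have Cc_borel: "Cc c \<in> sets borel" for c
    proof -
      have "Cc c = B \<inter> cell -` {c}" by (auto simp: Cc_def)
      thus ?thesis using B_borel measurable_sets[OF cell_meas, of "{c}"] by simp
    qed
    have Cc_sub: "Cc c \<subseteq> P_H a \<inter> {x. x $ first \<le> R}" for c by (auto simp: Cc_def B_def)
    \<comment> \<open>Cells at the left tip have labels below \<open>m\<close>, cells at the right
      tip are shifted by \<open>m\<close>, and \<open>m + m\<close> collects every other point, the
      equator included.\<close>
    define lab where "lab n z = (if z $ first < 0 \<and> E.chart (s n) z \<in> B then cell (E.chart (s n) z)
      else if 0 < z $ first \<and> E.chart (s n) z \<in> B then m + cell (E.chart (s n) z) else m + m)" for n z
    define V where "V n \<omega> = map (\<lambda>c. card {i\<in>{1..N n \<omega>}. lab n (Z i \<omega>) = c}) [0..<m + m]" for n \<omega>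
    define V' where "V' \<omega> = map (\<lambda>c. if c < m then card {i\<in>{1..}. X i \<omega> \<in> Cc c}
      else card {i\<in>{1..}. Y i \<omega> \<in> Cc (c - m)}) [0..<m + m]" for \<omega>
    define h where "h l = g (Hv l)" for l

    \<comment> \<open>The sample side\<close>
    have sample_close: "\<bar>g (W n \<omega>) - h (V n \<omega>)\<bar> \<le> \<eta>"
      if n: "n \<ge> 1" "s n < s0" "4 * s n * K < 3 * a $ first * (1 - E.q)"
        and \<omega>: "\<omega> \<in> space M" "\<forall>i\<ge>1. (\<Sum>k\<in>UNIV. (Z i \<omega> $ k / a $ k)\<^sup>2) < 1" and gd: "good (V n \<omega>)" for n \<omega>
    proof -
      define z where "z i = Z i \<omega>" for i
      define x where "x i = E.chart (s n) (z i)" for i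
      define L where "L = {i\<in>{1..N n \<omega>}. z i $ first < 0 \<and> x i \<in> B}"
      define Q where "Q = {i\<in>{1..N n \<omega>}. 0 < z i $ first \<and> x i \<in> B}"
      define val where "val i j = (2 * a $ first - norm (z i - z j)) / s n" for i j
      define P where "P = {(i, j). 1 \<le> i \<and> i < j \<and> j \<le> N n \<omega>}"
      have finP: "finite P" unfolding P_def
        by (rule finite_subset[of _ "{1..N n \<omega>} \<times> {1..N n \<omega>}"]) auto
      have zE: "z i \<in> ellipsoid a" if "i \<ge> 1" for i
        using \<omega>(2) that by (auto simp: z_def ellipsoid_def less_imp_le)
      have xP: "x i \<in> P_H a" if "i \<ge> 1" for i
      proof -
        have "(\<Sum>k\<in>UNIV. (z i $ k / a $ k)\<^sup>2) < 1" using \<omega>(2) that by (simp add: z_def)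
        hence "0 < s n * E.depth (x i)"
          using E.depth_chart[OF s_pos[of n], of "z i"] unfolding x_def by linarith
        thus ?thesis using s_pos[of n] by (simp add: E.P_H_iff zero_less_mult_iff)
      qed
      have LQ: "L \<subseteq> {1..N n \<omega>}" "Q \<subseteq> {1..N n \<omega>}" "L \<inter> Q = {}" by (auto simp: L_def Q_def)
      have sym: "val i j = val j i" for i j by (simp add: val_def norm_minus_commute)
      have far: "i \<in> L \<and> j \<in> Q \<or> j \<in> L \<and> i \<in> Q"
        if ij: "i \<in> {1..N n \<omega>}" "j \<in> {1..N n \<omega>}" "val i j \<le> K" for i j
      proof -
        have "2 * a $ first - s n * K \<le> norm (z i - z j)"
          using ij(3) s_pos[of n] by (simp add: val_def divide_simps mult.commute)
        note fp = E.far_pair[OF zE zE s_pos[of n] _ n(3) this]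
        have "z i $ first * z j $ first < 0" "x i $ first \<le> R" "x j $ first \<le> R"
          unfolding x_def R_def using fp ij K by auto
        thus ?thesis using xP ij by (auto simp: L_def Q_def B_def mult_less_0_iff)
      qed
      have close: "\<bar>val i j - gm (cell (x i)) (cell (x j))\<bar> \<le> e" if "i \<in> L" "j \<in> Q" for i j
      proof -
        have "\<bar>val i j - G a (x i) (x j)\<bar> < e / 2"
          unfolding val_def x_def using that R'(2) s_pos[of n] n(2)
          by (intro expand) (auto simp: L_def Q_def x_def)
        moreover have "\<bar>G a (x i) (x j) - gm (cell (x i)) (cell (x j))\<bar> \<le> e / 2"
          using that by (intro gm_close) (auto simp: L_def Q_def)
        ultimately show ?thesis by linarith
      qed
      let ?gg = "\<lambda>(p, p'). gm (cell (x p)) (cell (x p'))"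
      have tr1: "attained i P (\<lambda>(i, j). val i j) t \<Longrightarrow> t \<le> K \<Longrightarrow> attained i (L \<times> Q) ?gg (t + e)" for i t
        unfolding P_def using LQ sym far close by (rule attained_pairs_close(1))
      have tr2: "attained i (L \<times> Q) ?gg t \<Longrightarrow> attained i P (\<lambda>(i, j). val i j) (t + e)" for i t
        unfolding P_def using LQ sym far close by (rule attained_pairs_close(2))
      have ai: "attained i (L \<times> Q) ?gg t \<longleftrightarrow> i \<le> cnt (V n \<omega>) t" for i t
      proof (rule att_iff)
        show "finite L" "finite Q" using LQ finite_subset by blast+
        show "\<And>p. p \<in> L \<Longrightarrow> x p \<in> B" "\<And>p. p \<in> Q \<Longrightarrow> x p \<in> B" by (auto simp: L_def Q_def)
        fix c assume c: "c < m"
        have "{i\<in>{1..N n \<omega>}. lab n (Z i \<omega>) = c} = {p\<in>L. cell (x p) = c}"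
          using c by (auto simp: L_def lab_def x_def z_def)
        thus "V n \<omega> ! c = card {p\<in>L. cell (x p) = c}" using c by (simp add: V_def)
        have "{i\<in>{1..N n \<omega>}. lab n (Z i \<omega>) = m + c} = {p\<in>Q. cell (x p) = c}"
          using c by (auto simp: Q_def lab_def x_def z_def dest: cell_neq split: if_splits)
        thus "V n \<omega> ! (m + c) = card {p\<in>Q. cell (x p) = c}" using c by (simp add: V_def)
      qed
      \<comment> \<open>\<open>good\<close> guarantees at least \<open>CARD('k)\<close> pairs, the
        condition under which \<open>D\<close> is specified; samples with too few pairs thus fall
        outside the good event.\<close>
      have "attained CARD('k) P (\<lambda>(i, j). val i j) (K - 2 + e)"
        using gd by (intro tr2) (simp add: ai good_def)
      hence "CARD('k) \<le> card {p\<in>P. (case p of (i, j) \<Rightarrow> val i j) \<le> K - 2 + e}"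
        using finP by (simp add: attained_iff_card)
      also have "\<dots> \<le> card P" using finP by (intro card_mono) auto
      finally have kP: "CARD('k) \<le> card P" .
      have pd: "pair_distances (\<lambda>j. Z j \<omega>) (N n \<omega>) = image_mset (\<lambda>(i, j). norm (z i - z j)) (mset_set P)"
        by (simp add: pair_distances_def P_def z_def)
      have w: "W n \<omega> $ i = Inf {t. attained (card {..i}) P (\<lambda>(i, j). val i j) t}" for i
      proof -
        have "D n (card {..i}) \<omega> = ith_largest (card {..i}) (image_mset (\<lambda>(i, j). norm (z i - z j)) (mset_set P))"
          unfolding pd[symmetric] using kP by (intro D_largest \<omega>(1) idx) (simp add: pd)
        hence "W n \<omega> $ i = (2 * a $ first -
            ith_largest (card {..i}) (image_mset (\<lambda>(i, j). norm (z i - z j)) (mset_set P))) / s n"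
          by (simp add: W_def s_inv[OF n(1)])
        also have "\<dots> = Inf {t. attained (card {..i}) P (\<lambda>p. (2 * a $ first - (case p of (i, j) \<Rightarrow> norm (z i - z j))) / s n) t}"
          using finP idx[of i] kP s_pos[of n] by (intro ith_largest_eq_Inf) auto
        also have "(\<lambda>p. (2 * a $ first - (case p of (i, j) \<Rightarrow> norm (z i - z j))) / s n) = (\<lambda>(i, j). val i j)"
          by (auto simp: val_def fun_eq_iff)
        finally show ?thesis .
      qed
      show ?thesis unfolding h_def
      proof (rule compare[OF _ _ tr1 tr2 ai gd w])
        fix p assume "p \<in> P"
        thus "0 \<le> (case p of (i, j) \<Rightarrow> val i j)"
          using E.ellipsoid_dist_le[OF zE zE] s_pos[of n] by (auto simp: P_def val_def)
      next
        fix p assume "p \<in> L \<times> Q"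
        thus "0 \<le> ?gg p" by (auto simp: L_def Q_def intro: gm0)
      qed
    qed

    \<comment> \<open>The limit side\<close>
    have limit_close: "(good (V' \<omega>) \<longrightarrow> \<bar>g (W' \<omega>) - h (V' \<omega>)\<bar> \<le> \<eta>) \<and> (arr CARD('k) \<omega> \<le> K - 4 \<longrightarrow> good (V' \<omega>))"
      if fin: "\<forall>c<m. finite {i\<in>{1..}. X i \<omega> \<in> Cc c} \<and> finite {i\<in>{1..}. Y i \<omega> \<in> Cc c}"
        and P: "\<forall>i\<ge>1. X i \<omega> \<in> P_H a \<and> Y i \<omega> \<in> P_H a" for \<omega>
    proof -
      define L where "L = {i\<in>{1..}. X i \<omega> \<in> B}"
      define Q where "Q = {i\<in>{1..}. Y i \<omega> \<in> B}"
      define S where "S = {p\<in>I. 0 \<le> v \<omega> p}"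
      let ?gg = "\<lambda>(p, p'). gm (cell (X p \<omega>)) (cell (Y p' \<omega>))"
      have cX: "{i\<in>{1..}. X i \<omega> \<in> Cc c} = {p\<in>L. cell (X p \<omega>) = c}" for c by (auto simp: L_def Cc_def)
      have cY: "{i\<in>{1..}. Y i \<omega> \<in> Cc c} = {p\<in>Q. cell (Y p \<omega>) = c}" for c by (auto simp: Q_def Cc_def)
      \<comment> \<open>The finitely many cells cover \<open>B\<close>, so finite cell counts leave
        only finitely many points of the process in \<open>B\<close>.\<close>
      have "L = (\<Union>c\<in>{..<m}. {i\<in>{1..}. X i \<omega> \<in> Cc c})" using cell by (auto simp: L_def Cc_def)
      hence finL: "finite L" using fin by simp
      have "Q = (\<Union>c\<in>{..<m}. {i\<in>{1..}. Y i \<omega> \<in> Cc c})" using cell by (auto simp: Q_def Cc_def)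
      hence finQ: "finite Q" using fin by simp
      have SI: "S = I" using P G0 by (auto simp: S_def I_def v_def)
      have sub: "L \<times> Q \<subseteq> S" unfolding SI by (auto simp: L_def Q_def I_def)
      have far: "p \<in> L \<times> Q" if p: "p \<in> S" "v \<omega> p \<le> K" for p
      proof -
        obtain i j where ij: "p = (i, j)" "i \<ge> 1" "j \<ge> 1" using p(1) unfolding SI I_def by auto
        have XY: "X i \<omega> \<in> P_H a" "Y j \<omega> \<in> P_H a" using P ij by auto
        have "(1 - E.q) * (X i \<omega> $ first + Y j \<omega> $ first) \<le> K"
          using E.G_ge[OF XY] p(2) by (simp add: ij v_def)
        hence "X i \<omega> $ first + Y j \<omega> $ first \<le> R"
          using E.q_less_1 by (simp add: R_def pos_le_divide_eq mult.commute)
        hence "X i \<omega> $ first \<le> R" "Y j \<omega> $ first \<le> R"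
          using E.P_H_first_pos[OF XY(1)] E.P_H_first_pos[OF XY(2)] by auto
        thus ?thesis using XY ij by (auto simp: L_def Q_def B_def)
      qed
      have close: "\<bar>v \<omega> p - ?gg p\<bar> \<le> e" if "p \<in> L \<times> Q" for p
        using that gm_close[of "X (fst p) \<omega>" "Y (snd p) \<omega>"] e
        by (auto simp: L_def Q_def v_def)
      have tr1: "attained i S (v \<omega>) t \<Longrightarrow> t \<le> K \<Longrightarrow> attained i (L \<times> Q) ?gg (t + e)" for i t
        using sub far close by (rule attained_restrict(1))
      have tr2: "attained i (L \<times> Q) ?gg t \<Longrightarrow> attained i S (v \<omega>) (t + e)" for i t
        using sub far close by (rule attained_restrict(2))
      have ai: "attained i (L \<times> Q) ?gg t \<longleftrightarrow> i \<le> cnt (V' \<omega>) t" for i t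
      proof (rule att_iff[OF finL finQ])
        show "\<And>p. p \<in> L \<Longrightarrow> X p \<omega> \<in> B" "\<And>p. p \<in> Q \<Longrightarrow> Y p \<omega> \<in> B" by (auto simp: L_def Q_def)
        fix c assume c: "c < m"
        show "V' \<omega> ! c = card {p\<in>L. cell (X p \<omega>) = c}"
          unfolding cX[symmetric] using c by (simp add: V'_def)
        show "V' \<omega> ! (m + c) = card {p\<in>Q. cell (Y p \<omega>) = c}"
          unfolding cY[symmetric] using c by (simp add: V'_def)
      qed
      have w: "W' \<omega> $ i = Inf {t. attained (card {..i}) S (v \<omega>) t}" for i
        using idx[of i] by (simp add: W'_def arr_def arrival_point_masses S_def)
      have close_if_good: "\<bar>g (W' \<omega>) - h (V' \<omega>)\<bar> \<le> \<eta>" if gd: "good (V' \<omega>)"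
        unfolding h_def
      proof (rule compare[OF _ _ tr1 tr2 ai gd w])
        show "\<And>p. p \<in> S \<Longrightarrow> 0 \<le> v \<omega> p" by (simp add: S_def)
        show "\<And>p. p \<in> L \<times> Q \<Longrightarrow> 0 \<le> ?gg p" by (auto simp: L_def Q_def intro: gm0)
      qed
      have good_if_early: "good (V' \<omega>)" if early: "arr CARD('k) \<omega> \<le> K - 4"
      proof -
        let ?T = "{t. attained CARD('k) S (v \<omega>) t}"
        \<comment> \<open>The index set is infinite, so the pairs (i, 1) always attain some level.
          This rules out that a small arrival time is merely the value of
          \<open>Inf {}\<close>.\<close>
        have "attained CARD('k) S (v \<omega>) (Max (v \<omega> ` ({1..CARD('k)} \<times> {1})))"
          unfolding attained_def
          by (rule exI[of _ "{1..CARD('k)} \<times> {1}"]) (auto simp: SI I_def card_cartesian_product intro!: Max_ge)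
        hence ne: "?T \<noteq> {}" by auto
        have "arr CARD('k) \<omega> = Inf ?T" using k1 by (simp add: arr_def arrival_point_masses S_def)
        hence "Inf ?T < K - 3" using early by simp
        then obtain t where t: "attained CARD('k) S (v \<omega>) t" "t < K - 3"
          using cInf_lessD[OF ne] by auto
        have "attained CARD('k) (L \<times> Q) ?gg (t + e)" using t by (intro tr1) auto
        hence "attained CARD('k) (L \<times> Q) ?gg (K - 2)"
          by (rule attained_mono) (use t e in auto)
        thus ?thesis by (simp add: ai good_def)
      qed
      show ?thesis using close_if_good good_if_early by blast
    qed

    \<comment> \<open>Laws of the count vectors\<close>
    have lab_meas: "lab n \<in> measurable borel (count_space UNIV)" for n
    proof -
      note [measurable] = E.measurable_chart[OF s_pos[of n]] cell_meas B_borel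
      show ?thesis unfolding lab_def[abs_def] by measurable
    qed
    have lab_le: "lab n z \<le> m + m" for n z
      using cell[of "E.chart (s n) z"] by (auto simp: lab_def less_imp_le)
    define pp where "pp n c = measure M {\<omega>\<in>space M. lab n (Z 1 \<omega>) = c}" for n c
    have lab_emeasure: "emeasure M {\<omega>\<in>space M. lab n (Z i \<omega>) = c} =
        (\<integral>\<^sup>+z. ennreal (f z * indicator (ellipsoid a) z) * indicator {z. lab n z = c} z \<partial>lborel)" if "i \<ge> 1" for n i c
    proof -
      have "{\<omega>\<in>space M. lab n (Z i \<omega>) = c} = Z i -` {z. lab n z = c} \<inter> space M" by auto
      moreover have "{z. lab n z = c} \<in> sets lborel"
      proof -
        have "{z. lab n z = c} = lab n -` {c}" by auto
        thus ?thesis using measurable_sets[OF lab_meas, of "{c}" n] by simp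
      qed
      ultimately show ?thesis using distributed_emeasure[OF Z_density[OF that]] by (simp only:)
    qed
    have pp_i: "measure M {\<omega>\<in>space M. lab n (Z i \<omega>) = c} = pp n c" if "i \<ge> 1" for n i c
      unfolding pp_def measure_def using lab_emeasure[OF that] lab_emeasure[of 1] by simp
    have pp_int: "ennreal (pp n c) =
        (\<integral>\<^sup>+z. ennreal (f z * indicator (ellipsoid a) z) * indicator {z. lab n z = c} z \<partial>lborel)" for n c
      unfolding pp_def PM.emeasure_eq_measure[symmetric] by (rule lab_emeasure) simp
    have labl: "{z. lab n z = c} = {z. -1 * z $ first > 0 \<and> E.chart (s n) z \<in> Cc c}" if "c < m" for n c
      using that by (auto simp: lab_def Cc_def)
    have labr: "{z. lab n z = m + c} = {z. 1 * z $ first > 0 \<and> E.chart (s n) z \<in> Cc c}" if "c < m" for n c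
      using that by (auto simp: lab_def Cc_def dest: cell_neq split: if_splits)
    have \<gamma>': "real CARD('d) + 1 + 2 * \<beta> > 0" using \<gamma> by (simp add: \<gamma>_def)
    have s_eq: "s n = real n powr (- (2 / (real CARD('d) + 1 + 2 * \<beta>)))" if "n \<ge> 1" for n
      using that by (simp add: s_def \<gamma>_def)
    have fl: "((\<lambda>z. f z / (\<alpha>l * (1 - z \<bullet> (matrix_inv (Sigma_mat a) *v z)) powr \<beta>)) \<longlongrightarrow> 1)
        (at (axis first (-1 * a $ first)) within interior (ellipsoid a))" using f_left by simp
    have fr: "((\<lambda>z. f z / (\<alpha>r * (1 - z \<bullet> (matrix_inv (Sigma_mat a) *v z)) powr \<beta>)) \<longlongrightarrow> 1)
        (at (axis first (1 * a $ first)) within interior (ellipsoid a))" using f_right by simp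
    have pp0: "pp n c \<ge> 0" for n c by (simp add: pp_def)
    have left: "emeasure (Lambda a \<beta>) (Cc c) \<noteq> \<infinity>"
      "(\<lambda>n. real n * pp n c) \<longlonglongrightarrow> \<alpha>l * measure (Lambda a \<beta>) (Cc c)" if c: "c < m" for c
    proof -
      have "ennreal (pp n c) = (\<integral>\<^sup>+z. ennreal (f z * indicator (ellipsoid a) z) *
        indicator {z. -1 * z $ first > 0 \<and> E.chart (s n) z \<in> Cc c} z \<partial>lborel)" for n
        unfolding labl[OF c, symmetric] by (rule pp_int)
      note tip_rate = E.tip_rate[OF disjI2[OF refl] params(1) R \<gamma>' fl Cc_borel Cc_sub s_eq this pp0]
      show "emeasure (Lambda a \<beta>) (Cc c) \<noteq> \<infinity>" by (rule tip_rate(1))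
      show "(\<lambda>n. real n * pp n c) \<longlonglongrightarrow> \<alpha>l * measure (Lambda a \<beta>) (Cc c)" by (rule tip_rate(2))
    qed
    have right: "(\<lambda>n. real n * pp n (m + c)) \<longlonglongrightarrow> \<alpha>r * measure (Lambda a \<beta>) (Cc c)" if c: "c < m" for c
    proof -
      have "ennreal (pp n (m + c)) = (\<integral>\<^sup>+z. ennreal (f z * indicator (ellipsoid a) z) *
        indicator {z. 1 * z $ first > 0 \<and> E.chart (s n) z \<in> Cc c} z \<partial>lborel)" for n
        unfolding labr[OF c, symmetric] by (rule pp_int)
      from E.tip_rate(2)[OF disjI1[OF refl] params(2) R \<gamma>' fr Cc_borel Cc_sub s_eq this pp0]
      show ?thesis .
    qed
    define \<mu>l where "\<mu>l = scale_measure (ennreal \<alpha>l) (Lambda a \<beta>)"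
    define \<mu>r where "\<mu>r = scale_measure (ennreal \<alpha>r) (Lambda a \<beta>)"
    have \<mu>_fin: "emeasure \<mu>l (Cc c) \<noteq> \<infinity>" "emeasure \<mu>r (Cc c) \<noteq> \<infinity>" if "c < m" for c
      using left(1)[OF that] by (auto simp: \<mu>l_def \<mu>r_def ennreal_mult_eq_top_iff)
    have disj: "disjoint_family_on Cc {..<m}" by (auto simp: disjoint_family_on_def Cc_def)
    note count_law = poisson_count_vector[OF M' X_meas Y_meas X_poisson[folded \<mu>l_def] Y_poisson[folded \<mu>r_def]
      XY_indep sLam[of "ennreal \<alpha>l", folded \<mu>l_def] sLam[of "ennreal \<alpha>r", folded \<mu>r_def]
      Cc_borel disj \<mu>_fin]
    have limit_law: "V' \<in> measurable M' (count_space UNIV)"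
      "AE \<omega> in M'. \<forall>c<m. finite {i\<in>{1..}. X i \<omega> \<in> Cc c} \<and> finite {i\<in>{1..}. Y i \<omega> \<in> Cc c}"
      "measure M' {\<omega>\<in>space M'. V' \<omega> = l} = (if length l = m + m then \<Prod>c<m + m. pmf (poisson_law
        (if c < m then measure \<mu>l (Cc c) else measure \<mu>r (Cc (c - m)))) (l ! c) else 0)" for l
      unfolding V'_def[abs_def] by (rule count_law; assumption)+
    have sample_law: "V n \<in> measurable M (count_space UNIV)"
      "measure M {\<omega>\<in>space M. V n \<omega> = l} =
        (if length l = m + m then \<Prod>c<m + m. pmf (poisson_law (real n * pp n c)) (l ! c) else 0)" for n l
      unfolding V_def[abs_def]
      by (rule sample_count_vector[OF M Z_indep N_poisson of_nat_0_le_iff N_indep lab_meas lab_le pp_i];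
        assumption)+
    have V_meas: "V n \<in> measurable M (count_space UNIV)" for n by (rule sample_law(1))
    have V'_meas: "V' \<in> measurable M' (count_space UNIV)" by (rule limit_law(1))
    \<comment> \<open>Both laws are products of Poisson probabilities, so convergence of each mean
      is enough.\<close>
    have lim: "(\<lambda>n. measure M {\<omega>\<in>space M. V n \<omega> = l}) \<longlonglongrightarrow> measure M' {\<omega>\<in>space M'. V' \<omega> = l}" for l
    proof (cases "length l = m + m")
      case True
      have "(\<lambda>n. \<Prod>c<m + m. pmf (poisson_law (real n * pp n c)) (l ! c)) \<longlonglongrightarrow>
        (\<Prod>c<m + m. pmf (poisson_law (if c < m then measure \<mu>l (Cc c) else measure \<mu>r (Cc (c - m)))) (l ! c))"
      proof (intro tendsto_prod tendsto_pmf_poisson_law)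
        fix c assume c: "c \<in> {..<m + m}"
        show "(\<lambda>n. real n * pp n c) \<longlonglongrightarrow> (if c < m then measure \<mu>l (Cc c) else measure \<mu>r (Cc (c - m)))"
        proof (cases "c < m")
          case True
          thus ?thesis using left(2)[OF True] params(1) by (simp add: \<mu>l_def)
        next
          case False
          thus ?thesis using right[of "c - m"] c params(2) by (simp add: \<mu>r_def)
        qed
      qed (simp add: pp0)
      thus ?thesis unfolding sample_law(2) limit_law(3) using True by simp
    next
      case False
      thus ?thesis unfolding sample_law(2) limit_law(3) by simp
    qed
    have hb: "\<bar>h l\<bar> \<le> C" for l by (simp add: h_def C)
    have lim_h: "(\<lambda>n. \<integral>\<omega>. h (V n \<omega>) \<partial>M) \<longlonglongrightarrow> (\<integral>\<omega>. h (V' \<omega>) \<partial>M')"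
      by (rule tendsto_expectation_countable[OF M M' V_meas V'_meas lim hb])

    \<comment> \<open>Probability of the good event and final estimate\<close>
    define Gn where "Gn n = {\<omega>\<in>space M. good (V n \<omega>)}" for n
    define G' where "G' = {\<omega>\<in>space M'. good (V' \<omega>)}"
    have Gn: "Gn n \<in> sets M" for n
    proof -
      have "Gn n = V n -` {l. good l} \<inter> space M" by (auto simp: Gn_def)
      thus ?thesis using measurable_sets[OF V_meas, of "{l. good l}" n] by simp
    qed
    have G': "G' \<in> sets M'"
    proof -
      have "G' = V' -` {l. good l} \<inter> space M'" by (auto simp: G'_def)
      thus ?thesis using measurable_sets[OF V'_meas, of "{l. good l}"] by simp
    qed
    \<comment> \<open>Being good is a property of the count list, so its indicator is another
      bounded function on a countable type.\<close>
    have lim_good: "(\<lambda>n. measure M (Gn n)) \<longlonglongrightarrow> measure M' G'"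
    proof -
      have "(\<lambda>n. \<integral>\<omega>. indicator {l. good l} (V n \<omega>) \<partial>M) \<longlonglongrightarrow> (\<integral>\<omega>. indicator {l. good l} (V' \<omega>) \<partial>M' :: real)"
        by (rule tendsto_expectation_countable[OF M M' V_meas V'_meas lim, where C = 1]) (simp add: indicator_def)
      moreover have "(\<integral>\<omega>. indicator {l. good l} (V n \<omega>) \<partial>M) = measure M (Gn n)" for n
      proof -
        have "(\<integral>\<omega>. indicator {l. good l} (V n \<omega>) \<partial>M) = (\<integral>\<omega>. indicator (Gn n) \<omega> \<partial>M :: real)"
          by (intro Bochner_Integration.integral_cong) (auto simp: Gn_def indicator_def)
        thus ?thesis using Gn by simp
      qed
      moreover have "(\<integral>\<omega>. indicator {l. good l} (V' \<omega>) \<partial>M') = measure M' G'"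
      proof -
        have "(\<integral>\<omega>. indicator {l. good l} (V' \<omega>) \<partial>M') = (\<integral>\<omega>. indicator G' \<omega> \<partial>M' :: real)"
          by (intro Bochner_Integration.integral_cong) (auto simp: G'_def indicator_def)
        thus ?thesis using G' by simp
      qed
      ultimately show ?thesis by simp
    qed
    have AE': "AE \<omega> in M'. (good (V' \<omega>) \<longrightarrow> \<bar>g (W' \<omega>) - h (V' \<omega>)\<bar> \<le> \<eta>) \<and>
        (arr CARD('k) \<omega> \<le> K - 4 \<longrightarrow> good (V' \<omega>))"
      using limit_law(2) XYP by eventually_elim (rule limit_close)
    \<comment> \<open>Outside \<open>Am j0\<close> the last arrival time is at most
      \<open>K - 4\<close>, which forces a good count vector.\<close>
    have PG': "measure M' G' > 1 - \<eta>"
    proof -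
      have "1 - measure M' (Am j0) = measure M' (space M' - Am j0)"
        using Am by (simp add: PM'.prob_compl)
      also have "\<dots> \<le> measure M' G'"
      proof (rule PM'.finite_measure_mono_AE[OF _ G'])
        show "AE \<omega> in M'. \<omega> \<in> space M' - Am j0 \<longrightarrow> \<omega> \<in> G'"
          using AE' by eventually_elim (auto simp: Am_def G'_def K_def)
      qed
      finally show ?thesis using j0 by linarith
    qed
    have gm: "g \<in> borel_measurable borel" using g(1) by (rule borel_measurable_continuous_onI)
    have est': "\<bar>(\<integral>\<omega>. g (W' \<omega>) \<partial>M') - (\<integral>\<omega>. h (V' \<omega>) \<partial>M')\<bar> \<le> \<eta> + 2 * C * (1 - measure M' G')"
    proof (rule expectation_close[OF M' _ _ G'])
      show "(\<lambda>\<omega>. g (W' \<omega>)) \<in> borel_measurable M'" using W'm gm by measurable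
      show "(\<lambda>\<omega>. h (V' \<omega>)) \<in> borel_measurable M'" using V'_meas by measurable
      show "AE \<omega> in M'. \<omega> \<in> G' \<longrightarrow> \<bar>g (W' \<omega>) - h (V' \<omega>)\<bar> \<le> \<eta>"
        using AE' by eventually_elim (auto simp: G'_def)
    qed (use C hb \<eta> in auto)
    have est: "\<bar>(\<integral>\<omega>. g (W n \<omega>) \<partial>M) - (\<integral>\<omega>. h (V n \<omega>) \<partial>M)\<bar> \<le> \<eta> + 2 * C * (1 - measure M (Gn n))"
      if n: "n \<ge> 1" "s n < s0" "4 * s n * K < 3 * a $ first * (1 - E.q)" for n
    proof (rule expectation_close[OF M _ _ Gn])
      show "(\<lambda>\<omega>. g (W n \<omega>)) \<in> borel_measurable M" using Wm gm by measurable
      show "(\<lambda>\<omega>. h (V n \<omega>)) \<in> borel_measurable M" using V_meas by measurable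
      show "AE \<omega> in M. \<omega> \<in> Gn n \<longrightarrow> \<bar>g (W n \<omega>) - h (V n \<omega>)\<bar> \<le> \<eta>"
        using ZE AE_space by eventually_elim (auto simp: Gn_def intro: sample_close[OF n])
    qed (use C hb \<eta> in auto)
    \<comment> \<open>Restates the smallness condition of \<open>far_pair\<close> as an upper bound
      for \<open>s n\<close>.\<close>
    define s1 where "s1 = 3 * a $ first * (1 - E.q) / (4 * K)"
    have s1: "s1 > 0" unfolding s1_def using a_pos[of first] E.q_less_1 K by simp
    have "eventually (\<lambda>n. measure M (Gn n) > 1 - \<eta>) sequentially"
      using lim_good PG' by (rule order_tendstoD)
    moreover have "eventually (\<lambda>n. dist (\<integral>\<omega>. h (V n \<omega>) \<partial>M) (\<integral>\<omega>. h (V' \<omega>) \<partial>M') < \<eta>) sequentially"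
      using lim_h \<eta> by (rule tendstoD)
    ultimately have "eventually (\<lambda>n. norm ((\<integral>\<omega>. g (W n \<omega>) \<partial>M) - (\<integral>\<omega>. g (W' \<omega>) \<partial>M')) < r) sequentially"
      using s_lim[OF s0] s_lim[OF s1] eventually_ge_at_top[of 1]
    proof eventually_elim
      case (elim n)
      have "4 * s n * K < 3 * a $ first * (1 - E.q)"
        using elim(4) K by (simp add: s1_def pos_less_divide_eq mult_ac)
      note b1 = est[OF elim(5) elim(3) this]
      have "2 * C * (1 - measure M (Gn n)) \<le> 2 * C * \<eta>" "2 * C * (1 - measure M' G') \<le> 2 * C * \<eta>"
        using elim(1) PG' C0 by (auto intro!: mult_left_mono)
      moreover have "\<eta> + 2 * C * \<eta> + \<eta> + (\<eta> + 2 * C * \<eta>) < r"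
      proof -
        have "\<eta> + 2 * C * \<eta> + \<eta> + (\<eta> + 2 * C * \<eta>) < 4 * (C + 1) * \<eta>" using \<eta> by (simp add: algebra_simps)
        also have "\<dots> = r" using C0 by (simp add: \<eta>_def)
        finally show ?thesis .
      qed
      ultimately show ?case
        using b1 est' elim(2) unfolding dist_real_def real_norm_def by linarith
    qed
    thus "\<exists>no. \<forall>n\<ge>no. norm ((\<integral>\<omega>. g (W n \<omega>) \<partial>M) - (\<integral>\<omega>. g (W' \<omega>) \<partial>M')) < r"
      by (simp add: eventually_sequentially)
  qed
  have "converges_in_distribution M W M' W'"
    unfolding converges_in_distribution_def using Wm W'm conv by blast
  thus ?thesis unfolding W_def W'_def arr_def v_def I_def \<gamma>_def .
qed

end
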